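(* Let $\Gamma$ be a countable directed graph, $F:\Gamma_{Ar}\to\mathbb R$ a potential, $\beta\in\mathbb R$, and $v_0\in\Gamma_V$ a vertex such that $0<\sum_{n=0}^\infty A(\beta)^n_{v_0,v}<\infty$ for all $v\in\Gamma_V$. The map $\nu\mapsto m$ defined by $$m=\int_{Y_\beta}m_y\ \mathrm d\nu(y)$$ is an affine bijection between the set of Borel probability measures $\nu$ on $Y_\beta$ and the set $M^{v_0}_{\beta F}(\Gamma)$ of $v_0$-normalized $e^{\beta F}$-conformal measures $m$ on $P(\Gamma)$.
   Context: A countable directed graph $\Gamma$ consists of countable sets $\Gamma_V$ (vertices) and $\Gamma_{Ar}$ (arrows) with source and range maps $s,r:\Gamma_{Ar}\to\Gamma_V$ (multiple arrows and loops allowed). $P(\Gamma)$ is the set of infinite paths $p=(p_i)_{i\ge1}\in(\Gamma_{Ar})^{\mathbb N}$, $r(p_i)=s(p_{i+1})$, with the topology inherited from the product of discrete spaces (a Polish space); $Z(v)=\{p:s(p_1)=v\}$, $Z(a)=\{p:p_1=a\}$ for $a\in \Gamma_{Ar}$; the shift is $\sigma(p)_i=p_{i+1}$. $\mathrm{Ray}(\Gamma)$ is the set of infinite paths $p$ for which the vertices $s(p_i)$ are distinct. $A(\beta)_{v,w}=\sum_{a\in s^{-1}(v)\cap r^{-1}(w)}e^{-\beta F(a)}\in[0,\infty]$, with matrix powers $A(\beta)^n$, $A(\beta)^0$ the identity. A non-zero vector $\psi\in[0,\infty)^{\Gamma_V}$ is $A(\beta)$-harmonic if $\sum_wA(\beta)_{v,w}\psi_w=\psi_v$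 for all $v$; it is minimal if every $A(\beta)$-harmonic $\phi\le\psi$ is a multiple of $\psi$. A non-zero Borel measure $m$ on $P(\Gamma)$ with $m(Z(v))<\infty$ for all $v$ is $e^{\beta F}$-conformal if $m(\sigma(B\cap Z(a)))=e^{\beta F(a)}m(B\cap Z(a))$ for all arrows $a$ and Borel sets $B$; it is $v_0$-normalized if $m(Z(v_0))=1$. Martin kernel: $K_\beta(v,w)=\dfrac{\sum_{n=0}^\infty A(\beta)^n_{v,w}}{\sum_{n=0}^\infty A(\beta)^n_{v_0,w}}$. $X_\beta$ is the (Borel) set of $p\in P(\Gamma)$ such that $\psi_v=\lim_{k\to\infty}K_\beta(v,s(p_k))$ exists for all $v\in\Gamma_V$ and $\psi=(\psi_v)$ is a minimal $A(\beta)$-harmonic vector. $C_\beta=X_\beta\cap\mathrm{Ray}(\Gamma)\cap Z(v_0)$. For $p\in C_\beta$ let $K(p)=(\lim_{k\to\infty}K_\beta(v,s(p_k)))_{v\in\Gamma_V}$. For $y\in C_\beta$, $m_y$ is the unique $v_0$-normalized $e^{\beta F}$-conformal measure on $P(\Gamma)$ with $m_y(Z(v))=K(y)_v$ for all $v$. A subset of $P(\Gamma)$ is universally measurable if it is $\mu$-measurable for (the completion of) every $\sigma$-finite Borel measure $\mu$ on $P(\Gamma)$. There is a map $T:C_\beta\to C_\beta$ which is measurable with respect to the $\sigma$-algebra of universally measurable subsets of $C_\beta$ such that $K(T(p))=K(p)$ for all $p\in C_\beta$; $K(p)=K(q)\Leftrightarrow T(p)=T(q)$ for all $p,q\in C_\beta$;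 and $T(C_\beta)$ is universally measurable (this follows from a selection theorem of Burgess). Fix such a $T$ and set $Y_\beta=T(C_\beta)$. A Borel probability measure on $Y_\beta$ is a Borel probability measure $\nu$ on $P(\Gamma)$ for which there is a Borel set $B_\nu\subseteq Y_\beta$ with $\nu(B_\nu)=1$. The function $y\mapsto m_y(B)$ is Borel on $C_\beta$ for each Borel $B\subseteq P(\Gamma)$, and $\int_{Y_\beta}m_y\,\mathrm d\nu(y)$ is the measure $B\mapsto\int_{Y_\beta}m_y(B)\,\mathrm d\nu(y)$. *)

theory Defs
  imports "HOL-Probability.Probability" "Graph_Theory.Digraph"
begin

text \<open>Source and range of an arrow are \<^const>\<open>tail\<close> and \<^const>\<open>head\<close>.\<close>

locale countable_digraph = wf_digraph +
  assumes countable_verts: "countable (verts G)"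
    and countable_arcs: "countable (arcs G)"

section \<open>The path space\<close>

text \<open>Paths are indexed from 0, i.e. \<open>p i\<close> is the arrow $p_{i+1}$.\<close>

definition inf_paths :: "('v, 'a) pre_digraph \<Rightarrow> (nat \<Rightarrow> 'a) set" where
  "inf_paths G = {p. \<forall>i. p i \<in> arcs G \<and> head G (p i) = tail G (p (Suc i))}"

definition path_topology :: "('v, 'a) pre_digraph \<Rightarrow> (nat \<Rightarrow> 'a) topology" where
  "path_topology G =
     subtopology (product_topology (\<lambda>_. discrete_topology (arcs G)) UNIV) (inf_paths G)"

text \<open>The Borel \<open>\<sigma>\<close>-algebra; only \<^const>\<open>space\<close> and \<^const>\<open>sets\<close> of this measure matter.\<close>

definition path_borel :: "('v, 'a) pre_digraph \<Rightarrow> (nat \<Rightarrow> 'a) measure" where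
  "path_borel G = sigma (inf_paths G) {U. openin (path_topology G) U}"

definition vertex_cyl :: "('v, 'a) pre_digraph \<Rightarrow> 'v \<Rightarrow> (nat \<Rightarrow> 'a) set" where
  "vertex_cyl G v = {p \<in> inf_paths G. tail G (p 0) = v}"

definition arrow_cyl :: "('v, 'a) pre_digraph \<Rightarrow> 'a \<Rightarrow> (nat \<Rightarrow> 'a) set" where
  "arrow_cyl G a = {p \<in> inf_paths G. p 0 = a}"

definition path_shift :: "(nat \<Rightarrow> 'a) \<Rightarrow> nat \<Rightarrow> 'a" where
  "path_shift p = (\<lambda>i. p (Suc i))"

definition rays :: "('v, 'a) pre_digraph \<Rightarrow> (nat \<Rightarrow> 'a) set" where
  "rays G = {p \<in> inf_paths G. inj (\<lambda>i. tail G (p i))}"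

section \<open>Harmonic vectors\<close>

text \<open>Sums of non-negative terms over index sets are integrals against \<^const>\<open>count_space\<close>.\<close>

definition trans_mat ::
    "('v, 'a) pre_digraph \<Rightarrow> ('a \<Rightarrow> real) \<Rightarrow> real \<Rightarrow> 'v \<Rightarrow> 'v \<Rightarrow> ennreal" where
  "trans_mat G F \<beta> v w =
     (\<integral>\<^sup>+ a. ennreal (exp (- \<beta> * F a)) \<partial>count_space {a \<in> arcs G. tail G a = v \<and> head G a = w})"

fun mat_pow ::
    "('v, 'a) pre_digraph \<Rightarrow> ('a \<Rightarrow> real) \<Rightarrow> real \<Rightarrow> nat \<Rightarrow> 'v \<Rightarrow> 'v \<Rightarrow> ennreal" where
  "mat_pow G F \<beta> 0 v w = (if v = w then 1 else 0)"
| "mat_pow G F \<beta> (Suc n) v w =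
     (\<integral>\<^sup>+ u. trans_mat G F \<beta> v u * mat_pow G F \<beta> n u w \<partial>count_space (verts G))"

definition green ::
    "('v, 'a) pre_digraph \<Rightarrow> ('a \<Rightarrow> real) \<Rightarrow> real \<Rightarrow> 'v \<Rightarrow> 'v \<Rightarrow> ennreal" where
  "green G F \<beta> v w = (\<Sum>n. mat_pow G F \<beta> n v w)"

text \<open>Vectors in $[0,\infty)^{\Gamma_V}$ are \<^typ>\<open>ennreal\<close>-valued functions that are finite on
  the vertices; values off the vertex set are irrelevant.\<close>

definition harmonic ::
    "('v, 'a) pre_digraph \<Rightarrow> ('a \<Rightarrow> real) \<Rightarrow> real \<Rightarrow> ('v \<Rightarrow> ennreal) \<Rightarrow> bool" where
  "harmonic G F \<beta> \<psi> \<longleftrightarrow>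
     (\<forall>v\<in>verts G. \<psi> v < \<infinity>) \<and>
     (\<exists>v\<in>verts G. \<psi> v \<noteq> 0) \<and>
     (\<forall>v\<in>verts G. (\<integral>\<^sup>+ w. trans_mat G F \<beta> v w * \<psi> w \<partial>count_space (verts G)) = \<psi> v)"

definition minimal_harmonic ::
    "('v, 'a) pre_digraph \<Rightarrow> ('a \<Rightarrow> real) \<Rightarrow> real \<Rightarrow> ('v \<Rightarrow> ennreal) \<Rightarrow> bool" where
  "minimal_harmonic G F \<beta> \<psi> \<longleftrightarrow>
     harmonic G F \<beta> \<psi> \<and>
     (\<forall>\<phi>. harmonic G F \<beta> \<phi> \<and> (\<forall>v\<in>verts G. \<phi> v \<le> \<psi> v) \<longrightarrow>
        (\<exists>c::real. c \<ge> 0 \<and> (\<forall>v\<in>verts G. \<phi> v = ennreal c * \<psi> v)))"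

section \<open>Conformal measures\<close>

definition conformal ::
    "('v, 'a) pre_digraph \<Rightarrow> ('a \<Rightarrow> real) \<Rightarrow> real \<Rightarrow> (nat \<Rightarrow> 'a) measure \<Rightarrow> bool" where
  "conformal G F \<beta> m \<longleftrightarrow>
     sets m = sets (path_borel G) \<and>
     emeasure m (inf_paths G) \<noteq> 0 \<and>
     (\<forall>v\<in>verts G. emeasure m (vertex_cyl G v) < \<infinity>) \<and>
     (\<forall>a\<in>arcs G. \<forall>B\<in>sets (path_borel G).
        emeasure m (path_shift ` (B \<inter> arrow_cyl G a)) =
        ennreal (exp (\<beta> * F a)) * emeasure m (B \<inter> arrow_cyl G a))"

definition normalized_conformal ::
    "('v, 'a) pre_digraph \<Rightarrow> ('a \<Rightarrow> real) \<Rightarrow> real \<Rightarrow> 'v \<Rightarrow> (nat \<Rightarrow> 'a) measure set" where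
  "normalized_conformal G F \<beta> v0 =
     {m. conformal G F \<beta> m \<and> emeasure m (vertex_cyl G v0) = 1}"

section \<open>The Martin kernel and its limits along rays\<close>

definition martin_kernel ::
    "('v, 'a) pre_digraph \<Rightarrow> ('a \<Rightarrow> real) \<Rightarrow> real \<Rightarrow> 'v \<Rightarrow> 'v \<Rightarrow> 'v \<Rightarrow> ennreal" where
  "martin_kernel G F \<beta> v0 v w = green G F \<beta> v w / green G F \<beta> v0 w"

text \<open>Restricting to the vertex set makes equality of functions equality of vectors.\<close>

definition martin_limit ::
    "('v, 'a) pre_digraph \<Rightarrow> ('a \<Rightarrow> real) \<Rightarrow> real \<Rightarrow> 'v \<Rightarrow> (nat \<Rightarrow> 'a) \<Rightarrow> 'v \<Rightarrow> ennreal" where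
  "martin_limit G F \<beta> v0 p =
     (\<lambda>v\<in>verts G. lim (\<lambda>k. martin_kernel G F \<beta> v0 v (tail G (p k))))"

definition X_set ::
    "('v, 'a) pre_digraph \<Rightarrow> ('a \<Rightarrow> real) \<Rightarrow> real \<Rightarrow> 'v \<Rightarrow> (nat \<Rightarrow> 'a) set" where
  "X_set G F \<beta> v0 =
     {p \<in> inf_paths G.
        (\<forall>v\<in>verts G. convergent (\<lambda>k. martin_kernel G F \<beta> v0 v (tail G (p k)))) \<and>
        minimal_harmonic G F \<beta> (martin_limit G F \<beta> v0 p)}"

definition C_set ::
    "('v, 'a) pre_digraph \<Rightarrow> ('a \<Rightarrow> real) \<Rightarrow> real \<Rightarrow> 'v \<Rightarrow> (nat \<Rightarrow> 'a) set" where
  "C_set G F \<beta> v0 = X_set G F \<beta> v0 \<inter> rays G \<inter> vertex_cyl G v0"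

definition ray_measure ::
    "('v, 'a) pre_digraph \<Rightarrow> ('a \<Rightarrow> real) \<Rightarrow> real \<Rightarrow> 'v \<Rightarrow> (nat \<Rightarrow> 'a) \<Rightarrow> (nat \<Rightarrow> 'a) measure" where
  "ray_measure G F \<beta> v0 y =
     (THE m. m \<in> normalized_conformal G F \<beta> v0 \<and>
        (\<forall>v\<in>verts G. emeasure m (vertex_cyl G v) = martin_limit G F \<beta> v0 y v))"

section \<open>Selections\<close>

definition universally_measurable ::
    "('v, 'a) pre_digraph \<Rightarrow> (nat \<Rightarrow> 'a) set \<Rightarrow> bool" where
  "universally_measurable G A \<longleftrightarrow>
     A \<subseteq> inf_paths G \<and>
     (\<forall>\<mu>. sets \<mu> = sets (path_borel G) \<and> sigma_finite_measure \<mu> \<longrightarrow> A \<in> sets (completion \<mu>))"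

text \<open>Measurability of \<open>T\<close> is required for Borel sets in the codomain; preimages of universally
  measurable sets are then universally measurable as well.\<close>

definition martin_selection ::
    "('v, 'a) pre_digraph \<Rightarrow> ('a \<Rightarrow> real) \<Rightarrow> real \<Rightarrow> 'v \<Rightarrow> ((nat \<Rightarrow> 'a) \<Rightarrow> nat \<Rightarrow> 'a) \<Rightarrow> bool" where
  "martin_selection G F \<beta> v0 T \<longleftrightarrow>
     T \<in> C_set G F \<beta> v0 \<rightarrow> C_set G F \<beta> v0 \<and>
     (\<forall>B\<in>sets (path_borel G). universally_measurable G (T -` B \<inter> C_set G F \<beta> v0)) \<and>
     (\<forall>p\<in>C_set G F \<beta> v0. martin_limit G F \<beta> v0 (T p) = martin_limit G F \<beta> v0 p) \<and>
     (\<forall>p\<in>C_set G F \<beta> v0. \<forall>q\<in>C_set G F \<beta> v0.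
        martin_limit G F \<beta> v0 p = martin_limit G F \<beta> v0 q \<longleftrightarrow> T p = T q) \<and>
     universally_measurable G (T ` C_set G F \<beta> v0)"

section \<open>Integrating the measures of rays\<close>

definition borel_probs_on ::
    "('v, 'a) pre_digraph \<Rightarrow> (nat \<Rightarrow> 'a) set \<Rightarrow> (nat \<Rightarrow> 'a) measure set" where
  "borel_probs_on G Y =
     {\<nu>. sets \<nu> = sets (path_borel G) \<and> prob_space \<nu> \<and>
        (\<exists>B\<in>sets (path_borel G). B \<subseteq> Y \<and> emeasure \<nu> B = 1)}"

text \<open>The set \<open>Y\<close> need not be Borel, hence the completion. Note that \<^const>\<open>measure_of\<close> yields the
  zero measure if the given set function is not a measure; the zero measure is not conformal.\<close>

definition integrated_measure ::
    "('v, 'a) pre_digraph \<Rightarrow> ('a \<Rightarrow> real) \<Rightarrow> real \<Rightarrow> 'v \<Rightarrow> (nat \<Rightarrow> 'a) set \<Rightarrow>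
     (nat \<Rightarrow> 'a) measure \<Rightarrow> (nat \<Rightarrow> 'a) measure" where
  "integrated_measure G F \<beta> v0 Y \<nu> =
     measure_of (inf_paths G) (sets (path_borel G))
       (\<lambda>B. \<integral>\<^sup>+ y\<in>Y. emeasure (ray_measure G F \<beta> v0 y) B \<partial>completion \<nu>)"

definition convex_comb :: "real \<Rightarrow> 'b measure \<Rightarrow> 'b measure \<Rightarrow> 'b measure" where
  "convex_comb t \<mu> \<nu> =
     measure_of (space \<mu>) (sets \<mu>)
       (\<lambda>B. ennreal t * emeasure \<mu> B + ennreal (1 - t) * emeasure \<nu> B)"

definition affine_measure_map :: "'b measure set \<Rightarrow> ('b measure \<Rightarrow> 'c measure) \<Rightarrow> bool" where
  "affine_measure_map D \<Phi> \<longleftrightarrow>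
     (\<forall>\<mu>\<in>D. \<forall>\<nu>\<in>D. \<forall>t\<in>{0..1}.
        convex_comb t \<mu> \<nu> \<in> D \<and>
        \<Phi> (convex_comb t \<mu> \<nu>) = convex_comb t (\<Phi> \<mu>) (\<Phi> \<nu>))"

end

theory Submission
  imports Defs
begin

text \<open>
  A conformal measure is determined by its masses on the vertex cylinders, these masses form a
  vector fixed by the transition matrix, and every such vector arises in this way
  (\<open>semi_conformal_eqI\<close>, \<open>conformal_measure_exists\<close>). The theorem is
  therefore a Poisson-Martin representation of harmonic vectors, with limits of the Martin kernel
  along rays in the role of boundary points. No compactification and no martingale theory enters
  the proof.

  Everything rests on a last-exit identity. Let $D$ be a shift-invariant set of paths that visit
  each vertex only finitely often, and $W$ a finite set of vertices. Splitting a path by its last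
  visit to $W$ gives $m(Z(v) \cap D \cap \{\text{the path meets } W\}) = \sum_{w \in W}
  G(v,w)\,e(w)$, where $e(w)$ does not depend on $v$. If every path of $D$ meets the set of
  vertices $w$ with $K(v,w) \le a$, it follows that $m(Z(v) \cap D) \le a\, m(Z(v_0) \cap D)$, and
  likewise for lower bounds (\<open>hitting_comparison\<close>). For the set $D$ of paths along
  which $K(v,\cdot)$ oscillates across an interval, the two bounds contradict each other unless
  $D$ is null; so the kernel converges almost everywhere (\<open>AE_kernel_converges\<close>). For
  the level sets of the limit $k_v$ they give $m(Z(v) \cap D) = \int_{Z(v_0) \cap D} k_v \, dm$
  (\<open>invariant_integral\<close>).

  Consequently the limit vector $k(p)$ is harmonic for almost every $p$, and $m$ is the mixture of
  the conformal measures $m_{k(p)}$, even after restriction to any invariant $D$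
  (\<open>disintegration\<close>). Taking for $D$ the sets where $k_v$ lies below or above a given
  number shows that $m_{k(p)}$ lives on paths with the same limit vector as $p$. A normalised
  harmonic vector is minimal exactly if its conformal measure lives on the paths that converge to
  it (\<open>minimal_harmonic_if_concentrated\<close>,
  \<open>concentrated_if_minimal_harmonic\<close>), so almost every path has a minimal limit.

  Erasing loops turns such a path from $v_0$ into a ray with the same limit. The law under $m$ of
  the ray that $T$ selects for this loop erasure is the representing measure of $m$
  (\<open>integrated_measure_surj\<close>). It is the only one: for $y \in Y_\beta$ the selected
  ray is $y$ almost surely under $m_y$, so the law obtained from a mixture $\int m_y \, d\nu(y)$
  is $\nu$ itself (\<open>integrated_measure_determines_le\<close>).
\<close>

section \<open>The Borel sets of the path space\<close>

context countable_digraph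
begin

abbreviation paths :: "(nat \<Rightarrow> 'b) set" where
  "paths \<equiv> inf_paths G"

abbreviation cyl :: "'a \<Rightarrow> (nat \<Rightarrow> 'b) set" where
  "cyl \<equiv> vertex_cyl G"

abbreviation path_sets :: "(nat \<Rightarrow> 'b) set set" where
  "path_sets \<equiv> sets (path_borel G)"

text \<open>Fixing the source of the first arrow makes the case \<open>n = 0\<close> a whole vertex
  cylinder. These sets have finite conformal measure, cover the path space, and together with the
  empty set form a generator that is stable under intersection.\<close>

definition zcyl :: "nat \<Rightarrow> (nat \<Rightarrow> 'b) \<Rightarrow> (nat \<Rightarrow> 'b) set" where
  "zcyl n x = {p \<in> paths. tail G (p 0) = tail G (x 0) \<and> (\<forall>i<n. p i = x i)}"

definition zcyls :: "(nat \<Rightarrow> 'b) set set" where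
  "zcyls = insert {} (\<Union>n. zcyl n ` paths)"

lemma inf_paths_arcs: "p \<in> paths \<Longrightarrow> p i \<in> arcs G"
  and inf_paths_step: "p \<in> paths \<Longrightarrow> tail G (p (Suc i)) = head G (p i)"
  by (auto simp: inf_paths_def)

lemma inf_paths_tail: "p \<in> paths \<Longrightarrow> tail G (p i) \<in> verts G"
  by (auto simp: inf_paths_arcs)

lemma shift_in_paths: "p \<in> paths \<Longrightarrow> path_shift p \<in> paths"
  by (auto simp: inf_paths_def path_shift_def)

lemma cons_in_paths:
  "p \<in> paths \<Longrightarrow> a \<in> arcs G \<Longrightarrow> head G a = tail G (p 0) \<Longrightarrow> case_nat a p \<in> paths"
  by (auto simp: inf_paths_def split: nat.split)

lemma shift_cons [simp]: "path_shift (case_nat a p) = p"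
  by (auto simp: path_shift_def)

lemma cons_shift: "p 0 = a \<Longrightarrow> case_nat a (path_shift p) = p"
  by (auto simp: path_shift_def fun_eq_iff split: nat.split)

lemma zcyl_subset: "zcyl n x \<subseteq> paths"
  by (auto simp: zcyl_def)

lemma zcyl_self: "x \<in> paths \<Longrightarrow> x \<in> zcyl n x"
  by (auto simp: zcyl_def)

lemma zcyl_0: "zcyl 0 x = cyl (tail G (x 0))"
  by (auto simp: zcyl_def vertex_cyl_def)

lemma zcyl_Suc:
  assumes "x \<in> paths"
  shows "zcyl (Suc n) x = {p \<in> arrow_cyl G (x 0). path_shift p \<in> zcyl n (path_shift x)}"
  using assms
  by (auto simp: zcyl_def arrow_cyl_def path_shift_def shift_in_paths[unfolded path_shift_def]
      inf_paths_step All_less_Suc2)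

lemma topspace_path_topology: "topspace (path_topology G) = paths"
  by (auto simp: path_topology_def inf_paths_def)

lemma space_path_borel [simp]: "space (path_borel G) = paths"
  unfolding path_borel_def
  by (rule space_measure_of) (use openin_subset topspace_path_topology in blast)

lemma sets_path_borel: "path_sets = sigma_sets paths {U. openin (path_topology G) U}"
  unfolding path_borel_def
  by (rule sets_measure_of) (use openin_subset topspace_path_topology in blast)

lemma openin_zcyl: "openin (path_topology G) (zcyl n x)"
proof -
  define U where "U i = {a \<in> arcs G. (i = 0 \<longrightarrow> tail G a = tail G (x 0)) \<and> (i < n \<longrightarrow> a = x i)}" for i :: nat
  have "openin (product_topology (\<lambda>_. discrete_topology (arcs G)) UNIV) (PiE UNIV U)"
  proof (rule product_topology_basis)
    show "finite {i. U i \<noteq> topspace (discrete_topology (arcs G))}"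
      by (rule finite_subset[of _ "{..n}"]) (auto simp: U_def not_le)
  qed (auto simp: U_def)
  moreover have "zcyl n x = PiE UNIV U \<inter> paths"
    by (auto simp: zcyl_def U_def PiE_def Pi_def inf_paths_arcs)
  ultimately show ?thesis
    unfolding path_topology_def openin_subtopology by blast
qed

lemma zcyl_base:
  assumes "openin (path_topology G) S" "p \<in> S"
  shows "\<exists>n. zcyl n p \<subseteq> S"
proof -
  obtain T where T: "openin (product_topology (\<lambda>_. discrete_topology (arcs G)) UNIV) T"
      "S = T \<inter> paths"
    using assms(1) unfolding path_topology_def openin_subtopology by auto
  then obtain U where U: "finite {i. U i \<noteq> arcs G}" "p \<in> PiE UNIV U" "PiE UNIV U \<subseteq> T"
    using assms(2) unfolding openin_product_topology_alt by auto
  then obtain m where m: "\<And>i. U i \<noteq> arcs G \<Longrightarrow> i < m"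
    unfolding finite_nat_set_iff_bounded by auto
  have "zcyl m p \<subseteq> S"
  proof
    fix q assume q: "q \<in> zcyl m p"
    have "q i \<in> U i" for i
    proof (cases "i < m")
      case True
      then show ?thesis using q U(2) by (auto simp: zcyl_def)
    next
      case False
      then have "U i = arcs G" using m by blast
      then show ?thesis using q by (auto simp: zcyl_def inf_paths_arcs)
    qed
    then show "q \<in> S" using U(3) T(2) q by (auto simp: zcyl_def)
  qed
  then show ?thesis ..
qed

text \<open>A cylinder is determined by a finite word over the countable set of arrows. The word has length
  \<open>Suc n\<close>, because the source of the first arrow matters for \<open>n = 0\<close> as
  well.\<close>

lemma countable_zcyls: "countable zcyls"
proof -
  define g where "g n l = {p \<in> paths. tail G (p 0) = tail G (l ! 0) \<and> (\<forall>i<n. p i = l ! i)}"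
    for n :: nat and l :: "'b list"
  have "zcyl n ` paths \<subseteq> g n ` lists (arcs G)" for n
  proof
    fix Z assume "Z \<in> zcyl n ` paths"
    then obtain x where x: "x \<in> paths" "Z = zcyl n x" by auto
    have "map x [0..<Suc n] \<in> lists (arcs G)"
      using x(1) by (auto simp: inf_paths_arcs)
    moreover have "g n (map x [0..<Suc n]) = Z"
      by (simp add: x(2) g_def zcyl_def nth_append del: upt_Suc cong: conj_cong)
    ultimately show "Z \<in> g n ` lists (arcs G)" by blast
  qed
  then have "countable (zcyl n ` paths)" for n
    by (rule countable_subset) (simp add: countable_arcs)
  then show ?thesis by (auto simp: zcyls_def)
qed

lemma sets_path_borel_zcyls: "path_sets = sigma_sets paths zcyls"
  unfolding sets_path_borel
proof (rule sigma_sets_eqI)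
  fix S assume "S \<in> {U. openin (path_topology G) U}"
  then have S: "openin (path_topology G) S" by simp
  then have "S \<subseteq> paths" using openin_subset topspace_path_topology by blast
  have "S = \<Union>{Z \<in> zcyls. Z \<subseteq> S}"
  proof (intro equalityI subsetI)
    fix p assume p: "p \<in> S"
    then obtain n where n: "zcyl n p \<subseteq> S" using zcyl_base[OF S] by blast
    have "p \<in> paths" using p \<open>S \<subseteq> paths\<close> by blast
    then have "zcyl n p \<in> zcyls" "p \<in> zcyl n p" by (auto simp: zcyls_def zcyl_self)
    then show "p \<in> \<Union>{Z \<in> zcyls. Z \<subseteq> S}" using n by blast
  qed auto
  moreover have "\<Union>{Z \<in> zcyls. Z \<subseteq> S} \<in> sigma_sets paths zcyls"
    by (rule sigma_sets_UNION) (auto intro: countable_subset[OF _ countable_zcyls])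
  ultimately show "S \<in> sigma_sets paths zcyls" by simp
next
  fix Z assume "Z \<in> zcyls"
  then show "Z \<in> sigma_sets paths {U. openin (path_topology G) U}"
    by (auto simp: zcyls_def openin_zcyl)
qed

lemma zcyls_Pow: "zcyls \<subseteq> Pow paths"
  using zcyl_subset by (auto simp: zcyls_def)

text \<open>As for balls in an ultrametric space, every point of a cylinder is a centre of it.\<close>

lemma zcyl_inter:
  assumes "z \<in> zcyl n x" "z \<in> zcyl m y"
  shows "zcyl n x \<inter> zcyl m y = zcyl (max n m) z"
proof -
  have x: "z i = x i" if "i < n" for i using assms that by (auto simp: zcyl_def)
  have y: "z i = y i" if "i < m" for i using assms that by (auto simp: zcyl_def)
  show ?thesis
    using assms by (auto simp: zcyl_def less_max_iff_disj)
qed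

lemma Int_stable_zcyls: "Int_stable zcyls"
proof (rule Int_stableI)
  fix A B assume A: "A \<in> zcyls" and B: "B \<in> zcyls"
  show "A \<inter> B \<in> zcyls"
  proof (cases "A \<inter> B = {}")
    case False
    then obtain z where z: "z \<in> A" "z \<in> B" by auto
    obtain n x m y where "A = zcyl n x" "B = zcyl m y" using A B z by (auto simp: zcyls_def)
    then show ?thesis
      using zcyl_inter[of z n x m y] z zcyl_subset[of n x] by (auto simp: zcyls_def)
  qed (simp add: zcyls_def)
qed

lemma sets_zcyl [measurable]: "zcyl n x \<in> path_sets"
  unfolding sets_path_borel by (auto simp: openin_zcyl)

lemma measurable_into_path_borel:
  assumes "\<And>p. p \<in> space M \<Longrightarrow> f p \<in> paths"
    and "\<And>n x. x \<in> paths \<Longrightarrow> {p \<in> space M. f p \<in> zcyl n x} \<in> sets M"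
  shows "f \<in> measurable M (path_borel G)"
proof (rule measurable_sigma_sets[OF sets_path_borel_zcyls zcyls_Pow])
  show "f \<in> space M \<rightarrow> paths" using assms(1) by auto
  fix Z assume "Z \<in> zcyls"
  then consider "Z = {}" | n x where "x \<in> paths" "Z = zcyl n x"
    by (auto simp: zcyls_def)
  then show "f -` Z \<inter> space M \<in> sets M"
  proof cases
    case 2
    have "f -` Z \<inter> space M = {p \<in> space M. f p \<in> zcyl n x}" using 2 by auto
    then show ?thesis using assms(2)[OF 2(1)] by simp
  qed simp
qed

lemma measurable_coord: "(\<lambda>p. p i) \<in> measurable (path_borel G) (count_space (arcs G))"
  unfolding measurable_count_space_eq_countable[OF countable_arcs]
proof (intro conjI ballI)
  show "(\<lambda>p. p i) \<in> space (path_borel G) \<rightarrow> arcs G" by (auto simp: inf_paths_arcs)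
  fix a
  let ?S = "(\<lambda>p. p i) -` {a} \<inter> space (path_borel G)"
  have "?S = \<Union>{Z \<in> zcyls. Z \<subseteq> ?S}"
  proof (intro equalityI subsetI)
    fix p assume p: "p \<in> ?S"
    then have "zcyl (Suc i) p \<in> {Z \<in> zcyls. Z \<subseteq> ?S}" by (auto simp: zcyls_def zcyl_def)
    moreover have "p \<in> zcyl (Suc i) p" using p zcyl_self by auto
    ultimately show "p \<in> \<Union>{Z \<in> zcyls. Z \<subseteq> ?S}" by blast
  qed auto
  moreover have "\<Union>{Z \<in> zcyls. Z \<subseteq> ?S} \<in> sigma_sets paths zcyls"
    by (rule sigma_sets_UNION) (auto intro: countable_subset[OF _ countable_zcyls])
  ultimately show "?S \<in> path_sets" unfolding sets_path_borel_zcyls by metis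
qed

lemma measurable_coord_fun:
  assumes "\<And>a. a \<in> arcs G \<Longrightarrow> f a \<in> space N"
  shows "(\<lambda>p. f (p i)) \<in> measurable (path_borel G) N"
  by (rule measurable_compose[OF measurable_coord]) (use assms in auto)

lemma measurable_tail [measurable]:
  "(\<lambda>p. tail G (p i)) \<in> measurable (path_borel G) (count_space UNIV)"
  by (rule measurable_coord_fun) auto

lemma measurable_coord_UNIV [measurable]:
  "(\<lambda>p. p i) \<in> measurable (path_borel G) (count_space UNIV)"
  by (rule measurable_coord_fun) auto

lemma measurable_shift [measurable]: "path_shift \<in> measurable (path_borel G) (path_borel G)"
proof (rule measurable_into_path_borel)
  fix n x
  have "{p \<in> space (path_borel G). path_shift p \<in> zcyl n x} =
      {p \<in> space (path_borel G). tail G (p 1) = tail G (x 0) \<and> (\<forall>i<n. p (Suc i) = x i)}"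
    by (auto simp: zcyl_def path_shift_def shift_in_paths[unfolded path_shift_def])
  also have "\<dots> \<in> path_sets" by measurable
  finally show "{p \<in> space (path_borel G). path_shift p \<in> zcyl n x} \<in> path_sets" .
qed (auto simp: shift_in_paths)

lemma sets_vertex_cyl [measurable]: "cyl v \<in> path_sets"
proof -
  have "cyl v = {p \<in> space (path_borel G). tail G (p 0) = v}"
    by (auto simp: vertex_cyl_def)
  also have "\<dots> \<in> path_sets" by measurable
  finally show ?thesis .
qed

lemma sets_arrow_cyl [measurable]: "arrow_cyl G a \<in> path_sets"
proof -
  have "arrow_cyl G a = {p \<in> space (path_borel G). p 0 = a}"
    by (auto simp: arrow_cyl_def)
  also have "\<dots> \<in> path_sets" by measurable
  finally show ?thesis .
qed

lemma inf_paths_eq_Union: "paths = (\<Union>v\<in>verts G. cyl v)"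
  by (auto simp: vertex_cyl_def inf_paths_tail)

lemma disjoint_vertex_cyl: "disjoint_family_on cyl I"
  by (auto simp: disjoint_family_on_def vertex_cyl_def)

lemma emeasure_vertex_cyl_sum:
  assumes [measurable_cong]: "sets m = path_sets" and [measurable]: "B \<in> path_sets"
  shows "emeasure m B = (\<integral>\<^sup>+v. emeasure m (cyl v \<inter> B) \<partial>count_space (verts G))"
proof -
  have "B = (\<Union>v\<in>verts G. cyl v \<inter> B)"
    using sets.sets_into_space[OF assms(2)] by (auto simp: inf_paths_eq_Union)
  then have "emeasure m B = emeasure m (\<Union>v\<in>verts G. cyl v \<inter> B)" by simp
  also have "\<dots> = (\<integral>\<^sup>+v. emeasure m (cyl v \<inter> B) \<partial>count_space (verts G))"
    by (rule emeasure_UN_countable)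
      (use countable_verts disjoint_vertex_cyl[of "verts G"] in \<open>auto simp: disjoint_family_on_def\<close>)
  finally show ?thesis .
qed

end

section \<open>Mixtures of measures and sums over arrows\<close>

text \<open>The measures that are mixed are only $\sigma$-finite in general, so the monadic bind for
  subprobability kernels does not apply.\<close>

definition mixture :: "'i measure \<Rightarrow> 'b measure \<Rightarrow> ('i \<Rightarrow> 'b measure) \<Rightarrow> 'b measure" where
  "mixture N M \<kappa> = measure_of (space M) (sets M) (\<lambda>B. \<integral>\<^sup>+y. emeasure (\<kappa> y) B \<partial>N)"

lemma sets_mixture [simp]: "sets (mixture N M \<kappa>) = sets M"
  and space_mixture [simp]: "space (mixture N M \<kappa>) = space M"
  by (simp_all add: mixture_def)

lemma emeasure_mixture:
  fixes M :: "'b measure"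
  assumes \<kappa>: "\<And>y. y \<in> space N \<Longrightarrow> sets (\<kappa> y) = sets M"
    and meas: "\<And>B. B \<in> sets M \<Longrightarrow> (\<lambda>y. emeasure (\<kappa> y) B) \<in> borel_measurable N"
    and B: "B \<in> sets M"
  shows "emeasure (mixture N M \<kappa>) B = (\<integral>\<^sup>+y. emeasure (\<kappa> y) B \<partial>N)"
  unfolding mixture_def
proof (rule emeasure_measure_of_sigma[OF sets.sigma_algebra_axioms _ _ B])
  show "positive (sets M) (\<lambda>B. \<integral>\<^sup>+y. emeasure (\<kappa> y) B \<partial>N)"
    by (simp add: positive_def)
  show "countably_additive (sets M) (\<lambda>B. \<integral>\<^sup>+y. emeasure (\<kappa> y) B \<partial>N)"
  proof (rule countably_additiveI)
    fix A :: "nat \<Rightarrow> 'b set"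
    assume A: "range A \<subseteq> sets M" "disjoint_family A" "(\<Union>i. A i) \<in> sets M"
    have "(\<Sum>i. \<integral>\<^sup>+y. emeasure (\<kappa> y) (A i) \<partial>N) = (\<integral>\<^sup>+y. (\<Sum>i. emeasure (\<kappa> y) (A i)) \<partial>N)"
      by (rule nn_integral_suminf[symmetric]) (use A meas in auto)
    also have "\<dots> = (\<integral>\<^sup>+y. emeasure (\<kappa> y) (\<Union>i. A i) \<partial>N)"
      by (intro nn_integral_cong suminf_emeasure) (use A \<kappa> in auto)
    finally show "(\<Sum>i. \<integral>\<^sup>+y. emeasure (\<kappa> y) (A i) \<partial>N) = (\<integral>\<^sup>+y. emeasure (\<kappa> y) (\<Union>i. A i) \<partial>N)" .
  qed
qed

lemma nn_integral_fibres:
  fixes f :: "'c \<Rightarrow> ennreal"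
  assumes "h ` A \<subseteq> W"
  shows "(\<integral>\<^sup>+w. (\<integral>\<^sup>+a. f a \<partial>count_space {a \<in> A. h a = w}) \<partial>count_space W) =
    (\<integral>\<^sup>+a. f a \<partial>count_space A)"
proof -
  define g where "g = (\<lambda>(w, a). f a * indicator A a * indicator {h a} w)"
  have "(\<integral>\<^sup>+w. (\<integral>\<^sup>+a. f a \<partial>count_space {a \<in> A. h a = w}) \<partial>count_space W) =
      (\<integral>\<^sup>+w. (\<integral>\<^sup>+a. g (w, a) \<partial>count_space UNIV) \<partial>count_space UNIV)"
  proof -
    have "(\<integral>\<^sup>+a. f a \<partial>count_space {a \<in> A. h a = w}) * indicator W w = (\<integral>\<^sup>+a. g (w, a) \<partial>count_space UNIV)" for w
    proof (cases "w \<in> W")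
      case True
      then show ?thesis
        unfolding nn_integral_count_space_indicator[of "{a \<in> A. h a = w}", unfolded NO_MATCH_def, OF TrueI]
        by (auto simp: g_def intro!: nn_integral_cong split: split_indicator)
    next
      case False
      then have "g (w, a) = 0" for a using assms by (auto simp: g_def split: split_indicator)
      then show ?thesis using False by simp
    qed
    then show ?thesis by (simp add: nn_integral_count_space_indicator[of W, unfolded NO_MATCH_def])
  qed
  also have "\<dots> = (\<integral>\<^sup>+a. (\<integral>\<^sup>+w. g (w, a) \<partial>count_space UNIV) \<partial>count_space UNIV)"
    by (simp add: nn_integral_fst_count_space nn_integral_snd_count_space)
  also have "\<dots> = (\<integral>\<^sup>+a. f a * indicator A a \<partial>count_space UNIV)"
    by (simp add: g_def nn_integral_cmult_indicator)
  also have "\<dots> = (\<integral>\<^sup>+a. f a \<partial>count_space A)"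
    by (simp add: nn_integral_count_space_indicator)
  finally show ?thesis .
qed

lemma nn_integral_count_space_single:
  fixes f :: "'c \<Rightarrow> ennreal"
  assumes "\<And>u. u \<in> S \<Longrightarrow> u \<noteq> v \<Longrightarrow> f u = 0"
  shows "(\<integral>\<^sup>+u. f u \<partial>count_space S) = (if v \<in> S then f v else 0)"
proof -
  have "(\<integral>\<^sup>+u. f u \<partial>count_space S) = (\<integral>\<^sup>+u. f v * indicator ({v} \<inter> S) u \<partial>count_space S)"
    using assms by (auto intro!: nn_integral_cong split: split_indicator)
  also have "\<dots> = f v * emeasure (count_space S) ({v} \<inter> S)"
    by (rule nn_integral_cmult_indicator) auto
  finally show ?thesis by simp
qed

section \<open>Conformal measures and invariant vectors\<close>

locale weighted_digraph = countable_digraph +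
  fixes F :: "'b \<Rightarrow> real" and \<beta> :: real
begin

abbreviation transition :: "'a \<Rightarrow> 'a \<Rightarrow> ennreal" where
  "transition \<equiv> trans_mat G F \<beta>"

abbreviation transition_pow :: "nat \<Rightarrow> 'a \<Rightarrow> 'a \<Rightarrow> ennreal" where
  "transition_pow \<equiv> mat_pow G F \<beta>"

abbreviation greens :: "'a \<Rightarrow> 'a \<Rightarrow> ennreal" where
  "greens \<equiv> green G F \<beta>"

definition arrow_wt :: "'b \<Rightarrow> ennreal" where
  "arrow_wt a = ennreal (exp (- \<beta> * F a))"

definition path_wt :: "nat \<Rightarrow> (nat \<Rightarrow> 'b) \<Rightarrow> ennreal" where
  "path_wt n x = (\<Prod>i<n. arrow_wt (x i))"

text \<open>Conformality through preimages of the shift, with the zero measure admitted: the class is then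
  closed under restriction to shift-invariant sets, which may be null.\<close>

definition semi_conformal :: "(nat \<Rightarrow> 'b) measure \<Rightarrow> bool" where
  "semi_conformal m \<longleftrightarrow>
     sets m = path_sets \<and>
     (\<forall>v\<in>verts G. emeasure m (cyl v) < \<infinity>) \<and>
     (\<forall>a\<in>arcs G. \<forall>B\<in>path_sets.
        emeasure m {p \<in> arrow_cyl G a. path_shift p \<in> B} =
        arrow_wt a * emeasure m (cyl (head G a) \<inter> B))"

text \<open>The zero vector is admitted for the same reason: differences of comparable vectors stay in the
  class.\<close>

definition invariant_vec :: "('a \<Rightarrow> ennreal) \<Rightarrow> bool" where
  "invariant_vec \<phi> \<longleftrightarrow>
     (\<forall>v\<in>verts G. \<phi> v < \<infinity>) \<and>
     (\<forall>v\<in>verts G. (\<integral>\<^sup>+ w. transition v w * \<phi> w \<partial>count_space (verts G)) = \<phi> v)"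

lemma harmonic_iff: "harmonic G F \<beta> \<phi> \<longleftrightarrow> invariant_vec \<phi> \<and> (\<exists>v\<in>verts G. \<phi> v \<noteq> 0)"
  by (auto simp: harmonic_def invariant_vec_def)

lemma semi_conformalD:
  assumes "semi_conformal m"
  shows "sets m = path_sets" "space m = paths"
    and "v \<in> verts G \<Longrightarrow> emeasure m (cyl v) < \<infinity>"
    and "a \<in> arcs G \<Longrightarrow> B \<in> path_sets \<Longrightarrow>
       emeasure m {p \<in> arrow_cyl G a. path_shift p \<in> B} =
       arrow_wt a * emeasure m (cyl (head G a) \<inter> B)"
proof -
  show "sets m = path_sets" using assms by (simp add: semi_conformal_def)
  then have "space m = space (path_borel G)" by (rule sets_eq_imp_space_eq)
  then show "space m = paths" by simp
qed (use assms in \<open>auto simp: semi_conformal_def\<close>)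

lemma sets_shift_vimage [measurable]:
  "B \<in> path_sets \<Longrightarrow> {p \<in> arrow_cyl G a. path_shift p \<in> B} \<in> path_sets"
proof -
  assume [measurable]: "B \<in> path_sets"
  have "{p \<in> arrow_cyl G a. path_shift p \<in> B} =
      {p \<in> space (path_borel G). p 0 = a \<and> path_shift p \<in> B}"
    by (auto simp: arrow_cyl_def)
  also have "\<dots> \<in> path_sets" by measurable
  finally show ?thesis .
qed

lemma shift_image_arrow_cyl:
  assumes "a \<in> arcs G" "B \<subseteq> paths"
  shows "path_shift ` {p \<in> arrow_cyl G a. path_shift p \<in> B} = cyl (head G a) \<inter> B"
proof (intro equalityI subsetI)
  fix q assume q: "q \<in> cyl (head G a) \<inter> B"
  then have "case_nat a q \<in> {p \<in> arrow_cyl G a. path_shift p \<in> B}"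
    using assms cons_in_paths[of q a] by (auto simp: arrow_cyl_def vertex_cyl_def)
  then show "q \<in> path_shift ` {p \<in> arrow_cyl G a. path_shift p \<in> B}"
    by (rule rev_image_eqI) simp
qed (use shift_in_paths inf_paths_step in \<open>force simp: arrow_cyl_def vertex_cyl_def path_shift_def\<close>)

text \<open>On an arrow cylinder the shift is injective, and prepending the arrow is a measurable inverse.\<close>

lemma sets_shift_image:
  assumes a: "a \<in> arcs G" and [measurable]: "B \<in> path_sets"
  shows "path_shift ` (B \<inter> arrow_cyl G a) \<in> path_sets"
proof -
  let ?R = "restrict_space (path_borel G) (cyl (head G a))"
  have Z: "cyl (head G a) \<in> path_sets" by measurable
  have sp: "space ?R = cyl (head G a)"
    using sets.sets_into_space[OF Z] by (auto simp: space_restrict_space)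
  have meas: "case_nat a \<in> measurable ?R (path_borel G)"
  proof (rule measurable_into_path_borel)
    fix p assume "p \<in> space ?R"
    then show "case_nat a p \<in> paths"
      unfolding sp using a by (intro cons_in_paths) (auto simp: vertex_cyl_def)
  next
    fix n x
    have [measurable]: "(\<lambda>p. case_nat a p i) \<in> measurable ?R (count_space UNIV)" for i
      by (cases i) (auto intro: measurable_restrict_space1 measurable_coord_UNIV)
    have "{p \<in> space ?R. case_nat a p \<in> zcyl n x} =
       {p \<in> space ?R. tail G a = tail G (x 0) \<and> (\<forall>i<n. case_nat a p i = x i)}"
      unfolding sp using a cons_in_paths
      by (auto simp: zcyl_def vertex_cyl_def)
    also have "\<dots> \<in> sets ?R" by measurable
    finally show "{p \<in> space ?R. case_nat a p \<in> zcyl n x} \<in> sets ?R" .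
  qed
  have "path_shift ` (B \<inter> arrow_cyl G a) = case_nat a -` B \<inter> space ?R"
  proof (intro equalityI subsetI)
    fix q assume "q \<in> path_shift ` (B \<inter> arrow_cyl G a)"
    then obtain p where "p \<in> B" "p \<in> arrow_cyl G a" "q = path_shift p" by auto
    then show "q \<in> case_nat a -` B \<inter> space ?R"
      unfolding sp using cons_shift[of p a] shift_in_paths[of p] inf_paths_step[of p 0]
      by (auto simp: arrow_cyl_def vertex_cyl_def path_shift_def)
  next
    fix q assume q: "q \<in> case_nat a -` B \<inter> space ?R"
    then have "case_nat a q \<in> B \<inter> arrow_cyl G a"
      using sets.sets_into_space[OF assms(2)] by (auto simp: arrow_cyl_def)
    then show "q \<in> path_shift ` (B \<inter> arrow_cyl G a)"
      by (rule rev_image_eqI) simp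
  qed
  also have "\<dots> \<in> sets ?R" by (rule measurable_sets[OF meas assms(2)])
  finally have "path_shift ` (B \<inter> arrow_cyl G a) \<in> sets ?R" .
  then show ?thesis
    using sets.Int_space_eq2[OF Z] sets_restrict_space_iff[of "cyl (head G a)" "path_borel G"] Z
    by (metis sets.Int_space_eq1)
qed

lemma exp_mult_arrow_wt: "ennreal (exp (\<beta> * F a)) * (arrow_wt a * x) = x"
proof -
  have "ennreal (exp (\<beta> * F a)) * arrow_wt a = 1"
    by (simp add: arrow_wt_def flip: ennreal_mult' exp_add)
  then show ?thesis by (simp flip: mult.assoc)
qed

lemma arrow_wt_mult_exp: "arrow_wt a * (ennreal (exp (\<beta> * F a)) * x) = x"
  using exp_mult_arrow_wt[of a x] by (simp add: mult_ac)

lemma conformal_iff: "conformal G F \<beta> m \<longleftrightarrow> semi_conformal m \<and> emeasure m paths \<noteq> 0"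
proof (intro iffI conjI)
  assume c: "conformal G F \<beta> m"
  show "semi_conformal m"
    unfolding semi_conformal_def
  proof (intro conjI ballI)
    fix a B assume a: "a \<in> arcs G" and [measurable]: "B \<in> path_sets"
    have B: "B \<subseteq> paths" using sets.sets_into_space[OF \<open>B \<in> _\<close>] by simp
    let ?S = "{p \<in> arrow_cyl G a. path_shift p \<in> B}"
    have "?S \<in> path_sets" by measurable
    then have "emeasure m (path_shift ` (?S \<inter> arrow_cyl G a)) =
        ennreal (exp (\<beta> * F a)) * emeasure m (?S \<inter> arrow_cyl G a)"
      using c a unfolding conformal_def by blast
    moreover have "?S \<inter> arrow_cyl G a = ?S" by auto
    ultimately have "emeasure m (cyl (head G a) \<inter> B) = ennreal (exp (\<beta> * F a)) * emeasure m ?S"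
      by (simp add: shift_image_arrow_cyl[OF a B])
    then show "emeasure m ?S = arrow_wt a * emeasure m (cyl (head G a) \<inter> B)"
      by (simp add: arrow_wt_mult_exp)
  qed (use c in \<open>auto simp: conformal_def\<close>)
next
  assume sc: "semi_conformal m \<and> emeasure m paths \<noteq> 0"
  show "conformal G F \<beta> m"
    unfolding conformal_def
  proof (intro conjI ballI)
    fix a B assume a: "a \<in> arcs G" and B: "B \<in> path_sets"
    let ?S = "path_shift ` (B \<inter> arrow_cyl G a)"
    have S: "?S \<in> path_sets" by (rule sets_shift_image[OF a B])
    have "{p \<in> arrow_cyl G a. path_shift p \<in> ?S} = B \<inter> arrow_cyl G a"
    proof (intro equalityI subsetI)
      fix p assume p: "p \<in> {p \<in> arrow_cyl G a. path_shift p \<in> ?S}"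
      then obtain q where q: "path_shift p = path_shift q" "q \<in> B" "q \<in> arrow_cyl G a" by auto
      have "p 0 = a" "q 0 = a" using p q(3) by (auto simp: arrow_cyl_def)
      then have "p = q" using cons_shift[of p a] cons_shift[of q a] q(1) by metis
      then show "p \<in> B \<inter> arrow_cyl G a" using q by simp
    qed auto
    moreover have "cyl (head G a) \<inter> ?S = ?S"
      using shift_in_paths inf_paths_step
      by (force simp: arrow_cyl_def vertex_cyl_def path_shift_def)
    ultimately show "emeasure m ?S = ennreal (exp (\<beta> * F a)) * emeasure m (B \<inter> arrow_cyl G a)"
      using semi_conformalD(4)[OF _ a S, of m] sc by (simp add: exp_mult_arrow_wt)
  qed (use sc in \<open>auto simp: semi_conformal_def\<close>)
qed (simp add: conformal_def)

lemma path_wt_Suc: "path_wt (Suc n) x = arrow_wt (x 0) * path_wt n (path_shift x)"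
  by (simp add: path_wt_def path_shift_def prod.lessThan_Suc_shift del: prod.lessThan_Suc)

lemma semi_conformal_zcyl:
  assumes "semi_conformal m" "x \<in> paths"
  shows "emeasure m (zcyl n x) = path_wt n x * emeasure m (cyl (tail G (x n)))"
  using assms(2)
proof (induction n arbitrary: x)
  case 0
  then show ?case by (simp add: zcyl_0 path_wt_def)
next
  case (Suc n)
  have "cyl (head G (x 0)) \<inter> zcyl n (path_shift x) = zcyl n (path_shift x)"
    using inf_paths_step[OF Suc.prems, of 0]
    by (auto simp: zcyl_def vertex_cyl_def path_shift_def)
  then have "emeasure m (zcyl (Suc n) x) = arrow_wt (x 0) * emeasure m (zcyl n (path_shift x))"
    unfolding zcyl_Suc[OF Suc.prems]
    by (subst semi_conformalD(4)[OF assms(1) inf_paths_arcs[OF Suc.prems]]) auto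
  also have "\<dots> = arrow_wt (x 0) * (path_wt n (path_shift x) * emeasure m (cyl (tail G (path_shift x n))))"
    by (simp add: Suc.IH[OF shift_in_paths[OF Suc.prems]])
  finally show ?case
    by (simp add: path_wt_Suc mult.assoc) (simp add: path_shift_def)
qed

lemma measure_eqI_zcyl:
  assumes "sets m = path_sets" "sets m' = path_sets"
    and fin: "\<And>v. v \<in> verts G \<Longrightarrow> emeasure m (cyl v) < \<infinity>"
    and eq: "\<And>n x. x \<in> paths \<Longrightarrow> emeasure m (zcyl n x) = emeasure m' (zcyl n x)"
  shows "m = m'"
proof (rule measure_eqI_generator_eq_countable[OF Int_stable_zcyls zcyls_Pow])
  show "emeasure m X = emeasure m' X" if "X \<in> zcyls" for X
    using that eq by (auto simp: zcyls_def)
  show "sets m = sigma_sets paths zcyls" "sets m' = sigma_sets paths zcyls"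
    using assms by (simp_all add: sets_path_borel_zcyls)
  let ?A = "zcyl 0 ` paths"
  show "?A \<subseteq> zcyls" by (auto simp: zcyls_def)
  then show "countable ?A" by (rule countable_subset[OF _ countable_zcyls])
  show "\<Union>?A = paths" using zcyl_subset zcyl_self by blast
  show "emeasure m a \<noteq> \<infinity>" if "a \<in> ?A" for a
    using that fin by (auto simp: zcyl_0 inf_paths_tail less_top)
qed

text \<open>Conformality reduces the measure of a cylinder to that of the vertex cylinder at its end.\<close>

lemma semi_conformal_eqI:
  assumes "semi_conformal m" "semi_conformal m'"
    and "\<And>v. v \<in> verts G \<Longrightarrow> emeasure m (cyl v) = emeasure m' (cyl v)"
  shows "m = m'"
proof (rule measure_eqI_zcyl)
  show "emeasure m (cyl v) < \<infinity>" if "v \<in> verts G" for v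
    by (rule semi_conformalD(3)[OF assms(1) that])
qed (use assms in \<open>simp_all add: semi_conformal_zcyl inf_paths_tail semi_conformalD(1)\<close>)

text \<open>For a fixed arrow both sides of the conformality equation are measures in \<open>B\<close>, so
  it suffices to compare them on cylinders.\<close>

lemma semi_conformalI_zcyl:
  assumes sets: "sets m = path_sets"
    and fin: "\<And>v. v \<in> verts G \<Longrightarrow> emeasure m (cyl v) < \<infinity>"
    and cyl: "\<And>n x. x \<in> paths \<Longrightarrow>
        emeasure m (zcyl n x) = path_wt n x * emeasure m (cyl (tail G (x n)))"
  shows "semi_conformal m"
  unfolding semi_conformal_def
proof (intro conjI ballI sets fin)
  fix a B assume a: "a \<in> arcs G" and B: "B \<in> path_sets"
  have space: "space m = paths" using sets_eq_imp_space_eq[OF sets] by simp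
  note [measurable_cong] = sets
  define m1 where "m1 = distr (density m (indicator (arrow_cyl G a))) (path_borel G) path_shift"
  define m2 where "m2 = scale_measure (arrow_wt a) (density m (indicator (cyl (head G a))))"
  have m1: "emeasure m1 S = emeasure m {p \<in> arrow_cyl G a. path_shift p \<in> S}"
    if [measurable]: "S \<in> path_sets" for S
  proof -
    have "emeasure m1 S = emeasure m (arrow_cyl G a \<inter> (path_shift -` S \<inter> space m))"
      unfolding m1_def by (simp add: emeasure_distr emeasure_restricted)
    also have "arrow_cyl G a \<inter> (path_shift -` S \<inter> space m) = {p \<in> arrow_cyl G a. path_shift p \<in> S}"
      by (auto simp: space arrow_cyl_def)
    finally show ?thesis .
  qed
  have m2: "emeasure m2 S = arrow_wt a * emeasure m (cyl (head G a) \<inter> S)"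
    if [measurable]: "S \<in> path_sets" for S
    unfolding m2_def by (simp add: emeasure_restricted)
  have "m1 = m2"
  proof (rule measure_eqI_zcyl)
    show "sets m1 = path_sets" by (simp add: m1_def)
    show "sets m2 = path_sets" by (simp add: m2_def sets)
  next
    fix v assume "v \<in> verts G"
    have "emeasure m1 (cyl v) \<le> emeasure m (cyl (tail G a))"
      unfolding m1[OF sets_vertex_cyl]
      by (rule emeasure_mono) (auto simp: arrow_cyl_def sets, auto simp: vertex_cyl_def)
    then show "emeasure m1 (cyl v) < \<infinity>"
      using fin[of "tail G a"] a by (auto intro: le_less_trans)
  next
    fix n x assume x: "x \<in> paths"
    show "emeasure m1 (zcyl n x) = emeasure m2 (zcyl n x)"
    proof (cases "tail G (x 0) = head G a")
      case True
      let ?y = "case_nat a x"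
      have y: "?y \<in> paths" using True x a by (intro cons_in_paths) auto
      have "{p \<in> arrow_cyl G a. path_shift p \<in> zcyl n x} = zcyl (Suc n) ?y"
        unfolding zcyl_Suc[OF y] by simp
      moreover have "cyl (head G a) \<inter> zcyl n x = zcyl n x"
        using True by (auto simp: vertex_cyl_def zcyl_def)
      ultimately show ?thesis
        by (simp add: m1 m2 cyl[OF y] cyl[OF x] path_wt_Suc mult.assoc)
    next
      case False
      have "{p \<in> arrow_cyl G a. path_shift p \<in> zcyl n x} = {}"
        using False by (auto simp: arrow_cyl_def zcyl_def path_shift_def inf_paths_step)
      moreover have "cyl (head G a) \<inter> zcyl n x = {}"
        using False by (auto simp: vertex_cyl_def zcyl_def)
      ultimately show ?thesis by (simp only: m1 m2 sets_zcyl) simp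
    qed
  qed
  then show "emeasure m {p \<in> arrow_cyl G a. path_shift p \<in> B} =
      arrow_wt a * emeasure m (cyl (head G a) \<inter> B)"
    using m1[OF B] m2[OF B] by simp
qed

lemma semi_conformal_mixture:
  assumes \<kappa>: "\<And>y. y \<in> space N \<Longrightarrow> semi_conformal (\<kappa> y)"
    and meas: "\<And>B. B \<in> path_sets \<Longrightarrow> (\<lambda>y. emeasure (\<kappa> y) B) \<in> borel_measurable N"
    and fin: "\<And>v. v \<in> verts G \<Longrightarrow> (\<integral>\<^sup>+y. emeasure (\<kappa> y) (cyl v) \<partial>N) < \<infinity>"
  shows "semi_conformal (mixture N (path_borel G) \<kappa>)"
proof -
  have e: "emeasure (mixture N (path_borel G) \<kappa>) B = (\<integral>\<^sup>+y. emeasure (\<kappa> y) B \<partial>N)"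
    if "B \<in> path_sets" for B
    by (rule emeasure_mixture) (use \<kappa> meas that in \<open>auto simp: semi_conformalD\<close>)
  show ?thesis
    unfolding semi_conformal_def
  proof (intro conjI ballI)
    fix a B assume a: "a \<in> arcs G" and [measurable]: "B \<in> path_sets"
    have "emeasure (mixture N (path_borel G) \<kappa>) {p \<in> arrow_cyl G a. path_shift p \<in> B} =
        (\<integral>\<^sup>+y. arrow_wt a * emeasure (\<kappa> y) (cyl (head G a) \<inter> B) \<partial>N)"
      by (subst e) (auto intro!: nn_integral_cong semi_conformalD(4)[OF \<kappa>] a)
    also have "\<dots> = arrow_wt a * emeasure (mixture N (path_borel G) \<kappa>) (cyl (head G a) \<inter> B)"
      by (subst e) (auto intro!: nn_integral_cmult meas)
    finally show "emeasure (mixture N (path_borel G) \<kappa>) {p \<in> arrow_cyl G a. path_shift p \<in> B} =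
       arrow_wt a * emeasure (mixture N (path_borel G) \<kappa>) (cyl (head G a) \<inter> B)" .
  qed (use fin in \<open>auto simp: e\<close>)
qed

lemma trans_mat_sum:
  assumes v: "v \<in> verts G"
  shows "(\<integral>\<^sup>+w. transition v w * f w \<partial>count_space (verts G)) =
    (\<integral>\<^sup>+b. arrow_wt b * f (head G b) \<partial>count_space {b \<in> arcs G. tail G b = v})"
proof -
  have "transition v w * f w =
      (\<integral>\<^sup>+b. arrow_wt b * f (head G b) \<partial>count_space {b \<in> {b \<in> arcs G. tail G b = v}. head G b = w})" for w
  proof -
    have *: "{b \<in> {b \<in> arcs G. tail G b = v}. head G b = w} = {a \<in> arcs G. tail G a = v \<and> head G a = w}"
      by auto
    show ?thesis
      unfolding trans_mat_def * arrow_wt_def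
      by (subst nn_integral_multc[symmetric]) (auto intro!: nn_integral_cong)
  qed
  then show ?thesis
    by (simp only:) (rule nn_integral_fibres, use v in auto)
qed

lemma invariant_vec_sum:
  assumes "invariant_vec \<phi>" "v \<in> verts G"
  shows "(\<integral>\<^sup>+b. arrow_wt b * \<phi> (head G b) \<partial>count_space {b \<in> arcs G. tail G b = v}) = \<phi> v"
  using assms trans_mat_sum[OF assms(2), of \<phi>] by (simp add: invariant_vec_def)

lemma semi_conformal_step:
  assumes sc: "semi_conformal m" and v: "v \<in> verts G" and [measurable]: "B \<in> path_sets"
  shows "emeasure m {p \<in> cyl v. path_shift p \<in> B} =
    (\<integral>\<^sup>+u. transition v u * emeasure m (cyl u \<inter> B) \<partial>count_space (verts G))"
proof -
  let ?S = "{b \<in> arcs G. tail G b = v}"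
  have "{p \<in> cyl v. path_shift p \<in> B} = (\<Union>b\<in>?S. {p \<in> arrow_cyl G b. path_shift p \<in> B})"
    by (auto simp: vertex_cyl_def arrow_cyl_def inf_paths_arcs)
  also have "emeasure m \<dots> = (\<integral>\<^sup>+b. emeasure m {p \<in> arrow_cyl G b. path_shift p \<in> B} \<partial>count_space ?S)"
  proof (rule emeasure_UN_countable)
    show "countable ?S" by (rule countable_subset[OF _ countable_arcs]) auto
    show "disjoint_family_on (\<lambda>b. {p \<in> arrow_cyl G b. path_shift p \<in> B}) ?S"
      by (auto simp: disjoint_family_on_def arrow_cyl_def)
  qed (simp add: semi_conformalD(1)[OF sc] sets_shift_vimage)
  also have "\<dots> = (\<integral>\<^sup>+b. arrow_wt b * emeasure m (cyl (head G b) \<inter> B) \<partial>count_space ?S)"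
    by (intro nn_integral_cong semi_conformalD(4)[OF sc]) auto
  finally show ?thesis by (simp add: trans_mat_sum[OF v])
qed

lemma semi_conformal_invariant_vec:
  assumes sc: "semi_conformal m"
  shows "invariant_vec (\<lambda>v. emeasure m (cyl v))"
  unfolding invariant_vec_def
proof (intro conjI ballI)
  fix v assume v: "v \<in> verts G"
  have "{p \<in> cyl v. path_shift p \<in> paths} = cyl v"
    by (auto simp: vertex_cyl_def shift_in_paths)
  moreover have "cyl u \<inter> paths = cyl u" for u
    by (auto simp: vertex_cyl_def)
  ultimately show "(\<integral>\<^sup>+ w. transition v w * emeasure m (cyl w) \<partial>count_space (verts G)) =
      emeasure m (cyl v)"
    using semi_conformal_step[OF sc v, of "paths"] sets.top[of "path_borel G"] by simp
qed (use semi_conformalD(3)[OF sc] in auto)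

section \<open>Existence of conformal measures\<close>


text \<open>Here \<open>\<omega>\<close> assigns to each pair of a time and a vertex the arrow to follow. If
  these choices are independent, the path is a Markov chain; indexing them by time as well makes
  the arrows of a cylinder event refer to distinct coordinates even when the path returns to a
  vertex.\<close>

primrec chosen_path :: "'a \<Rightarrow> (nat \<times> 'a \<Rightarrow> 'b) \<Rightarrow> nat \<Rightarrow> 'b" where
  "chosen_path v \<omega> 0 = \<omega> (0, v)"
| "chosen_path v \<omega> (Suc i) = \<omega> (Suc i, head G (chosen_path v \<omega> i))"

lemma invariant_vec_arrow_le:
  assumes "invariant_vec \<phi>" "b \<in> arcs G"
  shows "arrow_wt b * \<phi> (head G b) \<le> \<phi> (tail G b)"
proof -
  have "arrow_wt b * \<phi> (head G b) \<le>
      (\<integral>\<^sup>+c. arrow_wt c * \<phi> (head G c) \<partial>count_space {c \<in> arcs G. tail G c = tail G b})"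
    by (rule nn_integral_ge_point) (use assms in auto)
  then show ?thesis using invariant_vec_sum[OF assms(1), of "tail G b"] assms(2) by simp
qed

lemma invariant_vec_arrow_zero:
  assumes "invariant_vec \<phi>" "b \<in> arcs G" "\<phi> (tail G b) = 0"
  shows "\<phi> (head G b) = 0"
proof -
  have "arrow_wt b * \<phi> (head G b) = 0"
    using invariant_vec_arrow_le[OF assms(1,2)] assms(3) by simp
  moreover have "arrow_wt b \<noteq> 0" by (simp add: arrow_wt_def)
  ultimately show ?thesis by simp
qed

text \<open>At a zero of an invariant vector all summands of the defining equation vanish, so zeros
  propagate along arrows.\<close>

lemma invariant_vec_path_zero:
  assumes "invariant_vec \<phi>" "x \<in> paths" "\<phi> (tail G (x i)) = 0" "i \<le> n"
  shows "\<phi> (tail G (x n)) = 0"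
  using assms(4)
proof (induction n rule: dec_induct)
  case (step n)
  then show ?case
    using invariant_vec_arrow_zero[OF assms(1) inf_paths_arcs[OF assms(2)]] inf_paths_step[OF assms(2)]
    by simp
qed (rule assms(3))

lemma path_wt_telescope:
  assumes \<phi>: "invariant_vec \<phi>" and x: "x \<in> paths"
    and pos: "\<And>i. i < n \<Longrightarrow> \<phi> (tail G (x i)) \<noteq> 0"
  shows "\<phi> (tail G (x 0)) * (\<Prod>i<n. arrow_wt (x i) * \<phi> (head G (x i)) / \<phi> (tail G (x i))) =
    path_wt n x * \<phi> (tail G (x n))"
  using pos
proof (induction n)
  case 0
  then show ?case by (simp add: path_wt_def)
next
  case (Suc n)
  let ?a = "\<phi> (tail G (x n))" and ?c = "arrow_wt (x n) * \<phi> (head G (x n))"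
  have a: "?a \<noteq> 0" "?a \<noteq> \<top>"
    using Suc.prems \<phi> inf_paths_tail[OF x, of n] by (auto simp: invariant_vec_def)
  have "\<phi> (tail G (x 0)) * (\<Prod>i<Suc n. arrow_wt (x i) * \<phi> (head G (x i)) / \<phi> (tail G (x i))) =
      path_wt n x * ?a * (?c / ?a)"
    using Suc by (simp flip: mult.assoc)
  also have "\<dots> = path_wt n x * (?c * ?a / ?a)"
    by (simp add: ennreal_times_divide mult_ac)
  also have "?c * ?a / ?a = ?c"
    using a by (simp add: ennreal_mult_divide_eq)
  finally show ?case by (simp add: path_wt_def inf_paths_step[OF x] mult_ac)
qed

text \<open>Transform the matrix by \<open>\<phi>\<close>: leave a vertex \<open>w\<close> with $\phi_w > 0$
  along the arrow $b$ with probability $e^{-\beta F(b)} \phi_{r(b)} / \phi_w$. These probabilities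
  add up to one because \<open>\<phi>\<close> is invariant, and along a cylinder their product
  telescopes. The measure is the sum over \<open>v\<close> of the laws of the paths from
  \<open>v\<close>, weighted with $\phi_v$.\<close>

theorem conformal_measure_exists:
  assumes \<phi>: "invariant_vec \<phi>"
  shows "\<exists>m. semi_conformal m \<and> (\<forall>v\<in>verts G. emeasure m (cyl v) = \<phi> v)"
proof -
  define pos where "pos = {v \<in> verts G. \<phi> v \<noteq> 0}"
  define law where "law j = (if snd j \<in> pos
      then density (count_space {b \<in> arcs G. tail G b = snd j \<and> head G b \<in> pos})
          (\<lambda>b. arrow_wt b * \<phi> (head G b) / \<phi> (snd j))
      else return (count_space UNIV) undefined)" for j :: "nat \<times> 'a"
  \<comment> \<open>Outside \<open>I\<close> the value of \<open>law\<close> only has to be some probability measure.\<close>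
  define I where "I = (UNIV :: nat set) \<times> pos"
  let ?\<Omega> = "PiM I law"
  have fin: "\<phi> v \<noteq> \<top>" if "v \<in> verts G" for v using \<phi> that by (auto simp: invariant_vec_def)
  have law_prob: "prob_space (law j)" for j
  proof (cases "snd j \<in> pos")
    case True
    have "emeasure (law j) (space (law j)) =
        (\<integral>\<^sup>+b. arrow_wt b * \<phi> (head G b) / \<phi> (snd j)
           \<partial>count_space {b \<in> arcs G. tail G b = snd j \<and> head G b \<in> pos})"
      using True by (auto simp: law_def emeasure_density intro!: nn_integral_cong)
    also have "\<dots> = (\<integral>\<^sup>+b. arrow_wt b * \<phi> (head G b) / \<phi> (snd j) \<partial>count_space {b \<in> arcs G. tail G b = snd j})"
      by (rule nn_integral_count_space_eq) (auto simp: pos_def)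
    also have "\<dots> = (\<integral>\<^sup>+b. arrow_wt b * \<phi> (head G b) \<partial>count_space {b \<in> arcs G. tail G b = snd j}) / \<phi> (snd j)"
      by (rule nn_integral_divide) simp
    also have "\<dots> = 1"
      using True fin[of "snd j"] by (simp add: invariant_vec_sum[OF \<phi>] pos_def ennreal_divide_self less_top)
    finally show ?thesis by (rule prob_spaceI)
  next
    case False
    then show ?thesis by (simp add: law_def prob_space_return)
  qed
  then interpret product_prob_space law I
    by (simp add: product_prob_space_def product_prob_space_axioms_def product_sigma_finite_def
        prob_space_imp_sigma_finite)
  have choice: "\<omega> (n, w) \<in> arcs G \<and> tail G (\<omega> (n, w)) = w \<and> head G (\<omega> (n, w)) \<in> pos"
    if "\<omega> \<in> space ?\<Omega>" "w \<in> pos" for \<omega> n w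
  proof -
    have "\<omega> (n, w) \<in> space (law (n, w))"
      using that by (auto simp: space_PiM I_def PiE_iff)
    then show ?thesis using that by (simp add: law_def)
  qed
  have path: "chosen_path v \<omega> \<in> cyl v \<and> (\<forall>i. tail G (chosen_path v \<omega> i) \<in> pos \<and> head G (chosen_path v \<omega> i) \<in> pos)"
    if \<omega>: "\<omega> \<in> space ?\<Omega>" and v: "v \<in> pos" for v \<omega>
  proof -
    have h: "head G (chosen_path v \<omega> i) \<in> pos" for i
      by (induction i) (use choice[OF \<omega>] v in auto)
    have s: "tail G (chosen_path v \<omega> (Suc i)) = head G (chosen_path v \<omega> i)" for i
      using choice[OF \<omega> h[of i]] by simp
    have z: "tail G (chosen_path v \<omega> 0) = v" using choice[OF \<omega> v] by simp
    have "chosen_path v \<omega> i \<in> arcs G" for i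
      using choice[OF \<omega> h] choice[OF \<omega> v] by (cases i) auto
    moreover have "tail G (chosen_path v \<omega> i) \<in> pos" for i
      using z s h v by (cases i) auto
    ultimately show ?thesis using h s z by (auto simp: vertex_cyl_def inf_paths_def simp del: chosen_path.simps)
  qed
  have cyl_iff: "chosen_path v \<omega> \<in> zcyl n x \<longleftrightarrow> tail G (x 0) = v \<and> (\<forall>i<n. \<omega> (i, tail G (x i)) = x i)"
    if \<omega>: "\<omega> \<in> space ?\<Omega>" and v: "v \<in> pos" and x: "x \<in> paths" for v \<omega> n x
  proof -
    note p = path[OF \<omega> v]
    have unfold: "chosen_path v \<omega> i = \<omega> (i, tail G (chosen_path v \<omega> i))" for i
      using p by (cases i) (auto simp: vertex_cyl_def inf_paths_step simp flip: chosen_path.simps(2))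
    have "\<forall>i<k. chosen_path v \<omega> i = x i"
      if "tail G (x 0) = v" "\<forall>i<n. \<omega> (i, tail G (x i)) = x i" "k \<le> n" for k
      using \<open>k \<le> n\<close>
    proof (induction k)
      case (Suc k)
      have "chosen_path v \<omega> k = x k"
        using that(1) that(2)[rule_format, of k] Suc inf_paths_step[OF x] by (cases k) auto
      then show ?case using Suc by (auto simp: less_Suc_eq)
    qed simp
    moreover have "\<forall>i<n. \<omega> (i, tail G (x i)) = x i" if "\<forall>i<n. chosen_path v \<omega> i = x i"
      using that unfold by metis
    ultimately show ?thesis
      using p by (auto simp: zcyl_def vertex_cyl_def)
  qed
  \<comment> \<open>Off \<open>ok\<close> the event is empty, and the cylinder formula gives 0 as well, as zeros propagate.\<close>
  define ok where "ok n x \<longleftrightarrow> (\<forall>i<n. tail G (x i) \<in> pos \<and> head G (x i) \<in> pos)" for n and x :: "nat \<Rightarrow> 'b"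
  have not_ok: "\<phi> (tail G (x n)) = 0" if no: "\<not> ok n x" and x: "x \<in> paths" for n x
  proof -
    obtain i where "i < n" "tail G (x i) \<notin> pos \<or> tail G (x (Suc i)) \<notin> pos"
      using no inf_paths_step[OF x] unfolding ok_def by metis
    then have "\<phi> (tail G (x i)) = 0 \<or> \<phi> (tail G (x (Suc i))) = 0"
      using inf_paths_tail[OF x] by (auto simp: pos_def)
    then show ?thesis
      using invariant_vec_path_zero[OF \<phi> x, of i n] invariant_vec_path_zero[OF \<phi> x, of "Suc i" n] \<open>i < n\<close>
      by auto
  qed
  have event: "{\<omega> \<in> space ?\<Omega>. chosen_path v \<omega> \<in> zcyl n x} \<in> sets ?\<Omega> \<and>
      \<phi> v * emeasure ?\<Omega> {\<omega> \<in> space ?\<Omega>. chosen_path v \<omega> \<in> zcyl n x} =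
      (if tail G (x 0) = v then path_wt n x * \<phi> (tail G (x n)) else 0)"
    if v: "v \<in> pos" and x: "x \<in> paths" for v n x
  proof (cases "tail G (x 0) = v \<and> ok n x")
    case True
    define J where "J = (\<lambda>i. (i, tail G (x i))) ` {..<n}"
    have J: "J \<subseteq> I" "finite J" using True by (auto simp: J_def I_def ok_def)
    have xs: "{x (fst j)} \<in> sets (law j)" if "j \<in> J" for j
      using that True x by (auto simp: J_def law_def ok_def inf_paths_arcs)
    have eq: "{\<omega> \<in> space ?\<Omega>. chosen_path v \<omega> \<in> zcyl n x} =
        {\<omega> \<in> space ?\<Omega>. \<forall>j\<in>J. \<omega> j \<in> {x (fst j)}}"
      using True cyl_iff[OF _ v x] by (auto simp: J_def)
    have "emeasure ?\<Omega> {\<omega> \<in> space ?\<Omega>. chosen_path v \<omega> \<in> zcyl n x} =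
        (\<Prod>j\<in>J. emeasure (law j) {x (fst j)})"
      unfolding eq by (rule emeasure_PiM_Collect) (use J xs in auto)
    also have "\<dots> = (\<Prod>i<n. emeasure (law (i, tail G (x i))) {x i})"
      unfolding J_def by (subst prod.reindex) (auto simp: inj_on_def)
    also have "\<dots> = (\<Prod>i<n. arrow_wt (x i) * \<phi> (head G (x i)) / \<phi> (tail G (x i)))"
    proof (rule prod.cong[OF refl])
      fix i assume i: "i \<in> {..<n}"
      have "x i \<in> {b \<in> arcs G. tail G b = tail G (x i) \<and> head G b \<in> pos}" "tail G (x i) \<in> pos"
        using True i x by (auto simp: ok_def inf_paths_arcs)
      then show "emeasure (law (i, tail G (x i))) {x i} =
          arrow_wt (x i) * \<phi> (head G (x i)) / \<phi> (tail G (x i))"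
        by (simp add: law_def emeasure_density nn_integral_cmult_indicator)
    qed
    finally have "\<phi> v * emeasure ?\<Omega> {\<omega> \<in> space ?\<Omega>. chosen_path v \<omega> \<in> zcyl n x} =
        path_wt n x * \<phi> (tail G (x n))"
      using path_wt_telescope[OF \<phi> x, of n] True by (auto simp: ok_def pos_def)
    moreover have "{\<omega> \<in> space ?\<Omega>. chosen_path v \<omega> \<in> zcyl n x} \<in> sets ?\<Omega>"
      unfolding eq
    proof (rule sets.sets_Collect_finite_All[OF _ J(2)])
      fix j assume j: "j \<in> J"
      have "(\<lambda>\<omega>. \<omega> j) -` {x (fst j)} \<inter> space ?\<Omega> \<in> sets ?\<Omega>"
        by (rule measurable_sets[OF measurable_component_singleton[of j I law, OF subsetD[OF J(1) j]] xs[OF j]])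
      then show "{\<omega> \<in> space ?\<Omega>. \<omega> j \<in> {x (fst j)}} \<in> sets ?\<Omega>"
        by (simp add: vimage_def Int_def conj_commute)
    qed
    ultimately show ?thesis using True by simp
  next
    case False
    have empty: "{\<omega> \<in> space ?\<Omega>. chosen_path v \<omega> \<in> zcyl n x} = {}"
    proof (cases "tail G (x 0) = v")
      case True
      then obtain i where i: "i < n" "tail G (x i) \<notin> pos \<or> head G (x i) \<notin> pos"
        using False by (auto simp: ok_def)
      then show ?thesis using path[OF _ v] by (auto simp: zcyl_def) metis+
    qed (use path[OF _ v] in \<open>auto simp: zcyl_def vertex_cyl_def\<close>)
    show ?thesis unfolding empty using False not_ok[OF _ x, of n] by auto
  qed
  have meas: "chosen_path v \<in> measurable ?\<Omega> (path_borel G)" if "v \<in> pos" for v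
    by (rule measurable_into_path_borel) (use path event that in \<open>auto simp: vertex_cyl_def\<close>)
  define N where "N v = scale_measure (\<phi> v) (distr ?\<Omega> (path_borel G) (chosen_path v))" for v
  define m where "m = mixture (count_space pos) (path_borel G) N"
  have N: "emeasure (N v) (zcyl n x) = (if tail G (x 0) = v then path_wt n x * \<phi> (tail G (x n)) else 0)"
    if v: "v \<in> pos" and x: "x \<in> paths" for v n x
  proof -
    have "chosen_path v -` zcyl n x \<inter> space ?\<Omega> = {\<omega> \<in> space ?\<Omega>. chosen_path v \<omega> \<in> zcyl n x}" by auto
    then show ?thesis
      using event[OF v x, of n] by (simp add: N_def emeasure_distr[OF meas[OF v]])
  qed
  have m: "emeasure m B = (\<integral>\<^sup>+v. emeasure (N v) B \<partial>count_space pos)" if "B \<in> path_sets" for B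
    unfolding m_def by (rule emeasure_mixture) (use that in \<open>auto simp: N_def\<close>)
  have mZ: "emeasure m (cyl v) = \<phi> v" if v: "v \<in> verts G" for v
  proof -
    have "emeasure (N u) (cyl v) = (if u = v then \<phi> v else 0)" if u: "u \<in> pos" for u
    proof -
      have "chosen_path u -` cyl v \<inter> space ?\<Omega> = (if u = v then space ?\<Omega> else {})"
        using path[OF _ u] by (auto simp: vertex_cyl_def)
      then show ?thesis using P.emeasure_space_1 by (simp add: N_def emeasure_distr[OF meas[OF u]])
    qed
    then have "emeasure m (cyl v) = (\<integral>\<^sup>+u. (if u = v then \<phi> v else 0) \<partial>count_space pos)"
      by (auto simp: m intro!: nn_integral_cong)
    also have "\<dots> = \<phi> v" using v by (subst nn_integral_count_space_single[of _ v]) (auto simp: pos_def)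
    finally show ?thesis .
  qed
  have "semi_conformal m"
  proof (rule semi_conformalI_zcyl)
    show "sets m = path_sets" by (simp add: m_def)
    show "emeasure m (cyl v) < \<infinity>" if "v \<in> verts G" for v
      using mZ[OF that] fin[OF that] by (simp add: less_top)
    fix n x assume x: "x \<in> paths"
    have "emeasure m (zcyl n x) =
       (\<integral>\<^sup>+u. (if u = tail G (x 0) then path_wt n x * \<phi> (tail G (x n)) else 0) \<partial>count_space pos)"
      by (auto simp: m N x intro!: nn_integral_cong)
    also have "\<dots> = path_wt n x * \<phi> (tail G (x n))"
      using invariant_vec_path_zero[OF \<phi> x, of 0 n] inf_paths_tail[OF x, of 0]
      by (subst nn_integral_count_space_single[of _ "tail G (x 0)"]) (auto simp: pos_def)
    finally show "emeasure m (zcyl n x) = path_wt n x * emeasure m (cyl (tail G (x n)))"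
      by (simp add: mZ inf_paths_tail[OF x])
  qed
  then show ?thesis using mZ by blast
qed

section \<open>Iterated steps, transience and last exits\<close>


lemma mat_pow_supermult:
  assumes "v \<in> verts G"
  shows "transition_pow m u v * transition_pow n v w \<le> transition_pow (m + n) u w"
proof (induction m arbitrary: u)
  case (Suc m)
  have "transition_pow (Suc m) u v * transition_pow n v w =
      (\<integral>\<^sup>+x. transition u x * (transition_pow m x v * transition_pow n v w) \<partial>count_space (verts G))"
    by (simp add: mult.assoc flip: nn_integral_multc)
  also have "\<dots> \<le> (\<integral>\<^sup>+x. transition u x * transition_pow (m + n) x w \<partial>count_space (verts G))"
    by (intro nn_integral_mono mult_left_mono Suc.IH) auto
  finally show ?case by simp
qed simp

lemma mat_pow_green_le:
  assumes "v \<in> verts G"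
  shows "transition_pow m u v * greens v w \<le> greens u w"
proof -
  have "transition_pow m u v * greens v w = (\<Sum>n. transition_pow m u v * transition_pow n v w)"
    unfolding green_def by (rule ennreal_suminf_cmult[symmetric])
  also have "\<dots> \<le> (\<Sum>n. transition_pow (n + m) u w)"
    using mat_pow_supermult[OF assms, of m u] by (intro suminf_le) (simp_all add: add.commute)
  also have "\<dots> \<le> greens u w"
    unfolding green_def by (subst (2) suminf_offset[of _ m]) simp_all
  finally show ?thesis .
qed

lemma measurable_shift_n [measurable]:
  "(\<lambda>p i. p (i + n)) \<in> measurable (path_borel G) (path_borel G)"
proof (induction n)
  case (Suc n)
  have "(\<lambda>p. path_shift (\<lambda>i. p (i + n))) \<in> measurable (path_borel G) (path_borel G)"
    by (rule measurable_compose[OF Suc measurable_shift])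
  then show ?case by (simp add: path_shift_def)
qed simp

lemma pred_tail_in [measurable]: "Measurable.pred (path_borel G) (\<lambda>p. tail G (p i) \<in> W)"
  by (rule measurable_compose[OF measurable_tail]) simp

lemma shift_n_in_paths: "p \<in> paths \<Longrightarrow> (\<lambda>i. p (i + n)) \<in> paths"
  by (auto simp: inf_paths_def)

lemma vertex_cyl_Int_Collect:
  "cyl v \<inter> {p \<in> paths. Q p} = {p \<in> cyl v. Q p}"
  by (auto simp: vertex_cyl_def)

lemma sets_visit [measurable]:
  assumes [measurable]: "B \<in> path_sets"
  shows "{p \<in> cyl v. tail G (p n) = w \<and> (\<lambda>i. p (i + n)) \<in> B} \<in> path_sets"
proof -
  have "{p \<in> space (path_borel G). tail G (p 0) = v \<and> tail G (p n) = w \<and> (\<lambda>i. p (i + n)) \<in> B}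
      \<in> path_sets" by measurable
  moreover have "{p \<in> space (path_borel G). tail G (p 0) = v \<and> tail G (p n) = w \<and> (\<lambda>i. p (i + n)) \<in> B} =
      {p \<in> cyl v. tail G (p n) = w \<and> (\<lambda>i. p (i + n)) \<in> B}"
    by (auto simp: vertex_cyl_def)
  ultimately show ?thesis by metis
qed

text \<open>The Markov property at time \<open>n\<close>, with powers of the matrix in place of transition
  probabilities.\<close>

lemma semi_conformal_steps:
  assumes sc: "semi_conformal m" and v: "v \<in> verts G" and B[measurable]: "B \<in> path_sets"
  shows "emeasure m {p \<in> cyl v. tail G (p n) = w \<and> (\<lambda>i. p (i + n)) \<in> B} =
    transition_pow n v w * emeasure m (cyl w \<inter> B)"
  using v
proof (induction n arbitrary: v)
  case 0
  have "{p \<in> cyl v. tail G (p 0) = w \<and> p \<in> B} = (if v = w then cyl w \<inter> B else {})"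
    by (auto simp: vertex_cyl_def)
  then show ?case by simp
next
  case (Suc n)
  let ?C = "{p \<in> paths. tail G (p n) = w \<and> (\<lambda>i. p (i + n)) \<in> B}"
  have C: "?C \<in> path_sets"
  proof -
    have "{p \<in> space (path_borel G). tail G (p n) = w \<and> (\<lambda>i. p (i + n)) \<in> B} \<in> path_sets"
      by measurable
    then show ?thesis unfolding space_path_borel .
  qed
  have "{p \<in> cyl v. tail G (p (Suc n)) = w \<and> (\<lambda>i. p (i + Suc n)) \<in> B} =
      {p \<in> cyl v. path_shift p \<in> ?C}"
  proof (rule Collect_cong)
    fix p :: "nat \<Rightarrow> 'b"
    have 1: "(\<lambda>i. path_shift p (i + n)) = (\<lambda>i. p (i + Suc n))" and 2: "path_shift p n = p (Suc n)"
      by (simp_all add: path_shift_def)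
    show "p \<in> cyl v \<and> tail G (p (Suc n)) = w \<and> (\<lambda>i. p (i + Suc n)) \<in> B \<longleftrightarrow>
        p \<in> cyl v \<and> path_shift p \<in> ?C"
      unfolding mem_Collect_eq 1 2 using shift_in_paths[of p] unfolding vertex_cyl_def by blast
  qed
  then have "emeasure m {p \<in> cyl v. tail G (p (Suc n)) = w \<and> (\<lambda>i. p (i + Suc n)) \<in> B} =
      (\<integral>\<^sup>+u. transition v u * emeasure m (cyl u \<inter> ?C) \<partial>count_space (verts G))"
    using semi_conformal_step[OF sc Suc.prems C] by simp
  also have "\<dots> = (\<integral>\<^sup>+u. transition v u * transition_pow n u w * emeasure m (cyl w \<inter> B) \<partial>count_space (verts G))"
    by (intro nn_integral_cong) (simp add: vertex_cyl_Int_Collect Suc.IH mult.assoc)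
  also have "\<dots> = transition_pow (Suc n) v w * emeasure m (cyl w \<inter> B)"
    by (simp add: nn_integral_multc)
  finally show ?case .
qed

definition transient_paths :: "(nat \<Rightarrow> 'b) set" where
  "transient_paths = {p \<in> paths. \<forall>w\<in>verts G. \<exists>n. \<forall>j\<ge>n. tail G (p j) \<noteq> w}"

definition shift_invariant :: "(nat \<Rightarrow> 'b) set \<Rightarrow> bool" where
  "shift_invariant D \<longleftrightarrow> D \<in> path_sets \<and> (\<forall>p\<in>paths. path_shift p \<in> D \<longleftrightarrow> p \<in> D)"

lemma shift_invariant_shift_n:
  assumes "shift_invariant D" "p \<in> paths"
  shows "(\<lambda>i. p (i + n)) \<in> D \<longleftrightarrow> p \<in> D"
proof (induction n)
  case (Suc n)
  have "(\<lambda>i. p (i + Suc n)) = path_shift (\<lambda>i. p (i + n))" by (auto simp: path_shift_def)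
  then show ?case using assms Suc shift_n_in_paths[OF assms(2), of n] by (simp add: shift_invariant_def)
qed simp

lemma shift_invariant_sets: "shift_invariant D \<Longrightarrow> D \<in> path_sets"
  by (simp add: shift_invariant_def)

lemma shift_invariant_subset: "shift_invariant D \<Longrightarrow> D \<subseteq> paths"
  using sets.sets_into_space[of D "path_borel G"] by (simp add: shift_invariant_def)

lemma shift_invariant_Int: "shift_invariant D \<Longrightarrow> shift_invariant D' \<Longrightarrow> shift_invariant (D \<inter> D')"
  by (auto simp: shift_invariant_def)

lemma shift_invariant_Collect:
  assumes "Measurable.pred (path_borel G) Q" "\<And>p. p \<in> paths \<Longrightarrow> Q (path_shift p) \<longleftrightarrow> Q p"
  shows "shift_invariant {p \<in> paths. Q p}"
proof -
  have "{p \<in> space (path_borel G). Q p} \<in> path_sets" using assms(1) by measurable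
  then show ?thesis using assms(2) by (auto simp: shift_invariant_def shift_in_paths)
qed

lemma shift_invariant_transient: "shift_invariant transient_paths"
  unfolding transient_paths_def
proof (rule shift_invariant_Collect)
  have "{p \<in> space (path_borel G). \<forall>w\<in>verts G. \<exists>n. \<forall>j\<ge>n. tail G (p j) \<noteq> w} \<in> path_sets"
    by (rule sets.sets_Collect_countable_All'[OF _ countable_verts]) measurable
  then show "Measurable.pred (path_borel G) (\<lambda>p. \<forall>w\<in>verts G. \<exists>n. \<forall>j\<ge>n. tail G (p j) \<noteq> w)"
    by (simp add: pred_def)
next
  fix p
  have "(\<exists>n. \<forall>j\<ge>n. tail G (p (Suc j)) \<noteq> w) \<longleftrightarrow> (\<exists>n. \<forall>j\<ge>n. tail G (p j) \<noteq> w)" for w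
    using eventually_sequentially_Suc[of "\<lambda>j. tail G (p j) \<noteq> w"] by (simp add: eventually_sequentially)
  then show "(\<forall>w\<in>verts G. \<exists>n. \<forall>j\<ge>n. tail G (path_shift p j) \<noteq> w) \<longleftrightarrow>
      (\<forall>w\<in>verts G. \<exists>n. \<forall>j\<ge>n. tail G (p j) \<noteq> w)"
    by (simp add: path_shift_def)
qed

text \<open>A transient path that meets the finite set \<open>W\<close> has a last visit to it. Splitting by
  the time and the place \<open>w\<close> of this visit, the event that remains after it is the
  same for every start and every time, because \<open>D\<close> is invariant; summing over the
  times produces the Green function.\<close>

lemma last_exit_sum:
  assumes sc: "semi_conformal m" and v: "v \<in> verts G" and W: "finite W"
    and D: "shift_invariant D" "D \<subseteq> transient_paths"
  shows "emeasure m (cyl v \<inter> D \<inter> {p. \<exists>k. tail G (p k) \<in> W}) =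
    (\<Sum>w\<in>W. greens v w * emeasure m (cyl w \<inter> {p \<in> D. \<forall>j. tail G (p (Suc j)) \<notin> W}))"
proof -
  note [measurable] = shift_invariant_sets[OF D(1)]
  define E where "E = {p \<in> D. \<forall>j. tail G (p (Suc j)) \<notin> W}"
  define S where "S n w = {p \<in> cyl v. tail G (p n) = w \<and> (\<lambda>i. p (i + n)) \<in> E}" for n w
  have DP: "D \<subseteq> paths" by (rule shift_invariant_subset[OF D(1)])
  have E[measurable]: "E \<in> path_sets"
  proof -
    have "{p \<in> space (path_borel G). p \<in> D \<and> (\<forall>j. tail G (p (Suc j)) \<notin> W)} \<in> path_sets"
      by measurable
    moreover have "{p \<in> space (path_borel G). p \<in> D \<and> (\<forall>j. tail G (p (Suc j)) \<notin> W)} = E"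
      using DP by (auto simp: E_def)
    ultimately show ?thesis by metis
  qed
  have S_sets: "S n w \<in> sets m" for n w
    unfolding S_def semi_conformalD(1)[OF sc] by measurable
  have S_iff: "p \<in> S n w \<longleftrightarrow> p \<in> cyl v \<inter> D \<and> tail G (p n) = w \<and> (\<forall>j>n. tail G (p j) \<notin> W)" for p n w
  proof -
    have "(\<forall>j. tail G (p (Suc j + n)) \<notin> W) \<longleftrightarrow> (\<forall>j>n. tail G (p j) \<notin> W)"
      by (metis add.commute less_add_Suc1 less_imp_Suc_add add_Suc)
    then show ?thesis
      using shift_invariant_shift_n[OF D(1), of p n] by (auto simp: S_def E_def vertex_cyl_def)
  qed
  have "cyl v \<inter> D \<inter> {p. \<exists>k. tail G (p k) \<in> W} = (\<Union>n. \<Union>w\<in>W. S n w)"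
  proof (intro equalityI subsetI)
    fix p assume p: "p \<in> cyl v \<inter> D \<inter> {p. \<exists>k. tail G (p k) \<in> W}"
    then have pT: "p \<in> transient_paths" using D(2) by auto
    let ?K = "{k. tail G (p k) \<in> W}"
    have "finite {k. tail G (p k) = w}" if "w \<in> W" for w
    proof (cases "w \<in> verts G")
      case True
      then obtain n where "\<forall>j\<ge>n. tail G (p j) \<noteq> w" using pT by (auto simp: transient_paths_def)
      then have "{k. tail G (p k) = w} \<subseteq> {..<n}" by (auto simp: not_le[symmetric])
      then show ?thesis by (rule finite_subset) simp
    next
      case False
      then have "{k. tail G (p k) = w} = {}" using pT inf_paths_tail by (auto simp: transient_paths_def)
      then show ?thesis by simp
    qed
    then have "finite (\<Union>w\<in>W. {k. tail G (p k) = w})" using W by blast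
    then have fin: "finite ?K" by (rule rev_finite_subset) auto
    have "Max ?K \<in> ?K" using fin p by (intro Max_in) auto
    moreover have "tail G (p j) \<notin> W" if "j > Max ?K" for j
      using Max_ge[OF fin, of j] that by auto
    ultimately have "p \<in> S (Max ?K) (tail G (p (Max ?K)))" "tail G (p (Max ?K)) \<in> W"
      using p unfolding S_iff by blast+
    then show "p \<in> (\<Union>n. \<Union>w\<in>W. S n w)" by blast
  next
    fix p assume "p \<in> (\<Union>n. \<Union>w\<in>W. S n w)"
    then show "p \<in> cyl v \<inter> D \<inter> {p. \<exists>k. tail G (p k) \<in> W}" unfolding UN_iff S_iff by blast
  qed
  also have "emeasure m \<dots> = (\<Sum>n. emeasure m (\<Union>w\<in>W. S n w))"
  proof (rule suminf_emeasure[symmetric])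
    show "range (\<lambda>n. \<Union>w\<in>W. S n w) \<subseteq> sets m" using S_sets W by auto
    show "disjoint_family (\<lambda>n. \<Union>w\<in>W. S n w)"
      unfolding disjoint_family_on_def S_iff[abs_def]
      by (auto simp: S_iff) (metis linorder_neqE_nat)
  qed
  also have "\<dots> = (\<Sum>n. \<Sum>w\<in>W. emeasure m (S n w))"
    by (intro suminf_cong sum_emeasure[symmetric]) (use S_sets W in \<open>auto simp: disjoint_family_on_def S_iff\<close>)
  also have "\<dots> = (\<Sum>w\<in>W. \<Sum>n. transition_pow n v w * emeasure m (cyl w \<inter> E))"
    unfolding S_def semi_conformal_steps[OF sc v E] by (rule suminf_sum) simp
  also have "\<dots> = (\<Sum>w\<in>W. greens v w * emeasure m (cyl w \<inter> E))"
    by (simp add: green_def)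
  finally show ?thesis by (simp add: E_def)
qed

text \<open>In \<open>last_exit_sum\<close> the starting vertex enters only through the Green function. An
  infinite set \<open>W\<close> is exhausted by finite ones.\<close>

lemma hitting_comparison:
  assumes sc: "semi_conformal m" and v: "v \<in> verts G" "v' \<in> verts G"
    and D: "shift_invariant D" "D \<subseteq> transient_paths"
    and hit: "\<And>p. p \<in> D \<Longrightarrow> \<exists>k. tail G (p k) \<in> W"
    and le: "\<And>w. w \<in> W \<Longrightarrow> w \<in> verts G \<Longrightarrow> c * greens v w \<le> c' * greens v' w"
  shows "c * emeasure m (cyl v \<inter> D) \<le> c' * emeasure m (cyl v' \<inter> D)"
proof -
  note [measurable] = shift_invariant_sets[OF D(1)]
  define U where "U n = W \<inter> verts G \<inter> from_nat_into (verts G) ` {..n}" for n :: nat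
  define H where "H n = cyl v \<inter> D \<inter> {p. \<exists>k. tail G (p k) \<in> U n}" for n
  have finU: "finite (U n)" for n by (simp add: U_def)
  have H_sets: "H n \<in> sets m" for n
  proof -
    have "H n = {p \<in> space (path_borel G). tail G (p 0) = v \<and> p \<in> D \<and> (\<exists>k. tail G (p k) \<in> U n)}"
      by (auto simp: H_def vertex_cyl_def)
    also have "\<dots> \<in> path_sets" by measurable
    finally show ?thesis by (simp add: semi_conformalD(1)[OF sc])
  qed
  have bound: "c * emeasure m (H n) \<le> c' * emeasure m (cyl v' \<inter> D)" for n
  proof -
    let ?e = "\<lambda>w. emeasure m (cyl w \<inter> {p \<in> D. \<forall>j. tail G (p (Suc j)) \<notin> U n})"
    have "c * emeasure m (H n) = (\<Sum>w\<in>U n. c * greens v w * ?e w)"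
      unfolding H_def last_exit_sum[OF sc v(1) finU D] by (simp add: sum_distrib_left mult.assoc)
    also have "\<dots> \<le> (\<Sum>w\<in>U n. c' * greens v' w * ?e w)"
      by (intro sum_mono mult_right_mono le) (auto simp: U_def)
    also have "\<dots> = c' * emeasure m (cyl v' \<inter> D \<inter> {p. \<exists>k. tail G (p k) \<in> U n})"
      unfolding last_exit_sum[OF sc v(2) finU D] by (simp add: sum_distrib_left mult.assoc)
    also have "\<dots> \<le> c' * emeasure m (cyl v' \<inter> D)"
      by (intro mult_left_mono emeasure_mono) (auto simp: semi_conformalD(1)[OF sc])
    finally show ?thesis .
  qed
  have D_eq: "cyl v \<inter> D = (\<Union>n. H n)"
  proof (intro equalityI subsetI)
    fix p assume p: "p \<in> cyl v \<inter> D"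
    then obtain k where k: "tail G (p k) \<in> W" using hit by blast
    have V: "tail G (p k) \<in> verts G"
      using p shift_invariant_subset[OF D(1)] inf_paths_tail by blast
    then obtain n where "from_nat_into (verts G) n = tail G (p k)"
      using from_nat_into_surj[OF countable_verts] by metis
    then have "tail G (p k) \<in> U n" using k V by (force simp: U_def)
    then show "p \<in> (\<Union>n. H n)" using p by (auto simp: H_def)
  qed (auto simp: H_def)
  have sup: "(SUP n. emeasure m (H n)) = emeasure m (\<Union>n. H n)"
  proof (rule SUP_emeasure_incseq)
    have "U i \<subseteq> U j" if "i \<le> j" for i j using that by (auto simp: U_def)
    then show "incseq H" unfolding incseq_def H_def by blast
  qed (use H_sets in auto)
  have "c * emeasure m (cyl v \<inter> D) = (SUP n. c * emeasure m (H n))"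
    unfolding D_eq sup[symmetric] by (rule SUP_mult_left_ennreal)
  also have "\<dots> \<le> c' * emeasure m (cyl v' \<inter> D)" by (rule SUP_least) (rule bound)
  finally show ?thesis .
qed

end

locale martin_graph = weighted_digraph +
  fixes v0 :: 'a
  assumes v0: "v0 \<in> verts G"
    and green_v0: "v \<in> verts G \<Longrightarrow> 0 < greens v0 v \<and> greens v0 v < \<infinity>"
begin

abbreviation kernel :: "'a \<Rightarrow> 'a \<Rightarrow> ennreal" where
  "kernel \<equiv> martin_kernel G F \<beta> v0"

abbreviation limit_vec :: "(nat \<Rightarrow> 'b) \<Rightarrow> 'a \<Rightarrow> ennreal" where
  "limit_vec \<equiv> martin_limit G F \<beta> v0"

abbreviation minimal_paths :: "(nat \<Rightarrow> 'b) set" where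
  "minimal_paths \<equiv> X_set G F \<beta> v0"

abbreviation minimal_rays :: "(nat \<Rightarrow> 'b) set" where
  "minimal_rays \<equiv> C_set G F \<beta> v0"

abbreviation integrated :: "(nat \<Rightarrow> 'b) set \<Rightarrow> (nat \<Rightarrow> 'b) measure \<Rightarrow> (nat \<Rightarrow> 'b) measure" where
  "integrated \<equiv> integrated_measure G F \<beta> v0"

lemma reachable_from_v0:
  assumes "v \<in> verts G"
  obtains n where "transition_pow n v0 v \<noteq> 0" "transition_pow n v0 v < \<infinity>"
proof -
  have "\<exists>n. transition_pow n v0 v \<noteq> 0"
  proof (rule ccontr)
    assume "\<not> ?thesis"
    then have "greens v0 v = 0" by (simp add: green_def)
    then show False using green_v0[OF assms] by simp
  qed
  then obtain n where n: "transition_pow n v0 v \<noteq> 0" ..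
  have "transition_pow n v0 v \<le> greens v0 v"
    unfolding green_def using sum_le_suminf[of "\<lambda>n. transition_pow n v0 v" "{n}"] by simp
  then show thesis using that[OF n] green_v0[OF assms] by (auto intro: le_less_trans)
qed

text \<open>Walks from \<open>v0\<close> to \<open>w\<close> include those that first follow a fixed walk
  from \<open>v0\<close> to \<open>v\<close>.\<close>

lemma green_bound:
  assumes v: "v \<in> verts G"
  obtains c where "c < \<infinity>" "\<And>w. greens v w \<le> c * greens v0 w"
proof -
  obtain n where n: "transition_pow n v0 v \<noteq> 0" "transition_pow n v0 v < \<infinity>"
    using reachable_from_v0[OF v] .
  let ?a = "transition_pow n v0 v"
  show thesis
  proof (rule that)
    show "inverse ?a < \<infinity>" using n by (simp add: less_top[symmetric] ennreal_divide_eq_top_iff[of 1 ?a, simplified divide_ennreal_def mult_1])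
    fix w
    have "greens v w = inverse ?a * (?a * greens v w)"
      using n by (simp add: mult.assoc[symmetric] ennreal_inverse_mult[symmetric] less_top mult.commute[of "inverse ?a"] divide_ennreal_def[symmetric] ennreal_divide_self)
    also have "\<dots> \<le> inverse ?a * greens v0 w"
      by (intro mult_left_mono mat_pow_green_le v) simp
    finally show "greens v w \<le> inverse ?a * greens v0 w" .
  qed
qed

lemma green_finite: "v \<in> verts G \<Longrightarrow> w \<in> verts G \<Longrightarrow> greens v w < \<infinity>"
proof -
  assume v: "v \<in> verts G" and w: "w \<in> verts G"
  obtain c where c: "c < \<infinity>" "\<And>w. greens v w \<le> c * greens v0 w" using green_bound[OF v] by blast
  have "c * greens v0 w < \<infinity>" using c(1) green_v0[OF w] by (simp add: ennreal_mult_less_top)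
  then show ?thesis using c(2) by (rule le_less_trans[rotated])
qed

text \<open>The visits to \<open>w\<close> of paths from \<open>v\<close> have total mass \<open>greens v w
  * emeasure m (cyl w)\<close>, which is finite, so the Borel-Cantelli lemma applies.\<close>

lemma AE_transient:
  assumes sc: "semi_conformal m"
  shows "AE p in m. p \<in> transient_paths"
proof -
  have "AE p in m. p \<in> cyl v \<longrightarrow> (\<exists>n. \<forall>j\<ge>n. tail G (p j) \<noteq> w)"
    if v: "v \<in> verts G" and w: "w \<in> verts G" for v w
  proof -
    define A where "A n = {p \<in> cyl v. tail G (p n) = w}" for n
    have A_eq: "A n = {p \<in> cyl v. tail G (p n) = w \<and> (\<lambda>i. p (i + n)) \<in> paths}" for n
      using shift_n_in_paths by (auto simp: A_def vertex_cyl_def)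
    have P: "paths \<in> path_sets" using sets.top[of "path_borel G"] by simp
    have A_sets: "A n \<in> sets m" for n
      unfolding A_eq semi_conformalD(1)[OF sc] using P by measurable
    have em: "emeasure m (A n) = transition_pow n v w * emeasure m (cyl w)" for n
    proof -
      have "cyl w \<inter> paths = cyl w" by (auto simp: vertex_cyl_def)
      then show ?thesis unfolding A_eq using semi_conformal_steps[OF sc v P] by simp
    qed
    have fin: "emeasure m (A n) < \<infinity>" for n
    proof -
      have "emeasure m (A n) \<le> emeasure m (cyl v)"
        by (rule emeasure_mono) (auto simp: A_def semi_conformalD(1)[OF sc])
      then show ?thesis using semi_conformalD(3)[OF sc v] by (rule le_less_trans)
    qed
    have "(\<Sum>n. ennreal (measure m (A n))) = (\<Sum>n. emeasure m (A n))"
      using fin by (simp add: emeasure_eq_ennreal_measure less_top)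
    also have "\<dots> = greens v w * emeasure m (cyl w)"
      by (simp add: em green_def)
    also have "\<dots> \<noteq> \<top>"
      using green_finite[OF v w] semi_conformalD(3)[OF sc w] by (simp add: ennreal_mult_eq_top_iff less_top[symmetric])
    finally have "summable (\<lambda>n. measure m (A n))"
      by (rule summable_suminf_not_top[rotated]) simp
    from borel_cantelli_AE1[OF A_sets fin this] show ?thesis
      by eventually_elim (auto simp: eventually_sequentially A_def)
  qed
  then have "AE p in m. \<forall>v\<in>verts G. \<forall>w\<in>verts G. p \<in> cyl v \<longrightarrow> (\<exists>n. \<forall>j\<ge>n. tail G (p j) \<noteq> w)"
    by (intro AE_ball_countable[OF countable_verts, THEN iffD2] ballI)
  then show ?thesis
    using AE_space
    by eventually_elim
      (auto simp: transient_paths_def semi_conformalD(2)[OF sc] vertex_cyl_def inf_paths_tail)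
qed

end

section \<open>Limits of the Martin kernel along paths\<close>

text \<open>This form makes the theorems on series of measurable functions available for sums over the
  vertices.\<close>

lemma nn_integral_count_space_suminf:
  fixes f :: "'i \<Rightarrow> ennreal"
  assumes "countable I"
  shows "(\<integral>\<^sup>+i. f i \<partial>count_space I) =
    (\<Sum>n. if n \<in> to_nat_on I ` I then f (from_nat_into I n) else 0)"
proof -
  have bij: "bij_betw (from_nat_into I) (to_nat_on I ` I) I"
    by (rule bij_betwI[where g = "to_nat_on I"]) (use assms in auto)
  have "(\<integral>\<^sup>+i. f i \<partial>count_space I) = (\<integral>\<^sup>+n. f (from_nat_into I n) \<partial>count_space (to_nat_on I ` I))"
    by (rule nn_integral_bij_count_space[OF bij, symmetric])
  also have "\<dots> = (\<integral>\<^sup>+n. (if n \<in> to_nat_on I ` I then f (from_nat_into I n) else 0) \<partial>count_space UNIV)"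
    unfolding nn_integral_count_space_indicator[of "to_nat_on I ` I", unfolded NO_MATCH_def, OF TrueI]
    by (intro nn_integral_cong) (simp split: split_indicator)
  finally show ?thesis by (simp add: nn_integral_count_space_nat)
qed

lemma borel_measurable_nn_integral_count_space:
  fixes f :: "'i \<Rightarrow> 'c \<Rightarrow> ennreal"
  assumes "countable I" and [measurable]: "\<And>i. i \<in> I \<Longrightarrow> f i \<in> borel_measurable M"
  shows "(\<lambda>x. \<integral>\<^sup>+i. f i x \<partial>count_space I) \<in> borel_measurable M"
proof -
  have "(\<lambda>x. if n \<in> to_nat_on I ` I then f (from_nat_into I n) x else 0) \<in> borel_measurable M" for n
    using assms by (cases "n \<in> to_nat_on I ` I") auto
  then show ?thesis
    unfolding nn_integral_count_space_suminf[OF assms(1)] by measurable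
qed

lemma nn_integral_count_space_swap:
  fixes f :: "'i \<Rightarrow> 'c \<Rightarrow> ennreal"
  assumes "countable I" and "\<And>i. i \<in> I \<Longrightarrow> f i \<in> borel_measurable M"
  shows "(\<integral>\<^sup>+x. (\<integral>\<^sup>+i. f i x \<partial>count_space I) \<partial>M) = (\<integral>\<^sup>+i. (\<integral>\<^sup>+x. f i x \<partial>M) \<partial>count_space I)"
proof -
  have "(\<lambda>x. if n \<in> to_nat_on I ` I then f (from_nat_into I n) x else 0) \<in> borel_measurable M" for n
    using assms by (cases "n \<in> to_nat_on I ` I") auto
  then show ?thesis
    unfolding nn_integral_count_space_suminf[OF assms(1)]
    by (subst nn_integral_suminf) (auto intro!: suminf_cong)
qed

lemma null_set_of_equal_integrals:
  fixes f g :: "'c \<Rightarrow> ennreal"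
  assumes [measurable]: "f \<in> borel_measurable M" "g \<in> borel_measurable M" "E \<in> sets M"
    and less: "\<And>x. x \<in> E \<Longrightarrow> f x < g x"
    and eq: "(\<integral>\<^sup>+x\<in>E. f x \<partial>M) = (\<integral>\<^sup>+x\<in>E. g x \<partial>M)" and fin: "(\<integral>\<^sup>+x\<in>E. f x \<partial>M) \<noteq> \<infinity>"
  shows "emeasure M E = 0"
proof -
  have "AE x in M. g x * indicator E x \<le> f x * indicator E x"
  proof (rule ccontr)
    assume n: "\<not> ?thesis"
    have "(\<integral>\<^sup>+x\<in>E. f x \<partial>M) < (\<integral>\<^sup>+x\<in>E. g x \<partial>M)"
      by (rule nn_integral_less[OF _ _ fin _ n]) (use less in \<open>auto intro!: less_imp_le split: split_indicator\<close>)
    then show False using eq by simp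
  qed
  then have "AE x in M. x \<notin> E"
    by eventually_elim (use less in \<open>force split: split_indicator_asm\<close>)
  then show ?thesis by (simp add: AE_iff_measurable[OF assms(3)] AE_iff_null_sets[symmetric] null_setsD1 flip: null_setsD1)
qed

text \<open>On the set where $jd \le f < (j+1)d$, the integral of \<open>f\<close> over \<open>E0\<close>
  and the measure of \<open>E1\<close> are both within $2d$ times the measure of \<open>E0\<close>
  of each other; sum over $j$ and let $d$ tend to zero. The lower bound is only asked for
  constants strictly below the level: a sequence whose limit inferior is at least $a$ need not
  have a term that is at least $a$.\<close>

lemma nn_integral_level_sets:
  fixes f :: "'c \<Rightarrow> ennreal"
  assumes f[measurable]: "f \<in> borel_measurable M" and E[measurable]: "E0 \<in> sets M" "E1 \<in> sets M"
    and fin: "emeasure M E0 < \<infinity>" and f_fin: "\<And>x. x \<in> space M \<Longrightarrow> f x < \<infinity>"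
    and upper: "\<And>a b. emeasure M (E1 \<inter> {x \<in> space M. a \<le> f x \<and> f x < b}) \<le>
        b * emeasure M (E0 \<inter> {x \<in> space M. a \<le> f x \<and> f x < b})"
    and lower: "\<And>a b c. c < a \<Longrightarrow> c * emeasure M (E0 \<inter> {x \<in> space M. a \<le> f x \<and> f x < b}) \<le>
        emeasure M (E1 \<inter> {x \<in> space M. a \<le> f x \<and> f x < b})"
  shows "(\<integral>\<^sup>+x\<in>E0. f x \<partial>M) = emeasure M E1"
proof -
  have approx: "(\<integral>\<^sup>+x\<in>E0. f x \<partial>M) \<le> emeasure M E1 + 2 * ennreal d * emeasure M E0 \<and>
      emeasure M E1 \<le> (\<integral>\<^sup>+x\<in>E0. f x \<partial>M) + ennreal d * emeasure M E0" if d: "d > 0" for d :: real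
  proof -
    define t where "t j = ennreal (real j * d)" for j
    define L where "L j = {x \<in> space M. t j \<le> f x \<and> f x < t (Suc j)}" for j
    have [measurable]: "L j \<in> sets M" for j unfolding L_def by measurable
    have t_mono: "t i \<le> t j" if "i \<le> j" for i j
      unfolding t_def using that d by (intro ennreal_leI mult_right_mono) auto
    have t_Suc: "t (Suc j) = t j + ennreal d" for j
      unfolding t_def using d by (simp add: ennreal_plus[symmetric] distrib_right add.commute del: ennreal_plus)
    have disj: "disjoint_family L"
      unfolding disjoint_family_on_def
    proof (intro ballI impI equals0I)
      fix i j :: nat and x assume "i \<noteq> j" and x: "x \<in> L i \<inter> L j"
      then consider "Suc i \<le> j" | "Suc j \<le> i" by linarith
      then show False using x t_mono[of "Suc i" j] t_mono[of "Suc j" i] unfolding L_def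
        by cases (auto dest: order.strict_trans2)
    qed
    have cover: "(\<Union>j. L j) = space M"
    proof (intro equalityI subsetI)
      fix x assume x: "x \<in> space M"
      then obtain r where r: "f x = ennreal r" "r \<ge> 0" using f_fin[OF x] by (cases "f x") auto
      define j where "j = nat \<lfloor>r / d\<rfloor>"
      have "real j \<le> r / d" "r / d < real j + 1"
        using r(2) d by (auto simp: j_def)
      then have "real j * d \<le> r" "r < real (Suc j) * d"
        using d by (auto simp: field_simps)
      then have "x \<in> L j" using x r d by (auto simp: L_def t_def ennreal_lessI)
      then show "x \<in> (\<Union>j. L j)" by blast
    qed (auto simp: L_def)
    have split: "emeasure N S = (\<Sum>j. emeasure N (S \<inter> L j))" if "S \<in> sets M" "sets N = sets M" for S N
    proof -
      have "S = (\<Union>j. S \<inter> L j)" using cover sets.sets_into_space[OF that(1)] by auto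
      then have "emeasure N S = emeasure N (\<Union>j. S \<inter> L j)" by simp
      also have "\<dots> = (\<Sum>j. emeasure N (S \<inter> L j))"
        by (rule suminf_emeasure[symmetric]) (use that disj in \<open>auto simp: disjoint_family_on_def\<close>)
      finally show ?thesis .
    qed
    let ?I = "\<lambda>S. \<integral>\<^sup>+x\<in>S. f x \<partial>M"
    have splitI: "?I E0 = (\<Sum>j. ?I (E0 \<inter> L j))"
      using split[of E0 "density M f"] by (simp add: emeasure_density)
    have up: "?I (E0 \<inter> L j) \<le> t (Suc j) * emeasure M (E0 \<inter> L j)" for j
    proof -
      have "?I (E0 \<inter> L j) \<le> (\<integral>\<^sup>+x. t (Suc j) * indicator (E0 \<inter> L j) x \<partial>M)"
        by (intro nn_integral_mono) (auto simp: L_def less_imp_le split: split_indicator)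
      then show ?thesis by (simp add: nn_integral_cmult_indicator)
    qed
    have lo: "t j * emeasure M (E0 \<inter> L j) \<le> ?I (E0 \<inter> L j)" for j
    proof -
      have "(\<integral>\<^sup>+x. t j * indicator (E0 \<inter> L j) x \<partial>M) \<le> ?I (E0 \<inter> L j)"
        by (intro nn_integral_mono) (auto simp: L_def split: split_indicator)
      then show ?thesis by (simp add: nn_integral_cmult_indicator)
    qed
    have "?I (E0 \<inter> L j) \<le> emeasure M (E1 \<inter> L j) + 2 * ennreal d * emeasure M (E0 \<inter> L j)" for j
    proof (cases j)
      case 0
      have "t (Suc 0) \<le> 2 * ennreal d" using d by (simp add: t_Suc t_def mult_2)
      then have "t (Suc j) * emeasure M (E0 \<inter> L j) \<le> 2 * ennreal d * emeasure M (E0 \<inter> L j)"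
        by (intro mult_right_mono) (auto simp: 0)
      then show ?thesis by (intro order_trans[OF up] add_increasing) auto
    next
      case (Suc i)
      have "t i < t j" unfolding Suc t_def using d by (intro ennreal_lessI) auto
      from lower[OF this, of "t (Suc j)"]
      have "t i * emeasure M (E0 \<inter> L j) \<le> emeasure M (E1 \<inter> L j)" by (simp add: L_def)
      moreover have "t (Suc j) = t i + 2 * ennreal d" by (simp add: t_Suc Suc mult_2 add.assoc)
      ultimately show ?thesis
        using up[of j] by (simp add: distrib_right) (meson add_right_mono order_trans)
    qed
    then have "?I E0 \<le> (\<Sum>j. emeasure M (E1 \<inter> L j) + 2 * ennreal d * emeasure M (E0 \<inter> L j))"
      unfolding splitI by (intro suminf_le) auto
    also have "\<dots> = emeasure M E1 + 2 * ennreal d * emeasure M E0"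
      using split[of E1 M] split[of E0 M] by (simp add: suminf_add[symmetric])
    finally have 1: "?I E0 \<le> emeasure M E1 + 2 * ennreal d * emeasure M E0" .
    have "emeasure M (E1 \<inter> L j) \<le> ?I (E0 \<inter> L j) + ennreal d * emeasure M (E0 \<inter> L j)" for j
    proof -
      have "emeasure M (E1 \<inter> L j) \<le> t (Suc j) * emeasure M (E0 \<inter> L j)"
        using upper[of "t j" "t (Suc j)"] by (simp add: L_def)
      also have "\<dots> = t j * emeasure M (E0 \<inter> L j) + ennreal d * emeasure M (E0 \<inter> L j)"
        by (simp add: t_Suc distrib_right)
      finally show ?thesis using lo[of j] by (meson add_right_mono order_trans)
    qed
    then have "emeasure M E1 \<le> (\<Sum>j. ?I (E0 \<inter> L j) + ennreal d * emeasure M (E0 \<inter> L j))"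
      using split[of E1 M] by (simp add: suminf_le)
    also have "\<dots> = ?I E0 + ennreal d * emeasure M E0"
      unfolding splitI using split[of E0 M] by (simp add: suminf_add[symmetric])
    finally show ?thesis using 1 by blast
  qed
  obtain r where r: "emeasure M E0 = ennreal r" "r \<ge> 0" using fin by (cases "emeasure M E0") auto
  \<comment> \<open>The step \<open>e / (2 * (r + 1))\<close> makes the total error at most \<open>e\<close>, also for \<open>r = 0\<close>.\<close>
  have small: "2 * ennreal (e / (2 * (r + 1))) * emeasure M E0 \<le> ennreal e" if "e > 0" for e
  proof -
    have "2 * ennreal (e / (2 * (r + 1))) * emeasure M E0 = ennreal (2 * (e / (2 * (r + 1))) * r)"
    proof -
      have "2 * ennreal x * ennreal r = ennreal (2 * x * r)" if "x \<ge> 0" for x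
        using that r(2) by (simp add: ennreal_mult)
      then show ?thesis using r that by simp
    qed
    also have "\<dots> \<le> ennreal e"
      using r that by (intro ennreal_leI) (simp add: field_simps)
    finally show ?thesis .
  qed
  show ?thesis
  proof (rule antisym; rule ennreal_le_epsilon)
    fix e :: real assume e: "e > 0"
    then have d: "e / (2 * (r + 1)) > 0" using r by simp
    show "(\<integral>\<^sup>+x\<in>E0. f x \<partial>M) \<le> emeasure M E1 + ennreal e"
      using approx[OF d, THEN conjunct1] add_left_mono[OF small[OF e]] by (rule order_trans)
    have le: "ennreal (e / (2 * (r + 1))) * emeasure M E0 \<le> 2 * ennreal (e / (2 * (r + 1))) * emeasure M E0"
    proof (intro mult_right_mono)
      have "x \<le> 2 * x" for x :: ennreal by (simp add: mult_2)
      then show "ennreal (e / (2 * (r + 1))) \<le> 2 * ennreal (e / (2 * (r + 1)))" .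
    qed simp
    show "emeasure M E1 \<le> (\<integral>\<^sup>+x\<in>E0. f x \<partial>M) + ennreal e"
      using approx[OF d, THEN conjunct2] add_left_mono[OF order_trans[OF le small[OF e]]] by (rule order_trans)
  qed
qed

context martin_graph
begin

text \<open>Unlike the limit, the limit inferior is a measurable function on all paths and exactly invariant
  under the shift.\<close>

definition lower_limit :: "'a \<Rightarrow> (nat \<Rightarrow> 'b) \<Rightarrow> ennreal" where
  "lower_limit v p = liminf (\<lambda>k. kernel v (tail G (p k)))"

lemma measurable_martin_kernel [measurable]:
  "(\<lambda>p. kernel v (tail G (p k))) \<in> borel_measurable (path_borel G)"
  by (rule measurable_compose[OF measurable_tail]) simp

lemma measurable_lower_limit [measurable]: "lower_limit v \<in> borel_measurable (path_borel G)"
  unfolding lower_limit_def[abs_def] by measurable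

lemma liminf_kernel_shift:
  "liminf (\<lambda>k. kernel v (tail G (path_shift p k))) =
   liminf (\<lambda>k. kernel v (tail G (p k)))"
  using liminf_shift[of "\<lambda>k. kernel v (tail G (p k))"] by (simp add: path_shift_def)

lemma limsup_kernel_shift:
  "limsup (\<lambda>k. kernel v (tail G (path_shift p k))) =
   limsup (\<lambda>k. kernel v (tail G (p k)))"
  using limsup_shift[of "\<lambda>k. kernel v (tail G (p k))"] by (simp add: path_shift_def)

lemma lower_limit_shift: "lower_limit v (path_shift p) = lower_limit v p"
  unfolding lower_limit_def by (rule liminf_kernel_shift)

lemma kernel_mult_green:
  assumes "w \<in> verts G"
  shows "kernel v w * greens v0 w = greens v w"
  using green_v0[OF assms] unfolding martin_kernel_def
  by (simp add: ennreal_divide_times[symmetric] ennreal_mult_divide_eq less_top)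
    (metis ennreal_mult_divide_eq ennreal_times_divide mult.commute not_gr_zero top.not_eq_extremum)

lemma kernel_v0: "w \<in> verts G \<Longrightarrow> kernel v0 w = 1"
  using green_v0[of w] by (simp add: martin_kernel_def ennreal_divide_self zero_less_iff_neq_zero)

lemma kernel_bound:
  assumes v: "v \<in> verts G"
  obtains c where "c < \<infinity>" "\<And>w. w \<in> verts G \<Longrightarrow> kernel v w \<le> c"
proof -
  obtain c where c: "c < \<infinity>" "\<And>w. greens v w \<le> c * greens v0 w" using green_bound[OF v] by blast
  show thesis
  proof (rule that[OF c(1)])
    fix w assume w: "w \<in> verts G"
    have "kernel v w \<le> c * greens v0 w / greens v0 w"
      unfolding martin_kernel_def by (rule divide_right_mono_ennreal[OF c(2)])
    also have "\<dots> = c" using green_v0[OF w] by (simp add: ennreal_mult_divide_eq zero_less_iff_neq_zero flip: less_top)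
    finally show "kernel v w \<le> c" .
  qed
qed

lemma lower_limit_v0: "p \<in> paths \<Longrightarrow> lower_limit v0 p = 1"
  unfolding lower_limit_def by (simp add: kernel_v0 inf_paths_tail Liminf_const)

lemma lower_limit_bound:
  assumes v: "v \<in> verts G"
  obtains c where "c < \<infinity>" "\<And>p. p \<in> paths \<Longrightarrow> lower_limit v p \<le> c"
proof -
  obtain c where c: "c < \<infinity>" "\<And>w. w \<in> verts G \<Longrightarrow> kernel v w \<le> c"
    using kernel_bound[OF v] by blast
  show thesis
  proof (rule that[OF c(1)])
    fix p assume "p \<in> paths"
    then have "limsup (\<lambda>k. kernel v (tail G (p k))) \<le> c"
      by (intro Limsup_bounded always_eventually allI c(2) inf_paths_tail)
    then show "lower_limit v p \<le> c"
      unfolding lower_limit_def using Liminf_le_Limsup[of sequentially] by (auto intro: order_trans)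
  qed
qed

lemma lower_limit_finite: "v \<in> verts G \<Longrightarrow> p \<in> paths \<Longrightarrow> lower_limit v p < \<infinity>"
  using lower_limit_bound[of v] by (metis le_less_trans)

text \<open>A path whose lower limit is less than \<open>a\<close> meets a vertex where the kernel is at
  most \<open>a\<close>.\<close>

lemma kernel_upper_comparison:
  assumes sc: "semi_conformal m" and v: "v \<in> verts G"
    and D: "shift_invariant D" "D \<subseteq> transient_paths"
    and less: "\<And>p. p \<in> D \<Longrightarrow> lower_limit v p < a"
  shows "emeasure m (cyl v \<inter> D) \<le> a * emeasure m (cyl v0 \<inter> D)"
proof -
  have "1 * emeasure m (cyl v \<inter> D) \<le> a * emeasure m (cyl v0 \<inter> D)"
  proof (rule hitting_comparison[OF sc v v0 D, where W = "{w. kernel v w \<le> a}"])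
    fix p assume p: "p \<in> D"
    show "\<exists>k. tail G (p k) \<in> {w. kernel v w \<le> a}"
    proof (rule ccontr)
      assume "\<not> ?thesis"
      then have "a \<le> lower_limit v p"
        unfolding lower_limit_def by (intro Liminf_bounded always_eventually) (auto simp: not_le intro: less_imp_le)
      then show False using less[OF p] by simp
    qed
  next
    fix w assume "w \<in> {w. kernel v w \<le> a}" "w \<in> verts G"
    then show "1 * greens v w \<le> a * greens v0 w"
      using kernel_mult_green[of w v] by (metis mem_Collect_eq mult_1 mult_right_mono zero_le)
  qed
  then show ?thesis by simp
qed

lemma kernel_lower_comparison:
  assumes sc: "semi_conformal m" and v: "v \<in> verts G"
    and D: "shift_invariant D" "D \<subseteq> transient_paths"
    and less: "\<And>p. p \<in> D \<Longrightarrow> b < limsup (\<lambda>k. kernel v (tail G (p k)))"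
  shows "b * emeasure m (cyl v0 \<inter> D) \<le> emeasure m (cyl v \<inter> D)"
proof -
  have "b * emeasure m (cyl v0 \<inter> D) \<le> 1 * emeasure m (cyl v \<inter> D)"
  proof (rule hitting_comparison[OF sc v0 v D, where W = "{w. b \<le> kernel v w}"])
    fix p assume p: "p \<in> D"
    show "\<exists>k. tail G (p k) \<in> {w. b \<le> kernel v w}"
    proof (rule ccontr)
      assume "\<not> ?thesis"
      then have "limsup (\<lambda>k. kernel v (tail G (p k))) \<le> b"
        by (intro Limsup_bounded always_eventually) (auto simp: not_le less_imp_le)
      then show False using less[OF p] by simp
    qed
  next
    fix w assume "w \<in> {w. b \<le> kernel v w}" "w \<in> verts G"
    then show "b * greens v0 w \<le> 1 * greens v w"
      using kernel_mult_green[of w v] by (metis mem_Collect_eq mult_1 mult_right_mono zero_le)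
  qed
  then show ?thesis by simp
qed

text \<open>Each vertex is the end of a walk of positive weight from \<open>v0\<close>, and prepending it to
  a path does not leave an invariant set.\<close>

lemma shift_invariant_null:
  assumes sc: "semi_conformal m" and D: "shift_invariant D"
    and null: "emeasure m (cyl v0 \<inter> D) = 0"
  shows "emeasure m D = 0"
proof -
  note [measurable] = shift_invariant_sets[OF D]
  have "emeasure m (cyl v \<inter> D) = 0" if v: "v \<in> verts G" for v
  proof -
    obtain n where n: "transition_pow n v0 v \<noteq> 0" using reachable_from_v0[OF v] .
    have "transition_pow n v0 v * emeasure m (cyl v \<inter> D) =
        emeasure m {p \<in> cyl v0. tail G (p n) = v \<and> (\<lambda>i. p (i + n)) \<in> D}"
      by (rule semi_conformal_steps[OF sc v0 shift_invariant_sets[OF D], symmetric])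
    also have "\<dots> \<le> emeasure m (cyl v0 \<inter> D)"
    proof (rule emeasure_mono)
      show "{p \<in> cyl v0. tail G (p n) = v \<and> (\<lambda>i. p (i + n)) \<in> D} \<subseteq> cyl v0 \<inter> D"
      proof
        fix p assume p: "p \<in> {p \<in> cyl v0. tail G (p n) = v \<and> (\<lambda>i. p (i + n)) \<in> D}"
        then have "p \<in> paths" by (simp add: vertex_cyl_def)
        from shift_invariant_shift_n[OF D this, of n] show "p \<in> cyl v0 \<inter> D" using p by blast
      qed
      show "cyl v0 \<inter> D \<in> sets m" unfolding semi_conformalD(1)[OF sc] by measurable
    qed
    finally show ?thesis using n null by simp
  qed
  then have "(\<integral>\<^sup>+v. emeasure m (cyl v \<inter> D) \<partial>count_space (verts G)) = (\<integral>\<^sup>+v. 0 \<partial>count_space (verts G))"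
    by (intro nn_integral_cong) auto
  then show ?thesis
    by (subst emeasure_vertex_cyl_sum) (simp_all add: semi_conformalD(1)[OF sc])
qed

lemma AE_not_in_invariant:
  assumes sc: "semi_conformal m" and D: "shift_invariant D"
    and null: "emeasure m (cyl v0 \<inter> D) = 0"
  shows "AE p in m. p \<notin> D"
  using shift_invariant_null[OF assms] shift_invariant_sets[OF D]
  by (intro AE_not_in null_setsI) (simp_all add: semi_conformalD(1)[OF sc])

lemma emeasure_vertex_cyl_Int_finite:
  assumes "semi_conformal m" "v \<in> verts G" 
  shows "emeasure m (cyl v \<inter> D) < \<infinity>"
proof -
  have "emeasure m (cyl v \<inter> D) \<le> emeasure m (cyl v)"
    by (rule emeasure_mono) (auto simp: semi_conformalD(1)[OF assms(1)])
  then show ?thesis using semi_conformalD(3)[OF assms] by (rule le_less_trans)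
qed

text \<open>Let \<open>D\<close> be the set of transient paths along which the kernel has limit inferior
  below \<open>a\<close> and limit superior above \<open>b\<close>, where \<open>a < b\<close>.
  The two comparisons give $b\, m(Z(v_0) \cap D) \le m(Z(v) \cap D) \le a\, m(Z(v_0) \cap D)$, so
  \<open>D\<close> is null.\<close>

lemma AE_kernel_converges:
  assumes sc: "semi_conformal m"
  shows "AE p in m. \<forall>v\<in>verts G. (\<lambda>k. kernel v (tail G (p k))) \<longlonglongrightarrow> lower_limit v p"
proof (intro AE_ball_countable[OF countable_verts, THEN iffD2] ballI)
  fix v assume v: "v \<in> verts G"
  let ?l = "\<lambda>p. liminf (\<lambda>k. kernel v (tail G (p k)))"
  let ?u = "\<lambda>p. limsup (\<lambda>k. kernel v (tail G (p k)))"
  obtain B :: "ennreal set" where B: "countable B" "\<And>x y. x < y \<Longrightarrow> \<exists>b\<in>B. x < b \<and> b < y"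
    using countable_separating_set_dense_linorder by metis
  have "AE p in m. \<not> (?l p < a \<and> b < ?u p)" if ab: "a < b" for a b
  proof -
    let ?D = "{p \<in> paths. ?l p < a \<and> b < ?u p} \<inter> transient_paths"
    have D: "shift_invariant ?D"
      by (intro shift_invariant_Int shift_invariant_transient shift_invariant_Collect)
        (measurable, simp add: liminf_kernel_shift limsup_kernel_shift)
    let ?x = "emeasure m (cyl v0 \<inter> ?D)"
    have "b * ?x \<le> emeasure m (cyl v \<inter> ?D)"
      by (rule kernel_lower_comparison[OF sc v D]) auto
    also have "\<dots> \<le> a * ?x"
      by (rule kernel_upper_comparison[OF sc v D]) (auto simp: lower_limit_def)
    finally have le: "b * ?x \<le> a * ?x" .
    have "?x = 0"
    proof (rule ccontr)
      assume "?x \<noteq> 0"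
      then have "a * ?x < b * ?x"
        using ab emeasure_vertex_cyl_Int_finite[OF sc v0] by (intro ennreal_mult_strict_right_mono) (auto simp: zero_less_iff_neq_zero)
      then show False using le by simp
    qed
    from AE_not_in_invariant[OF sc D this] AE_transient[OF sc] AE_space show ?thesis
      by eventually_elim (auto simp: semi_conformalD(2)[OF sc])
  qed
  then have "AE p in m. \<forall>a\<in>B. \<forall>b\<in>B. a < b \<longrightarrow> \<not> (?l p < a \<and> b < ?u p)"
    using B(1) by (intro AE_ball_countable[THEN iffD2] ballI) auto
  then show "AE p in m. (\<lambda>k. kernel v (tail G (p k))) \<longlonglongrightarrow> lower_limit v p"
  proof eventually_elim
    case (elim p)
    have "\<not> ?l p < ?u p"
    proof
      assume "?l p < ?u p"
      then obtain b where b: "b \<in> B" "?l p < b" "b < ?u p" using B(2) by blast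
      then obtain a where "a \<in> B" "?l p < a" "a < b" using B(2) by blast
      then show False using elim b by blast
    qed
    then have "?u p = ?l p" using Liminf_le_Limsup[of sequentially] by (metis order.not_eq_order_implies_strict trivial_limit_sequentially)
    then show ?case
      unfolding lower_limit_def by (intro Liminf_eq_Limsup) simp_all
  qed
qed

text \<open>The two comparisons, on the level sets of the lower limit, are the hypotheses of
  \<open>nn_integral_level_sets\<close>.\<close>

lemma invariant_integral_transient:
  assumes sc: "semi_conformal m" and v: "v \<in> verts G" and D: "shift_invariant D" "D \<subseteq> transient_paths"
  shows "(\<integral>\<^sup>+p\<in>cyl v0 \<inter> D. lower_limit v p \<partial>m) = emeasure m (cyl v \<inter> D)"
proof (rule nn_integral_level_sets)
  note [measurable_cong] = semi_conformalD(1)[OF sc] and [measurable] = shift_invariant_sets[OF D(1)]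
  note sp = semi_conformalD(2)[OF sc]
  show "lower_limit v \<in> borel_measurable m" by measurable
  show "cyl v0 \<inter> D \<in> sets m" "cyl v \<inter> D \<in> sets m" by measurable
  show "emeasure m (cyl v0 \<inter> D) < \<infinity>" by (rule emeasure_vertex_cyl_Int_finite[OF sc v0])
  show "lower_limit v x < \<infinity>" if "x \<in> space m" for x
    using that lower_limit_finite[OF v] by (simp add: sp)
  fix a b :: ennreal
  let ?L = "{x \<in> paths. a \<le> lower_limit v x \<and> lower_limit v x < b}"
  have "shift_invariant ?L"
    by (rule shift_invariant_Collect) (measurable, simp add: lower_limit_shift)
  then have DL: "shift_invariant (D \<inter> ?L)" "D \<inter> ?L \<subseteq> transient_paths"
    using D shift_invariant_Int by auto
  show "emeasure m (cyl v \<inter> D \<inter> {x \<in> space m. a \<le> lower_limit v x \<and> lower_limit v x < b}) \<le>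
      b * emeasure m (cyl v0 \<inter> D \<inter> {x \<in> space m. a \<le> lower_limit v x \<and> lower_limit v x < b})"
    unfolding sp Int_assoc by (rule kernel_upper_comparison[OF sc v DL]) auto
  show "c * emeasure m (cyl v0 \<inter> D \<inter> {x \<in> space m. a \<le> lower_limit v x \<and> lower_limit v x < b}) \<le>
      emeasure m (cyl v \<inter> D \<inter> {x \<in> space m. a \<le> lower_limit v x \<and> lower_limit v x < b})" if c: "c < a" for c
    unfolding sp Int_assoc
  proof (rule kernel_lower_comparison[OF sc v DL])
    fix p assume "p \<in> D \<inter> ?L"
    then have "c < lower_limit v p" using c by auto
    then show "c < limsup (\<lambda>k. kernel v (tail G (p k)))"
      unfolding lower_limit_def using Liminf_le_Limsup[of sequentially] by (auto intro: less_le_trans)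
  qed
qed

lemma invariant_integral:
  assumes sc: "semi_conformal m" and v: "v \<in> verts G" and D: "shift_invariant D"
  shows "(\<integral>\<^sup>+p\<in>cyl v0 \<inter> D. lower_limit v p \<partial>m) = emeasure m (cyl v \<inter> D)"
proof -
  let ?D = "D \<inter> transient_paths"
  note [measurable_cong] = semi_conformalD(1)[OF sc]
  note [measurable] = shift_invariant_sets[OF D] shift_invariant_sets[OF shift_invariant_transient]
  have "(\<integral>\<^sup>+p\<in>cyl v0 \<inter> D. lower_limit v p \<partial>m) = (\<integral>\<^sup>+p\<in>cyl v0 \<inter> ?D. lower_limit v p \<partial>m)"
    by (rule nn_integral_cong_AE, use AE_transient[OF sc] in eventually_elim) (auto split: split_indicator)
  also have "\<dots> = emeasure m (cyl v \<inter> ?D)"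
    by (rule invariant_integral_transient[OF sc v]) (use D shift_invariant_transient shift_invariant_Int in auto)
  also have "\<dots> = emeasure m (cyl v \<inter> D)"
  proof (rule emeasure_eq_AE)
    show "AE p in m. p \<in> cyl v \<inter> ?D \<longleftrightarrow> p \<in> cyl v \<inter> D"
      using AE_transient[OF sc] by eventually_elim auto
  qed measurable
  finally show ?thesis .
qed

section \<open>Disintegration along the limits\<close>


definition harmonic_paths :: "(nat \<Rightarrow> 'b) set" where
  "harmonic_paths = {p \<in> paths. invariant_vec (\<lambda>v. lower_limit v p)}"

text \<open>The null measure as default keeps the family semi-conformal and measurable in \<open>p\<close>
  without exceptional sets.\<close>

definition limit_measure :: "(nat \<Rightarrow> 'b) \<Rightarrow> (nat \<Rightarrow> 'b) measure" where
  "limit_measure p = (if p \<in> harmonic_paths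
     then (THE m. semi_conformal m \<and> (\<forall>v\<in>verts G. emeasure m (cyl v) = lower_limit v p))
     else null_measure (path_borel G))"

lemma measurable_transition_lower_limit [measurable]:
  "(\<lambda>p. \<integral>\<^sup>+w. transition v w * lower_limit w p \<partial>count_space (verts G)) \<in> borel_measurable (path_borel G)"
  by (rule borel_measurable_nn_integral_count_space[OF countable_verts]) measurable

lemma harmonic_paths_eq:
  "harmonic_paths = {p \<in> paths. \<forall>v\<in>verts G.
     (\<integral>\<^sup>+w. transition v w * lower_limit w p \<partial>count_space (verts G)) = lower_limit v p}"
  using lower_limit_finite by (auto simp: harmonic_paths_def invariant_vec_def)

lemma shift_invariant_harmonic_paths: "shift_invariant harmonic_paths"
  unfolding harmonic_paths_eq
proof (rule shift_invariant_Collect)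
  have "{p \<in> space (path_borel G). \<forall>v\<in>verts G.
     (\<integral>\<^sup>+w. transition v w * lower_limit w p \<partial>count_space (verts G)) = lower_limit v p} \<in> path_sets"
    by (rule sets.sets_Collect_countable_All'[OF _ countable_verts]) measurable
  then show "Measurable.pred (path_borel G) (\<lambda>p. \<forall>v\<in>verts G.
     (\<integral>\<^sup>+w. transition v w * lower_limit w p \<partial>count_space (verts G)) = lower_limit v p)"
    by (simp add: pred_def)
qed (simp add: lower_limit_shift)

lemma semi_conformal_restrict:
  assumes sc: "semi_conformal m" and D: "shift_invariant D"
  shows "semi_conformal (density m (indicator D))"
proof -
  note [measurable_cong] = semi_conformalD(1)[OF sc] and [measurable] = shift_invariant_sets[OF D]
  have D_sets: "D \<in> sets m" by measurable
  have e: "emeasure (density m (indicator D)) B = emeasure m (D \<inter> B)" if "B \<in> path_sets" for B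
    using that D_sets by (intro emeasure_restricted) (simp_all add: semi_conformalD(1)[OF sc])
  show ?thesis
    unfolding semi_conformal_def
  proof (intro conjI ballI)
    fix a B assume a: "a \<in> arcs G" and [measurable]: "B \<in> path_sets"
    have "D \<inter> {p \<in> arrow_cyl G a. path_shift p \<in> B} = {p \<in> arrow_cyl G a. path_shift p \<in> D \<inter> B}"
      using D by (auto simp: shift_invariant_def arrow_cyl_def)
    moreover have "D \<inter> (cyl (head G a) \<inter> B) = cyl (head G a) \<inter> (D \<inter> B)" by auto
    ultimately show "emeasure (density m (indicator D)) {p \<in> arrow_cyl G a. path_shift p \<in> B} =
       arrow_wt a * emeasure (density m (indicator D)) (cyl (head G a) \<inter> B)"
      using semi_conformalD(4)[OF sc a, of "D \<inter> B"] by (simp add: e)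
  next
    fix v assume "v \<in> verts G"
    then show "emeasure (density m (indicator D)) (cyl v) < \<infinity>"
      using emeasure_vertex_cyl_Int_finite[OF sc, of v D] by (simp add: e Int_commute)
  qed (simp add: semi_conformalD(1)[OF sc])
qed

text \<open>By \<open>invariant_integral\<close> both sides are statements about the masses of the sets
  \<open>cyl w \<inter> D\<close>, and these form an invariant vector, because \<open>D\<close> is
  invariant.\<close>

lemma integral_transition_lower_limit:
  assumes sc: "semi_conformal m" and v: "v \<in> verts G" and D: "shift_invariant D"
  shows "(\<integral>\<^sup>+p\<in>cyl v0 \<inter> D. (\<integral>\<^sup>+w. transition v w * lower_limit w p \<partial>count_space (verts G)) \<partial>m) =
    (\<integral>\<^sup>+p\<in>cyl v0 \<inter> D. lower_limit v p \<partial>m)"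
proof -
  note [measurable_cong] = semi_conformalD(1)[OF sc] and [measurable] = shift_invariant_sets[OF D]
  let ?E = "cyl v0 \<inter> D"
  have "(\<integral>\<^sup>+p\<in>?E. (\<integral>\<^sup>+w. transition v w * lower_limit w p \<partial>count_space (verts G)) \<partial>m) =
      (\<integral>\<^sup>+p. (\<integral>\<^sup>+w. transition v w * (lower_limit w p * indicator ?E p) \<partial>count_space (verts G)) \<partial>m)"
    by (simp add: mult.assoc flip: nn_integral_multc)
  also have "\<dots> = (\<integral>\<^sup>+w. (\<integral>\<^sup>+p. transition v w * (lower_limit w p * indicator ?E p) \<partial>m) \<partial>count_space (verts G))"
    by (rule nn_integral_count_space_swap[OF countable_verts]) measurable
  also have "\<dots> = (\<integral>\<^sup>+w. transition v w * (\<integral>\<^sup>+p\<in>?E. lower_limit w p \<partial>m) \<partial>count_space (verts G))"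
    by (intro nn_integral_cong nn_integral_cmult) measurable
  also have "\<dots> = (\<integral>\<^sup>+w. transition v w * emeasure m (cyl w \<inter> D) \<partial>count_space (verts G))"
    by (intro nn_integral_cong) (simp add: invariant_integral[OF sc _ D])
  also have "\<dots> = emeasure m {p \<in> cyl v. path_shift p \<in> D}"
    by (rule semi_conformal_step[OF sc v shift_invariant_sets[OF D], symmetric])
  also have "{p \<in> cyl v. path_shift p \<in> D} = cyl v \<inter> D"
    using D by (auto simp: shift_invariant_def vertex_cyl_def)
  finally show ?thesis by (simp add: invariant_integral[OF sc v D])
qed

text \<open>If one side of the harmonicity equation exceeded the other on a set of positive measure, this
  set would be invariant and contradict the equality of integrals over it.\<close>

lemma AE_harmonic:
  assumes sc: "semi_conformal m"
  shows "AE p in m. p \<in> harmonic_paths"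
proof -
  note [measurable_cong] = semi_conformalD(1)[OF sc]
  let ?s = "\<lambda>v p. \<integral>\<^sup>+w. transition v w * lower_limit w p \<partial>count_space (verts G)"
  have "AE p in m. ?s v p = lower_limit v p" if v: "v \<in> verts G" for v
  proof -
    let ?D1 = "{p \<in> paths. ?s v p < lower_limit v p}" and ?D2 = "{p \<in> paths. lower_limit v p < ?s v p}"
    have D1: "shift_invariant ?D1"
      by (rule shift_invariant_Collect) (measurable, simp add: lower_limit_shift)
    have D2: "shift_invariant ?D2"
      by (rule shift_invariant_Collect) (measurable, simp add: lower_limit_shift)
    have E1: "cyl v0 \<inter> ?D1 \<in> sets m" and E2: "cyl v0 \<inter> ?D2 \<in> sets m"
      using shift_invariant_sets[OF D1] shift_invariant_sets[OF D2]
      by (simp_all only: semi_conformalD(1)[OF sc] sets.Int sets_vertex_cyl)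
    have sm: "?s v \<in> borel_measurable m" and lm: "lower_limit v \<in> borel_measurable m"
      by measurable
    have fin: "(\<integral>\<^sup>+p\<in>cyl v0 \<inter> D. lower_limit v p \<partial>m) \<noteq> \<infinity>" if "shift_invariant D" for D
      using emeasure_vertex_cyl_Int_finite[OF sc v] by (simp add: invariant_integral[OF sc v that] less_top)
    have "emeasure m (cyl v0 \<inter> ?D1) = 0"
      by (rule null_set_of_equal_integrals[of "?s v" _ "lower_limit v"])
        (use sm lm E1 integral_transition_lower_limit[OF sc v D1] fin[OF D1] in auto)
    moreover have "emeasure m (cyl v0 \<inter> ?D2) = 0"
      by (rule null_set_of_equal_integrals[of "lower_limit v" _ "?s v"])
        (use sm lm E2 integral_transition_lower_limit[OF sc v D2] fin[OF D2] in auto)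
    ultimately have "AE p in m. p \<notin> ?D1" "AE p in m. p \<notin> ?D2"
      using AE_not_in_invariant[OF sc D1] AE_not_in_invariant[OF sc D2] by blast+
    then show ?thesis
      using AE_space by eventually_elim (auto simp: semi_conformalD(2)[OF sc] not_less intro: antisym)
  qed
  then have "AE p in m. \<forall>v\<in>verts G. ?s v p = lower_limit v p"
    by (intro AE_ball_countable[OF countable_verts, THEN iffD2] ballI)
  then show ?thesis
    using AE_space by eventually_elim (simp add: harmonic_paths_eq semi_conformalD(2)[OF sc])
qed

lemma semi_conformal_null: "semi_conformal (null_measure (path_borel G))"
  by (auto simp: semi_conformal_def)

lemma limit_measure_harmonic:
  assumes "p \<in> harmonic_paths"
  shows "semi_conformal (limit_measure p) \<and> (\<forall>v\<in>verts G. emeasure (limit_measure p) (cyl v) = lower_limit v p)"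
proof -
  have "\<exists>!m. semi_conformal m \<and> (\<forall>v\<in>verts G. emeasure m (cyl v) = lower_limit v p)"
  proof (rule ex_ex1I)
    show "\<exists>m. semi_conformal m \<and> (\<forall>v\<in>verts G. emeasure m (cyl v) = lower_limit v p)"
      using conformal_measure_exists[of "\<lambda>v. lower_limit v p"] assms by (simp add: harmonic_paths_def)
  qed (auto intro: semi_conformal_eqI)
  from theI'[OF this] show ?thesis using assms by (simp add: limit_measure_def)
qed

lemma semi_conformal_limit_measure: "semi_conformal (limit_measure p)"
  using limit_measure_harmonic[of p] semi_conformal_null
  by (cases "p \<in> harmonic_paths") (auto simp: limit_measure_def)

lemma sets_limit_measure [simp]: "sets (limit_measure p) = path_sets"
  by (rule semi_conformalD(1)[OF semi_conformal_limit_measure])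

lemma limit_measure_vertex_cyl:
  "v \<in> verts G \<Longrightarrow> emeasure (limit_measure p) (cyl v) = lower_limit v p * indicator harmonic_paths p"
  using limit_measure_harmonic[of p] by (cases "p \<in> harmonic_paths") (auto simp: limit_measure_def)

lemma limit_measure_unique:
  assumes "semi_conformal m" "p \<in> harmonic_paths"
    and "\<And>v. v \<in> verts G \<Longrightarrow> emeasure m (cyl v) = lower_limit v p"
  shows "m = limit_measure p"
  using assms limit_measure_harmonic[OF assms(2)] by (intro semi_conformal_eqI) auto

lemma limit_measure_shift:
  assumes "p \<in> paths"
  shows "limit_measure (path_shift p) = limit_measure p"
proof -
  have "path_shift p \<in> harmonic_paths \<longleftrightarrow> p \<in> harmonic_paths"
    using shift_invariant_harmonic_paths assms by (simp add: shift_invariant_def)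
  then show ?thesis by (simp add: limit_measure_def lower_limit_shift)
qed

text \<open>On a cylinder the mass is a constant multiple of a lower limit. The generator argument runs
  inside one vertex cylinder at a time, where the measures are finite and complements can be
  subtracted.\<close>

lemma measurable_limit_measure:
  assumes B: "B \<in> path_sets"
  shows "(\<lambda>p. emeasure (limit_measure p) B) \<in> borel_measurable (path_borel G)"
proof -
  note [measurable] = shift_invariant_sets[OF shift_invariant_harmonic_paths]
  have part: "(\<lambda>p. emeasure (limit_measure p) (cyl v \<inter> B)) \<in> borel_measurable (path_borel G)"
    if v: "v \<in> verts G" for v
    using Int_stable_zcyls zcyls_Pow B[unfolded sets_path_borel_zcyls]
  proof (induction rule: sigma_sets_induct_disjoint)
    case (basic A)
    show ?case
    proof (cases "cyl v \<inter> A = {}")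
      case False
      then obtain z where z: "z \<in> cyl v" "z \<in> A" by blast
      then obtain n x where x: "x \<in> paths" "A = zcyl n x" using basic by (auto simp: zcyls_def)
      then have "tail G (x 0) = v" using z by (auto simp: zcyl_def vertex_cyl_def)
      note 2 = x this
      have "cyl v \<inter> A = zcyl n x" using 2 by (auto simp: zcyl_def vertex_cyl_def)
      then have "(\<lambda>p. emeasure (limit_measure p) (cyl v \<inter> A)) =
          (\<lambda>p. path_wt n x * (lower_limit (tail G (x n)) p * indicator harmonic_paths p))"
        using inf_paths_tail[OF 2(1)]
        by (simp add: semi_conformal_zcyl[OF semi_conformal_limit_measure 2(1)] limit_measure_vertex_cyl)
      then show ?thesis by simp
    qed simp
  next
    case empty
    then show ?case by simp
  next
    case (compl A)
    have A: "A \<in> path_sets" using compl.hyps by (simp add: sets_path_borel_zcyls)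
    have "emeasure (limit_measure p) (cyl v \<inter> (paths - A)) =
        lower_limit v p * indicator harmonic_paths p - emeasure (limit_measure p) (cyl v \<inter> A)" for p
    proof -
      have "cyl v \<inter> (paths - A) = cyl v - cyl v \<inter> A"
        by (auto simp: vertex_cyl_def)
      moreover have "emeasure (limit_measure p) (cyl v - cyl v \<inter> A) =
          emeasure (limit_measure p) (cyl v) - emeasure (limit_measure p) (cyl v \<inter> A)"
        by (rule emeasure_Diff)
          (use A emeasure_vertex_cyl_Int_finite[OF semi_conformal_limit_measure v, of p A] in \<open>auto simp: less_top\<close>)
      ultimately show ?thesis by (simp add: limit_measure_vertex_cyl[OF v])
    qed
    then show ?case using compl.IH by simp
  next
    case (union A)
    have A: "A i \<in> path_sets" for i using union.hyps by (auto simp: sets_path_borel_zcyls)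
    have "emeasure (limit_measure p) (cyl v \<inter> (\<Union>i. A i)) =
        (\<Sum>i. emeasure (limit_measure p) (cyl v \<inter> A i))" for p
      unfolding Int_UN_distrib
      by (rule suminf_emeasure[symmetric]) (use A union.hyps in \<open>auto simp: disjoint_family_on_def\<close>)
    then show ?case using union.IH by simp
  qed
  have "emeasure (limit_measure p) B = (\<integral>\<^sup>+v. emeasure (limit_measure p) (cyl v \<inter> B) \<partial>count_space (verts G))" for p
    by (rule emeasure_vertex_cyl_sum) (use B in auto)
  then show ?thesis
    using borel_measurable_nn_integral_count_space[OF countable_verts part] by simp
qed

lemma mixture_limit_measure:
  assumes sets: "sets N = path_sets"
    and fin: "emeasure N paths < \<infinity>"
  shows "semi_conformal (mixture N (path_borel G) limit_measure)"
    and "B \<in> path_sets \<Longrightarrow>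
      emeasure (mixture N (path_borel G) limit_measure) B = (\<integral>\<^sup>+p. emeasure (limit_measure p) B \<partial>N)"
proof -
  have meas: "(\<lambda>p. emeasure (limit_measure p) B) \<in> borel_measurable N" if "B \<in> path_sets" for B
    using measurable_limit_measure[OF that] by (simp add: measurable_cong_sets[OF sets refl])
  have space: "space N = paths" using sets_eq_imp_space_eq[OF sets] by simp
  show "semi_conformal (mixture N (path_borel G) limit_measure)"
  proof (rule semi_conformal_mixture[OF semi_conformal_limit_measure meas])
    fix v assume v: "v \<in> verts G"
    obtain c where c: "c < \<infinity>" "\<And>p. p \<in> paths \<Longrightarrow> lower_limit v p \<le> c"
      using lower_limit_bound[OF v] by blast
    have "(\<integral>\<^sup>+p. emeasure (limit_measure p) (cyl v) \<partial>N) \<le> (\<integral>\<^sup>+p. c \<partial>N)"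
      by (intro nn_integral_mono) (use c(2) in \<open>auto simp: limit_measure_vertex_cyl[OF v] space split: split_indicator\<close>)
    also have "\<dots> < \<infinity>" using c(1) fin by (simp add: space ennreal_mult_less_top)
    finally show "(\<integral>\<^sup>+p. emeasure (limit_measure p) (cyl v) \<partial>N) < \<infinity>" .
  qed
  show "emeasure (mixture N (path_borel G) limit_measure) B = (\<integral>\<^sup>+p. emeasure (limit_measure p) B \<partial>N)"
    if "B \<in> path_sets"
    by (rule emeasure_mixture) (use meas that in auto)
qed

text \<open>As functions of \<open>B\<close> both sides are conformal measures, and their vertex masses
  agree by \<open>invariant_integral\<close>.\<close>

lemma disintegration:
  assumes sc: "semi_conformal m" and D: "shift_invariant D" and B: "B \<in> path_sets"
  shows "emeasure m (B \<inter> D) = (\<integral>\<^sup>+p\<in>cyl v0 \<inter> D. emeasure (limit_measure p) B \<partial>m)"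
proof -
  note sets_m = semi_conformalD(1)[OF sc]
  note [measurable_cong] = sets_m and [measurable] = shift_invariant_sets[OF D] B
  let ?E = "cyl v0 \<inter> D"
  let ?N = "density m (indicator ?E)"
  have E: "?E \<in> sets m" and Dm: "D \<in> sets m" by measurable
  have N_fin: "emeasure ?N paths < \<infinity>"
  proof -
    have "emeasure ?N paths = emeasure m (?E \<inter> paths)"
      using E sets.top[of m] by (intro emeasure_restricted) (simp_all add: semi_conformalD(2)[OF sc])
    also have "?E \<inter> paths = cyl v0 \<inter> D" by (auto simp: vertex_cyl_def)
    finally show ?thesis using emeasure_vertex_cyl_Int_finite[OF sc v0] by simp
  qed
  have sets_N: "sets ?N = path_sets" by (simp add: sets_m)
  note mix = mixture_limit_measure[OF sets_N N_fin]
  have int: "(\<integral>\<^sup>+p. f p \<partial>?N) = (\<integral>\<^sup>+p\<in>?E. f p \<partial>m)" if "f \<in> borel_measurable (path_borel G)" for f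
  proof -
    have [measurable]: "f \<in> borel_measurable m" using that by (simp add: measurable_cong_sets[OF sets_m refl])
    show ?thesis by (subst nn_integral_density) (auto simp: mult.commute)
  qed
  have "density m (indicator D) = mixture ?N (path_borel G) limit_measure"
  proof (rule semi_conformal_eqI[OF semi_conformal_restrict[OF sc D] mix(1)])
    fix v assume v: "v \<in> verts G"
    have "emeasure (mixture ?N (path_borel G) limit_measure) (cyl v) =
        (\<integral>\<^sup>+p\<in>?E. emeasure (limit_measure p) (cyl v) \<partial>m)"
      by (simp add: mix(2) int measurable_limit_measure)
    also have "\<dots> = (\<integral>\<^sup>+p\<in>?E. lower_limit v p \<partial>m)"
      by (rule nn_integral_cong_AE, use AE_harmonic[OF sc] in eventually_elim)
        (simp add: limit_measure_vertex_cyl[OF v])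
    also have "\<dots> = emeasure m (cyl v \<inter> D)" by (rule invariant_integral[OF sc v D])
    also have "\<dots> = emeasure (density m (indicator D)) (cyl v)"
      using emeasure_restricted[OF Dm, of "cyl v"] by (simp add: sets_m Int_commute)
    finally show "emeasure (density m (indicator D)) (cyl v) =
        emeasure (mixture ?N (path_borel G) limit_measure) (cyl v)" by simp
  qed
  then have "emeasure (density m (indicator D)) B = (\<integral>\<^sup>+p\<in>?E. emeasure (limit_measure p) B \<partial>m)"
    by (simp add: mix(2) int measurable_limit_measure B)
  then show ?thesis
    using emeasure_restricted[OF Dm, of B] B by (simp add: sets_m Int_commute)
qed

section \<open>Minimal limits\<close>


lemma shift_invariant_paths: "shift_invariant paths"
  using sets.top[of "path_borel G"] shift_in_paths by (auto simp: shift_invariant_def)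

text \<open>Let \<open>D'\<close> be the set of \<open>p\<close> outside \<open>D\<close> whose limit
  measure charges \<open>cyl v0 \<inter> D\<close>. Disintegrating the empty set as an
  intersection of \<open>D\<close> with \<open>D'\<close> shows that \<open>D'\<close> is null.\<close>

lemma AE_limit_measure_null_event:
  assumes sc: "semi_conformal m" and D: "shift_invariant D"
  shows "AE p in m. p \<notin> D \<longrightarrow> emeasure (limit_measure p) (cyl v0 \<inter> D) = 0"
proof -
  note [measurable_cong] = semi_conformalD(1)[OF sc] and [measurable] = shift_invariant_sets[OF D]
  let ?B = "cyl v0 \<inter> D"
  have B: "?B \<in> path_sets" by measurable
  note [measurable] = measurable_limit_measure[OF B]
  let ?D' = "{p \<in> paths. p \<notin> D \<and> emeasure (limit_measure p) ?B \<noteq> 0}"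
  have D': "shift_invariant ?D'"
    by (rule shift_invariant_Collect)
      (measurable, use D in \<open>simp add: limit_measure_shift shift_invariant_def\<close>)
  have E: "cyl v0 \<inter> ?D' \<in> sets m"
    using shift_invariant_sets[OF D'] by (simp only: semi_conformalD(1)[OF sc] sets.Int sets_vertex_cyl)
  have "(\<integral>\<^sup>+p\<in>cyl v0 \<inter> ?D'. emeasure (limit_measure p) ?B \<partial>m) = emeasure m (?B \<inter> ?D')"
    by (rule disintegration[OF sc D' B, symmetric])
  also have "?B \<inter> ?D' = {}" by auto
  finally have "(\<integral>\<^sup>+p. emeasure (limit_measure p) ?B * indicator (cyl v0 \<inter> ?D') p \<partial>m) = 0" by simp
  moreover have "(\<lambda>p. emeasure (limit_measure p) ?B * indicator (cyl v0 \<inter> ?D') p) \<in> borel_measurable m"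
    using E measurable_limit_measure[OF B] measurable_cong_sets[OF semi_conformalD(1)[OF sc] refl]
    by (intro borel_measurable_times_ennreal borel_measurable_indicator) auto
  ultimately have "AE p in m. emeasure (limit_measure p) ?B * indicator (cyl v0 \<inter> ?D') p = 0"
    by (simp only: nn_integral_0_iff_AE)
  then have "AE p in m. p \<notin> cyl v0 \<inter> ?D'"
    by eventually_elim (auto split: split_indicator_asm)
  then have "emeasure m (cyl v0 \<inter> ?D') = 0"
    using E AE_iff_null_sets[OF E] by auto
  from AE_not_in_invariant[OF sc D' this] AE_space show ?thesis
    by eventually_elim (auto simp: semi_conformalD(2)[OF sc])
qed

definition same_limit :: "(nat \<Rightarrow> 'b) \<Rightarrow> (nat \<Rightarrow> 'b) \<Rightarrow> bool" where
  "same_limit p q \<longleftrightarrow> (\<forall>v\<in>verts G. lower_limit v q = lower_limit v p)"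

lemma shift_invariant_less: "shift_invariant {q \<in> paths. lower_limit v q < r}"
  by (rule shift_invariant_Collect) (measurable, simp add: lower_limit_shift)

lemma shift_invariant_greater: "shift_invariant {q \<in> paths. r < lower_limit v q}"
  by (rule shift_invariant_Collect) (measurable, simp add: lower_limit_shift)

text \<open>Apply \<open>AE_limit_measure_null_event\<close> to the events that \<open>lower_limit v\<close>
  is less than \<open>r\<close>, or greater than \<open>r\<close>, with \<open>r\<close> from a
  countable order-dense set.\<close>

lemma AE_limit_measure_same_limit:
  assumes sc: "semi_conformal m"
  shows "AE p in m. AE q in limit_measure p. same_limit p q"
proof -
  obtain B :: "ennreal set" where B: "countable B" "\<And>x y. x < y \<Longrightarrow> \<exists>b\<in>B. x < b \<and> b < y"
    using countable_separating_set_dense_linorder by metis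
  let ?L = "\<lambda>v r. {q \<in> paths. lower_limit v q < r}"
  let ?U = "\<lambda>v r. {q \<in> paths. r < lower_limit v q}"
  have "AE p in m. \<forall>v\<in>verts G. \<forall>r\<in>B.
      (p \<notin> ?L v r \<longrightarrow> emeasure (limit_measure p) (cyl v0 \<inter> ?L v r) = 0) \<and>
      (p \<notin> ?U v r \<longrightarrow> emeasure (limit_measure p) (cyl v0 \<inter> ?U v r) = 0)"
    using AE_limit_measure_null_event[OF sc shift_invariant_less]
      AE_limit_measure_null_event[OF sc shift_invariant_greater]
    by (intro AE_ball_countable[OF countable_verts, THEN iffD2] AE_ball_countable[OF B(1), THEN iffD2] ballI AE_conjI)
  then show ?thesis
  proof eventually_elim
    case (elim p)
    note sp = semi_conformal_limit_measure[of p]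
    have "AE q in limit_measure p. (r < lower_limit v p \<longrightarrow> q \<notin> ?L v r) \<and> (lower_limit v p < r \<longrightarrow> q \<notin> ?U v r)"
      if v: "v \<in> verts G" and r: "r \<in> B" for v r
      using elim[rule_format, OF v r] AE_not_in_invariant[OF sp shift_invariant_less, of v r]
        AE_not_in_invariant[OF sp shift_invariant_greater, of r v]
      by (cases "lower_limit v p" r rule: linorder_cases) auto
    then have "AE q in limit_measure p. \<forall>v\<in>verts G. \<forall>r\<in>B.
        (r < lower_limit v p \<longrightarrow> q \<notin> ?L v r) \<and> (lower_limit v p < r \<longrightarrow> q \<notin> ?U v r)"
      by (intro AE_ball_countable[OF countable_verts, THEN iffD2] AE_ball_countable[OF B(1), THEN iffD2] ballI)
    then show ?case
      using AE_space
    proof eventually_elim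
      case (elim q)
      then have q: "q \<in> paths" by (simp add: semi_conformalD(2)[OF sp])
      show ?case
        unfolding same_limit_def
      proof
        fix v assume v: "v \<in> verts G"
        have "\<not> lower_limit v q < lower_limit v p" using B(2) elim(1) v q by blast
        moreover have "\<not> lower_limit v p < lower_limit v q" using B(2) elim(1) v q by blast
        ultimately show "lower_limit v q = lower_limit v p" by simp
      qed
    qed
  qed
qed

lemma invariant_vec_diff:
  assumes \<phi>: "invariant_vec \<phi>" and h: "invariant_vec h" and le: "\<And>v. v \<in> verts G \<Longrightarrow> h v \<le> \<phi> v"
  shows "invariant_vec (\<lambda>v. \<phi> v - h v)"
  unfolding invariant_vec_def
proof (intro conjI ballI)
  fix v assume v: "v \<in> verts G"
  have fin: "h w \<noteq> \<top>" if "w \<in> verts G" for w using h that by (auto simp: invariant_vec_def)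
  show "\<phi> v - h v < \<infinity>" using \<phi> v by (auto simp: invariant_vec_def intro: le_less_trans[OF diff_le_self_ennreal])
  have "(\<integral>\<^sup>+w. transition v w * (\<phi> w - h w) \<partial>count_space (verts G)) +
      (\<integral>\<^sup>+w. transition v w * h w \<partial>count_space (verts G)) =
      (\<integral>\<^sup>+w. transition v w * \<phi> w \<partial>count_space (verts G))"
    by (subst nn_integral_add[symmetric])
      (use le in \<open>auto intro!: nn_integral_cong simp: diff_add_cancel_ennreal simp flip: distrib_left\<close>)
  then have "(\<integral>\<^sup>+w. transition v w * (\<phi> w - h w) \<partial>count_space (verts G)) + h v = \<phi> v"
    using \<phi> h v by (simp add: invariant_vec_def)
  then show "(\<integral>\<^sup>+w. transition v w * (\<phi> w - h w) \<partial>count_space (verts G)) = \<phi> v - h v"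
    using fin[OF v] by (metis ennreal_add_diff_cancel_right)
qed

text \<open>The difference of the vertex masses is an invariant vector; its conformal measure, added to
  \<open>m\<close>, gives \<open>m'\<close> by uniqueness.\<close>

lemma semi_conformal_dominated:
  assumes m: "semi_conformal m" and m': "semi_conformal m'"
    and le: "\<And>v. v \<in> verts G \<Longrightarrow> emeasure m (cyl v) \<le> emeasure m' (cyl v)"
    and B: "B \<in> path_sets"
  shows "emeasure m B \<le> emeasure m' B"
proof -
  obtain d where d: "semi_conformal d"
    "\<And>v. v \<in> verts G \<Longrightarrow> emeasure d (cyl v) = emeasure m' (cyl v) - emeasure m (cyl v)"
    using conformal_measure_exists[OF invariant_vec_diff[OF semi_conformal_invariant_vec[OF m'] semi_conformal_invariant_vec[OF m] le]]
    by auto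
  define s where "s = mixture (count_space UNIV) (path_borel G) (\<lambda>b. if b then m else d)"
  have s: "emeasure s C = emeasure m C + emeasure d C" if "C \<in> path_sets" for C
    unfolding s_def
    by (subst emeasure_mixture)
      (use that m d in \<open>auto simp: semi_conformalD(1) nn_integral_count_space_finite UNIV_bool add.commute\<close>)
  have "s = m'"
  proof (rule semi_conformal_eqI[OF _ m'])
    show "semi_conformal s"
      unfolding s_def
      by (rule semi_conformal_mixture)
        (use m d(1) semi_conformalD(3) in \<open>auto simp: nn_integral_count_space_finite UNIV_bool\<close>)
    show "emeasure s (cyl v) = emeasure m' (cyl v)" if "v \<in> verts G" for v
      using d(2)[OF that] le[OF that] by (simp add: s add.commute diff_add_cancel_ennreal)
  qed
  then show ?thesis using s[OF B] by simp
qed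

lemma invariant_vec_cong:
  assumes "\<And>v. v \<in> verts G \<Longrightarrow> \<phi> v = \<psi> v"
  shows "invariant_vec \<phi> \<longleftrightarrow> invariant_vec \<psi>"
proof -
  have "(\<integral>\<^sup>+w. transition v w * \<phi> w \<partial>count_space (verts G)) =
      (\<integral>\<^sup>+w. transition v w * \<psi> w \<partial>count_space (verts G))" for v
    by (rule nn_integral_cong) (simp add: assms)
  then show ?thesis using assms by (simp add: invariant_vec_def)
qed

text \<open>A harmonic \<open>h\<close> below \<open>\<phi>\<close> has a conformal measure dominated by
  that of \<open>\<phi>\<close>, so almost all of its paths have the limit \<open>\<phi>\<close>
  too, and the integral formula reads $h_v = \phi_v h_{v_0}$.\<close>

lemma minimal_harmonic_if_concentrated:
  assumes p: "p \<in> harmonic_paths" and conc: "AE q in limit_measure p. same_limit p q"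
    and \<phi>: "\<And>v. v \<in> verts G \<Longrightarrow> \<phi> v = lower_limit v p"
  shows "minimal_harmonic G F \<beta> \<phi>"
proof -
  have pP: "p \<in> paths" using p by (simp add: harmonic_paths_def)
  have inv: "invariant_vec \<phi>"
    using p invariant_vec_cong[of \<phi> "\<lambda>v. lower_limit v p"] \<phi> by (simp add: harmonic_paths_def)
  show ?thesis
    unfolding minimal_harmonic_def
  proof (intro conjI allI impI)
    show "harmonic G F \<beta> \<phi>"
      using inv v0 lower_limit_v0[OF pP] \<phi>[OF v0] by (auto simp: harmonic_iff intro!: bexI[of _ v0])
    fix h assume h: "harmonic G F \<beta> h \<and> (\<forall>v\<in>verts G. h v \<le> \<phi> v)"
    then obtain m where m: "semi_conformal m" "\<And>v. v \<in> verts G \<Longrightarrow> emeasure m (cyl v) = h v"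
      using conformal_measure_exists[of h] by (auto simp: harmonic_iff)
    note sp = semi_conformal_limit_measure[of p]
    have le: "emeasure m B \<le> emeasure (limit_measure p) B" if "B \<in> path_sets" for B
      by (rule semi_conformal_dominated[OF m(1) sp _ that])
        (use h m(2) \<phi> limit_measure_vertex_cyl[of _ p] p in auto)
    have "absolutely_continuous (limit_measure p) m"
    proof -
      have "emeasure m B = 0" if "B \<in> path_sets" "emeasure (limit_measure p) B = 0" for B
        using le[OF that(1)] that(2) by simp
      then show ?thesis
        by (auto simp: absolutely_continuous_def null_sets_def semi_conformalD(1)[OF m(1)])
    qed
    then have "AE q in m. same_limit p q"
      by (rule absolutely_continuous_AE[rotated, OF _ conc]) (simp add: semi_conformalD(1)[OF m(1)])
    note AE = this
    have "h v = h v0 * \<phi> v" if v: "v \<in> verts G" for v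
    proof -
      note [measurable_cong] = semi_conformalD(1)[OF m(1)]
      have Z: "cyl u \<inter> paths = cyl u" for u by (auto simp: vertex_cyl_def)
      have "h v = (\<integral>\<^sup>+q\<in>cyl v0. lower_limit v q \<partial>m)"
        using invariant_integral[OF m(1) v shift_invariant_paths] m(2)[OF v] by (simp add: Z)
      also have "\<dots> = (\<integral>\<^sup>+q. \<phi> v * indicator (cyl v0) q \<partial>m)"
        by (rule nn_integral_cong_AE, use AE in eventually_elim) (simp add: same_limit_def v \<phi>)
      also have "\<dots> = \<phi> v * emeasure m (cyl v0)"
        by (rule nn_integral_cmult_indicator) measurable
      finally show ?thesis by (simp add: m(2)[OF v0] mult.commute)
    qed
    moreover have "h v0 = ennreal (enn2real (h v0))"
      using h v0 by (auto simp: harmonic_def)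
    ultimately show "\<exists>c::real. c \<ge> 0 \<and> (\<forall>v\<in>verts G. h v = ennreal c * \<phi> v)"
      by (intro exI[of _ "enn2real (h v0)"]) auto
  qed
qed

text \<open>For an invariant set \<open>D\<close> the masses of \<open>cyl u \<inter> D\<close> form a
  vector below \<open>\<phi>\<close>, hence a multiple of \<open>\<phi>\<close> by minimality. By
  the integral formula the average of \<open>lower_limit v\<close> over \<open>cyl v0 \<inter>
  D\<close> is then $\phi_v$, which is impossible if the lower limit is less than $\phi_v$
  throughout \<open>D\<close>, or greater throughout \<open>D\<close>, unless \<open>D\<close> is
  null.\<close>

lemma concentrated_if_minimal_harmonic:
  assumes p: "p \<in> harmonic_paths" and min: "minimal_harmonic G F \<beta> \<phi>"
    and \<phi>: "\<And>v. v \<in> verts G \<Longrightarrow> \<phi> v = lower_limit v p"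
  shows "AE q in limit_measure p. same_limit p q"
proof -
  let ?m = "limit_measure p"
  note sc = semi_conformal_limit_measure[of p]
  note [measurable_cong] = sets_limit_measure[of p]
  have pP: "p \<in> paths" using p by (simp add: harmonic_paths_def)
  have mZ: "emeasure ?m (cyl v) = \<phi> v" if "v \<in> verts G" for v
    using that p by (simp add: limit_measure_vertex_cyl \<phi>)
  have eq: "(\<integral>\<^sup>+q\<in>cyl v0 \<inter> D. lower_limit v q \<partial>?m) = (\<integral>\<^sup>+q\<in>cyl v0 \<inter> D. \<phi> v \<partial>?m)"
    if v: "v \<in> verts G" and D: "shift_invariant D" and nz: "emeasure ?m (cyl v0 \<inter> D) \<noteq> 0" for v D
  proof -
    note [measurable] = shift_invariant_sets[OF D]
    have D_sets: "D \<in> sets ?m" by measurable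
    let ?\<psi> = "\<lambda>u. emeasure ?m (cyl u \<inter> D)"
    have "emeasure (density ?m (indicator D)) (cyl u) = ?\<psi> u" for u
      using emeasure_restricted[OF D_sets, of "cyl u"] by (simp add: Int_commute)
    then have "invariant_vec ?\<psi>"
      using semi_conformal_invariant_vec[OF semi_conformal_restrict[OF sc D]] by simp
    then have "harmonic G F \<beta> ?\<psi>" using nz v0 by (auto simp: harmonic_iff)
    moreover have "?\<psi> u \<le> \<phi> u" if "u \<in> verts G" for u
      unfolding mZ[OF that, symmetric] by (rule emeasure_mono) auto
    ultimately obtain c :: real where c: "\<And>u. u \<in> verts G \<Longrightarrow> ?\<psi> u = ennreal c * \<phi> u"
      using min unfolding minimal_harmonic_def by blast
    have "\<phi> v0 = 1" using \<phi>[OF v0] lower_limit_v0[OF pP] by simp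
    then have "?\<psi> v = ?\<psi> v0 * \<phi> v" using c[OF v] c[OF v0] by simp
    moreover have "(\<integral>\<^sup>+q\<in>cyl v0 \<inter> D. \<phi> v \<partial>?m) = \<phi> v * ?\<psi> v0"
      by (rule nn_integral_cmult_indicator) measurable
    ultimately show ?thesis
      unfolding invariant_integral[OF sc v D] by (simp add: mult.commute)
  qed
  have "AE q in ?m. lower_limit v q = lower_limit v p" if v: "v \<in> verts G" for v
  proof -
    let ?L = "{q \<in> paths. lower_limit v q < \<phi> v}" and ?U = "{q \<in> paths. \<phi> v < lower_limit v q}"
    have lm: "lower_limit v \<in> borel_measurable ?m" by measurable
    have sets: "cyl v0 \<inter> ?L \<in> sets ?m" "cyl v0 \<inter> ?U \<in> sets ?m"
      using shift_invariant_sets[OF shift_invariant_less] shift_invariant_sets[OF shift_invariant_greater]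
      by (simp_all only: sets_limit_measure sets.Int sets_vertex_cyl)
    have fin: "(\<integral>\<^sup>+q\<in>cyl v0 \<inter> D. lower_limit v q \<partial>?m) \<noteq> \<infinity>" if "shift_invariant D" for D
      using emeasure_vertex_cyl_Int_finite[OF sc v, of D] by (simp add: invariant_integral[OF sc v that] less_top)
    have "emeasure ?m (cyl v0 \<inter> ?L) = 0"
    proof (rule ccontr)
      assume nz: "emeasure ?m (cyl v0 \<inter> ?L) \<noteq> 0"
      have "emeasure ?m (cyl v0 \<inter> ?L) = 0"
        by (rule null_set_of_equal_integrals[OF lm _ sets(1), where g = "\<lambda>_. \<phi> v"])
          (use eq[OF v shift_invariant_less nz] fin[OF shift_invariant_less] in auto)
      then show False using nz by simp
    qed
    moreover have "emeasure ?m (cyl v0 \<inter> ?U) = 0"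
    proof (rule ccontr)
      assume nz: "emeasure ?m (cyl v0 \<inter> ?U) \<noteq> 0"
      have "emeasure ?m (cyl v0 \<inter> ?U) = 0"
        by (rule null_set_of_equal_integrals[OF _ lm sets(2), where f = "\<lambda>_. \<phi> v"])
          (use eq[OF v shift_invariant_greater nz] fin[OF shift_invariant_greater] in auto)
      then show False using nz by simp
    qed
    ultimately have "AE q in ?m. q \<notin> ?L" "AE q in ?m. q \<notin> ?U"
      using AE_not_in_invariant[OF sc shift_invariant_less] AE_not_in_invariant[OF sc shift_invariant_greater]
      by blast+
    then show ?thesis
      using AE_space
    proof eventually_elim
      case (elim q)
      then show ?case
        using \<phi>[OF v] by (auto simp: semi_conformalD(2)[OF sc] intro: linorder_cases)
    qed
  qed
  then show ?thesis
    unfolding same_limit_def by (intro AE_ball_countable[OF countable_verts, THEN iffD2] ballI)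
qed

lemma X_set_converges:
  assumes "p \<in> minimal_paths" "v \<in> verts G"
  shows "(\<lambda>k. kernel v (tail G (p k))) \<longlonglongrightarrow> lower_limit v p"
proof -
  have "convergent (\<lambda>k. kernel v (tail G (p k)))"
    using assms by (auto simp: X_set_def)
  then obtain l where l: "(\<lambda>k. kernel v (tail G (p k))) \<longlonglongrightarrow> l"
    by (auto simp: convergent_def)
  then have "lower_limit v p = l"
    unfolding lower_limit_def by (intro lim_imp_Liminf) simp_all
  then show ?thesis using l by simp
qed

lemma martin_limit_eq_lower_limit:
  assumes "(\<lambda>k. kernel v (tail G (p k))) \<longlonglongrightarrow> lower_limit v p" "v \<in> verts G"
  shows "limit_vec p v = lower_limit v p"
  using limI[OF assms(1)] assms(2) by (simp add: martin_limit_def)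

lemma X_set_iff:
  "p \<in> minimal_paths \<longleftrightarrow> p \<in> harmonic_paths \<and>
     (\<forall>v\<in>verts G. (\<lambda>k. kernel v (tail G (p k))) \<longlonglongrightarrow> lower_limit v p) \<and>
     (AE q in limit_measure p. same_limit p q)"
proof (intro iffI conjI ballI)
  assume X: "p \<in> minimal_paths"
  note conv = X_set_converges[OF X]
  then show "(\<lambda>k. kernel v (tail G (p k))) \<longlonglongrightarrow> lower_limit v p" if "v \<in> verts G" for v
    using that by blast
  note ml = martin_limit_eq_lower_limit[OF conv]
  have min: "minimal_harmonic G F \<beta> (limit_vec p)" and p: "p \<in> paths"
    using X by (auto simp: X_set_def)
  then have "invariant_vec (limit_vec p)"
    by (simp add: minimal_harmonic_def harmonic_iff)
  then have "invariant_vec (\<lambda>v. lower_limit v p)"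
    using invariant_vec_cong[of "limit_vec p" "\<lambda>v. lower_limit v p"] ml by blast
  then show h: "p \<in> harmonic_paths" using p by (simp add: harmonic_paths_def)
  show "AE q in limit_measure p. same_limit p q"
    by (rule concentrated_if_minimal_harmonic[OF h min ml])
next
  assume a: "p \<in> harmonic_paths \<and>
     (\<forall>v\<in>verts G. (\<lambda>k. kernel v (tail G (p k))) \<longlonglongrightarrow> lower_limit v p) \<and>
     (AE q in limit_measure p. same_limit p q)"
  then have "minimal_harmonic G F \<beta> (limit_vec p)"
    by (intro minimal_harmonic_if_concentrated[of p]) (auto intro: martin_limit_eq_lower_limit)
  then show "p \<in> minimal_paths"
    using a by (auto simp: X_set_def convergent_def harmonic_paths_def)
qed

lemma AE_X_set: "semi_conformal m \<Longrightarrow> AE p in m. p \<in> minimal_paths"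
  unfolding X_set_iff
  using AE_harmonic[of m] AE_kernel_converges[of m] AE_limit_measure_same_limit[of m]
  by (intro AE_conjI)

lemma X_set_martin_limit: "p \<in> minimal_paths \<Longrightarrow> v \<in> verts G \<Longrightarrow> limit_vec p v = lower_limit v p"
  by (intro martin_limit_eq_lower_limit X_set_converges)

lemma martin_limit_eq_iff:
  assumes "p \<in> minimal_paths" "q \<in> minimal_paths"
  shows "limit_vec p = limit_vec q \<longleftrightarrow> same_limit q p"
proof -
  have "limit_vec r v = undefined" if "v \<notin> verts G" for r v
    using that by (simp add: martin_limit_def)
  then show ?thesis
    using X_set_martin_limit[OF assms(1)] X_set_martin_limit[OF assms(2)]
    unfolding same_limit_def fun_eq_iff by metis
qed

lemma ray_measure_eq:
  assumes "y \<in> minimal_paths"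
  shows "ray_measure G F \<beta> v0 y = limit_measure y"
  unfolding ray_measure_def
proof (rule the_equality)
  have h: "y \<in> harmonic_paths" using assms by (simp add: X_set_iff)
  then have y: "y \<in> paths" by (simp add: harmonic_paths_def)
  have Z: "emeasure (limit_measure y) (cyl v) = lower_limit v y" if "v \<in> verts G" for v
    using h that by (simp add: limit_measure_vertex_cyl)
  have 1: "emeasure (limit_measure y) (cyl v0) = 1"
    using Z[OF v0] lower_limit_v0[OF y] by simp
  have "emeasure (limit_measure y) (cyl v0) \<le> emeasure (limit_measure y) paths"
    using sets.top[of "path_borel G"] by (intro emeasure_mono) (auto simp: vertex_cyl_def)
  then have "emeasure (limit_measure y) paths \<noteq> 0" using 1 by auto
  then show "limit_measure y \<in> normalized_conformal G F \<beta> v0 \<and>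
      (\<forall>v\<in>verts G. emeasure (limit_measure y) (cyl v) = limit_vec y v)"
    using 1 Z X_set_martin_limit[OF assms] semi_conformal_limit_measure
    by (simp add: normalized_conformal_def conformal_iff)
  show "m = limit_measure y" if "m \<in> normalized_conformal G F \<beta> v0 \<and>
      (\<forall>v\<in>verts G. emeasure m (cyl v) = limit_vec y v)" for m
    using that h X_set_martin_limit[OF assms]
    by (intro limit_measure_unique) (auto simp: normalized_conformal_def conformal_iff)
qed

section \<open>Loop erasure\<close>


text \<open>On a transient path, the least time after which the vertex at time \<open>k\<close> does not
  recur is the time of the last visit to it. Following the path from one last exit to the next
  erases its loops.\<close>

definition last_visit :: "(nat \<Rightarrow> 'b) \<Rightarrow> nat \<Rightarrow> nat" where
  "last_visit p k = (LEAST n. \<forall>j>n. tail G (p j) \<noteq> tail G (p k))"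

primrec exit_time :: "(nat \<Rightarrow> 'b) \<Rightarrow> nat \<Rightarrow> nat" where
  "exit_time p 0 = last_visit p 0"
| "exit_time p (Suc i) = last_visit p (Suc (exit_time p i))"

definition loop_erasure :: "(nat \<Rightarrow> 'b) \<Rightarrow> nat \<Rightarrow> 'b" where
  "loop_erasure p = (if p \<in> transient_paths then (\<lambda>i. p (exit_time p i)) else p)"

lemma last_visit:
  assumes p: "p \<in> transient_paths"
  shows "k \<le> last_visit p k" "tail G (p (last_visit p k)) = tail G (p k)"
    and "last_visit p k < j \<Longrightarrow> tail G (p j) \<noteq> tail G (p k)"
proof -
  let ?Q = "\<lambda>n. \<forall>j>n. tail G (p j) \<noteq> tail G (p k)"
  have "tail G (p k) \<in> verts G" using p by (auto simp: transient_paths_def inf_paths_tail)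
  then obtain n where "\<forall>j\<ge>n. tail G (p j) \<noteq> tail G (p k)"
    using p unfolding transient_paths_def by blast
  then have "?Q n" by auto
  then have Q: "?Q (last_visit p k)" unfolding last_visit_def by (rule LeastI)
  then show "last_visit p k < j \<Longrightarrow> tail G (p j) \<noteq> tail G (p k)" by blast
  show le: "k \<le> last_visit p k" using Q by (metis not_le)
  show "tail G (p (last_visit p k)) = tail G (p k)"
  proof (cases "last_visit p k = k")
    case False
    then obtain l where l: "last_visit p k = Suc l" using le by (cases "last_visit p k") auto
    then have "\<not> ?Q l" using not_less_Least[of l ?Q] by (simp add: last_visit_def)
    then obtain j where "j > l" "tail G (p j) = tail G (p k)" by blast
    then show ?thesis using Q l by (metis Suc_lessI)
  qed simp
qed

lemma exit_time_tail:
  assumes "p \<in> transient_paths"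
  shows "tail G (p (exit_time p 0)) = tail G (p 0)"
    and "tail G (p (exit_time p (Suc i))) = tail G (p (Suc (exit_time p i)))"
  using last_visit(2)[OF assms] by simp_all

lemma strict_mono_exit_time: "p \<in> transient_paths \<Longrightarrow> strict_mono (exit_time p)"
  using last_visit(1) by (simp add: strict_mono_Suc_iff Suc_le_lessD)

lemma exit_time_last:
  assumes "p \<in> transient_paths" "exit_time p i < j"
  shows "tail G (p j) \<noteq> tail G (p (exit_time p i))"
  using last_visit[OF assms(1)] assms(2) by (cases i) simp_all

lemma loop_erasure_in_rays:
  assumes p: "p \<in> transient_paths"
  shows "loop_erasure p \<in> rays G" "tail G (loop_erasure p 0) = tail G (p 0)"
proof -
  have pP: "p \<in> paths" using p by (simp add: transient_paths_def)
  have l: "loop_erasure p i = p (exit_time p i)" for i using p by (simp add: loop_erasure_def)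
  have "loop_erasure p \<in> paths"
    using exit_time_tail(2)[OF p] inf_paths_arcs[OF pP] inf_paths_step[OF pP]
    unfolding inf_paths_def l by simp
  moreover have "inj (\<lambda>i. tail G (loop_erasure p i))"
  proof (rule injI)
    fix i j assume eq: "tail G (loop_erasure p i) = tail G (loop_erasure p j)"
    show "i = j"
    proof (rule ccontr)
      assume "i \<noteq> j"
      then have "exit_time p i < exit_time p j \<or> exit_time p j < exit_time p i"
        using strict_monoD[OF strict_mono_exit_time[OF p]] by (metis linorder_neqE_nat)
      then show False using exit_time_last[OF p] eq unfolding l by metis
    qed
  qed
  ultimately show "loop_erasure p \<in> rays G" by (simp add: rays_def)
  show "tail G (loop_erasure p 0) = tail G (p 0)" unfolding l by (rule exit_time_tail(1)[OF p])
qed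

lemma loop_erasure_in_paths: "p \<in> paths \<Longrightarrow> loop_erasure p \<in> paths"
  using loop_erasure_in_rays[of p] by (cases "p \<in> transient_paths") (auto simp: rays_def loop_erasure_def)

text \<open>The vertices of the loop erasure form a subsequence of those of the path, so kernel limits are
  inherited.\<close>

lemma loop_erasure_in_C:
  assumes p: "p \<in> transient_paths" "p \<in> minimal_paths" "p \<in> cyl v0"
  shows "loop_erasure p \<in> minimal_rays" "same_limit p (loop_erasure p)"
proof -
  let ?q = "loop_erasure p"
  have conv: "(\<lambda>k. kernel v (tail G (?q k))) \<longlonglongrightarrow> lower_limit v p" if "v \<in> verts G" for v
  proof -
    have "(\<lambda>k. kernel v (tail G (?q k))) =
        (\<lambda>k. kernel v (tail G (p k))) \<circ> exit_time p"
      using p(1) by (auto simp: loop_erasure_def)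
    then show ?thesis
      using LIMSEQ_subseq_LIMSEQ[OF X_set_converges[OF p(2) that] strict_mono_exit_time[OF p(1)]] by simp
  qed
  then have "limit_vec ?q = limit_vec p"
    unfolding martin_limit_def
    by (intro restrict_ext) (simp add: limI[OF conv] limI[OF X_set_converges[OF p(2)]])
  then have "?q \<in> minimal_paths"
    using p(2) conv loop_erasure_in_rays(1)[OF p(1)] by (auto simp: X_set_def convergent_def rays_def)
  then show "?q \<in> minimal_rays"
    using loop_erasure_in_rays[OF p(1)] p(3) by (auto simp: C_set_def vertex_cyl_def rays_def)
  show "same_limit p ?q"
    unfolding same_limit_def
  proof
    fix v assume v: "v \<in> verts G"
    show "lower_limit v ?q = lower_limit v p"
      unfolding lower_limit_def[of v ?q] by (rule lim_imp_Liminf[OF _ conv[OF v]]) simp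
  qed
qed

lemma pred_tail_eq [measurable]: "Measurable.pred (path_borel G) (\<lambda>p. tail G (p j) = tail G (p k))"
  by (rule measurable_compose_countable'[OF _ measurable_coord countable_arcs]) measurable

lemma measurable_last_visit [measurable]:
  "(\<lambda>p. last_visit p k) \<in> measurable (path_borel G) (count_space UNIV)"
  unfolding last_visit_def by measurable

lemma measurable_exit_time [measurable]:
  "(\<lambda>p. exit_time p i) \<in> measurable (path_borel G) (count_space UNIV)"
proof (induction i)
  case (Suc i)
  then show ?case
    using measurable_compose_countable[OF measurable_last_visit, of "\<lambda>p. Suc (exit_time p i)"]
    by simp
qed simp

lemma measurable_exit_arrow [measurable]:
  "(\<lambda>p. p (exit_time p i)) \<in> measurable (path_borel G) (count_space UNIV)"
  by (rule measurable_compose_countable[OF measurable_coord_UNIV measurable_exit_time])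

lemma measurable_loop_erasure [measurable]: "loop_erasure \<in> measurable (path_borel G) (path_borel G)"
proof (rule measurable_into_path_borel)
  fix n and x :: "nat \<Rightarrow> 'b"
  note trans = shift_invariant_sets[OF shift_invariant_transient]
  have start: "Measurable.pred (path_borel G) (\<lambda>p. tail G (p (exit_time p 0)) = tail G (x 0))"
    by (rule measurable_compose[OF measurable_exit_arrow]) simp
  have arrow: "Measurable.pred (path_borel G) (\<lambda>p. p (exit_time p i) = x i)" for i
    by (rule measurable_compose[OF measurable_exit_arrow]) simp
  have iff: "loop_erasure p \<in> zcyl n x \<longleftrightarrow>
      p \<in> transient_paths \<and> tail G (p (exit_time p 0)) = tail G (x 0) \<and> (\<forall>i<n. p (exit_time p i) = x i) \<or>
      p \<notin> transient_paths \<and> p \<in> zcyl n x" if "p \<in> paths" for p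
    using loop_erasure_in_paths[OF that]
    by (cases "p \<in> transient_paths") (auto simp: zcyl_def loop_erasure_def simp del: exit_time.simps)
  have "{p \<in> space (path_borel G). loop_erasure p \<in> zcyl n x} =
      {p \<in> space (path_borel G). p \<in> transient_paths \<and> tail G (p (exit_time p 0)) = tail G (x 0) \<and>
         (\<forall>i<n. p (exit_time p i) = x i)} \<union>
      {p \<in> space (path_borel G). p \<notin> transient_paths \<and> p \<in> zcyl n x}"
    using iff by auto
  also have "\<dots> = (transient_paths \<inter> {p \<in> space (path_borel G). tail G (p (exit_time p 0)) = tail G (x 0)} \<inter>
        {p \<in> space (path_borel G). \<forall>i\<in>{..<n}. p (exit_time p i) = x i}) \<union> (zcyl n x - transient_paths)"
    using zcyl_subset[of n x] by auto
  also have "\<dots> \<in> path_sets"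
    by (intro sets.Un sets.Diff sets.Int trans sets_zcyl sets.sets_Collect_finite_All predE start arrow) simp
  finally show "{p \<in> space (path_borel G). loop_erasure p \<in> zcyl n x} \<in> path_sets" .
qed (simp add: loop_erasure_in_paths)

end

section \<open>The representation theorem\<close>

lemma emeasure_convex_comb:
  assumes sets: "sets \<nu> = sets \<mu>" and t: "0 \<le> t" "t \<le> 1"
  shows "sets (convex_comb t \<mu> \<nu>) = sets \<mu>"
    and "B \<in> sets \<mu> \<Longrightarrow>
      emeasure (convex_comb t \<mu> \<nu>) B = ennreal t * emeasure \<mu> B + ennreal (1 - t) * emeasure \<nu> B"
proof -
  show "sets (convex_comb t \<mu> \<nu>) = sets \<mu>" by (simp add: convex_comb_def)
  let ?N = "point_measure (UNIV :: bool set) (\<lambda>b. ennreal (if b then t else 1 - t))"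
  have int: "(\<integral>\<^sup>+b. f b \<partial>?N) = ennreal t * f True + ennreal (1 - t) * f False" for f :: "bool \<Rightarrow> ennreal"
    by (subst nn_integral_point_measure_finite) (auto simp: UNIV_bool add.commute mult.commute)
  have "convex_comb t \<mu> \<nu> = mixture ?N \<mu> (\<lambda>b. if b then \<mu> else \<nu>)"
    unfolding convex_comb_def mixture_def int by simp
  moreover have "emeasure (mixture ?N \<mu> (\<lambda>b. if b then \<mu> else \<nu>)) B =
      (\<integral>\<^sup>+b. emeasure (if b then \<mu> else \<nu>) B \<partial>?N)" if "B \<in> sets \<mu>"
    by (rule emeasure_mixture) (use that sets in \<open>auto simp: measurable_point_measure_eq1\<close>)
  ultimately show "emeasure (convex_comb t \<mu> \<nu>) B = ennreal t * emeasure \<mu> B + ennreal (1 - t) * emeasure \<nu> B"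
    if "B \<in> sets \<mu>"
    using that by (simp only: int) simp
qed

lemma nn_integral_convex_comb:
  assumes sets: "sets \<nu> = sets \<mu>" and t: "0 \<le> t" "t \<le> 1" and f: "f \<in> borel_measurable \<mu>"
  shows "(\<integral>\<^sup>+x. f x \<partial>convex_comb t \<mu> \<nu>) =
    ennreal t * (\<integral>\<^sup>+x. f x \<partial>\<mu>) + ennreal (1 - t) * (\<integral>\<^sup>+x. f x \<partial>\<nu>)"
proof -
  let ?c = "convex_comb t \<mu> \<nu>"
  have sets_c: "sets ?c = sets \<mu>" by (rule emeasure_convex_comb(1)[OF sets t])
  have space: "space ?c = space \<mu>" "space \<nu> = space \<mu>"
    using sets_eq_imp_space_eq[OF sets_c] sets_eq_imp_space_eq[OF sets] .
  have meas: "g \<in> borel_measurable \<nu>" "g \<in> borel_measurable ?c" if "g \<in> borel_measurable \<mu>" for g :: "_ \<Rightarrow> ennreal"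
    using that by (simp_all add: measurable_cong_sets[OF sets refl] measurable_cong_sets[OF sets_c refl])
  show ?thesis
    using f
  proof (induction rule: borel_measurable_induct)
    case (cong f g)
    then have "(\<integral>\<^sup>+x. f x \<partial>M) = (\<integral>\<^sup>+x. g x \<partial>M)" if "space M = space \<mu>" for M
      using that by (intro nn_integral_cong) auto
    then show ?case using cong space by simp
  next
    case (set A)
    then show ?case using emeasure_convex_comb(2)[OF sets t] by (simp add: sets sets_c)
  next
    case (mult u c)
    then show ?case by (simp add: nn_integral_cmult meas distrib_left mult_ac)
  next
    case (add u v)
    then show ?case by (simp add: nn_integral_add meas distrib_left add_ac)
  next
    case (seq U)
    have inc: "incseq (\<lambda>i. \<integral>\<^sup>+x. U i x \<partial>M)" for M
      using seq(3) by (auto simp: incseq_def le_fun_def intro!: nn_integral_mono)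
    have sup: "(\<integral>\<^sup>+x. (SUP i. U i) x \<partial>M) = (SUP i. \<integral>\<^sup>+x. U i x \<partial>M)"
      if "\<And>i. U i \<in> borel_measurable M" for M
      using nn_integral_monotone_convergence_SUP[OF seq(3) that] by (simp add: image_comp)
    have "(SUP i. \<integral>\<^sup>+x. U i x \<partial>?c) =
        (SUP i. ennreal t * (\<integral>\<^sup>+x. U i x \<partial>\<mu>) + ennreal (1 - t) * (\<integral>\<^sup>+x. U i x \<partial>\<nu>))"
      using seq by simp
    also have "\<dots> = (SUP i. ennreal t * (\<integral>\<^sup>+x. U i x \<partial>\<mu>)) + (SUP i. ennreal (1 - t) * (\<integral>\<^sup>+x. U i x \<partial>\<nu>))"
      by (rule ennreal_SUP_add) (use inc in \<open>auto simp: incseq_def intro!: mult_left_mono\<close>)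
    finally show ?case
      using seq(1) meas by (simp only: sup SUP_mult_left_ennreal)
  qed
qed

context martin_graph
begin

lemma C_set_X: "p \<in> minimal_rays \<Longrightarrow> p \<in> minimal_paths"
  and C_set_paths: "p \<in> minimal_rays \<Longrightarrow> p \<in> paths"
  by (auto simp: C_set_def X_set_def)

lemma X_set_harmonic: "p \<in> minimal_paths \<Longrightarrow> p \<in> harmonic_paths"
  by (simp add: X_set_iff)

lemma sets_borel_probs_on: "\<nu> \<in> borel_probs_on G Y \<Longrightarrow> sets \<nu> = path_sets"
  by (simp add: borel_probs_on_def)

lemma space_borel_probs_on: "\<nu> \<in> borel_probs_on G Y \<Longrightarrow> space \<nu> = paths"
  using sets_eq_imp_space_eq[OF sets_borel_probs_on] by simp

lemma AE_borel_probs_on: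
  assumes "\<nu> \<in> borel_probs_on G Y"
  shows "AE y in \<nu>. y \<in> Y"
proof -
  obtain B where B: "B \<in> path_sets" "B \<subseteq> Y" "emeasure \<nu> B = 1" and p: "prob_space \<nu>"
    using assms by (auto simp: borel_probs_on_def)
  then interpret prob_space \<nu> by simp
  have "AE y in \<nu>. y \<in> B"
    using B sets_borel_probs_on[OF assms] by (subst AE_in_set_eq_1) (auto simp: measure_def)
  then show ?thesis by eventually_elim (use B in auto)
qed

text \<open>Since \<open>\<nu>\<close> is carried by a Borel subset of \<open>Y\<close>, neither the
  restriction to \<open>Y\<close> nor the completion changes the integral.\<close>

lemma integrated_measure_eq_mixture:
  assumes Y: "Y \<subseteq> minimal_rays" and \<nu>: "\<nu> \<in> borel_probs_on G Y"
  shows "integrated Y \<nu> = mixture \<nu> (path_borel G) limit_measure"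
proof -
  have "(\<integral>\<^sup>+y\<in>Y. emeasure (ray_measure G F \<beta> v0 y) B \<partial>completion \<nu>) =
      (\<integral>\<^sup>+y. emeasure (limit_measure y) B \<partial>\<nu>)" for B
    unfolding nn_integral_completion
    by (rule nn_integral_cong_AE, use AE_borel_probs_on[OF \<nu>] in eventually_elim)
      (use Y ray_measure_eq C_set_X in auto)
  then show ?thesis by (simp add: integrated_measure_def mixture_def)
qed

lemma integrated_measure:
  assumes Y: "Y \<subseteq> minimal_rays" and \<nu>: "\<nu> \<in> borel_probs_on G Y"
  shows "semi_conformal (integrated Y \<nu>)"
    and "B \<in> path_sets \<Longrightarrow>
      emeasure (integrated Y \<nu>) B = (\<integral>\<^sup>+y. emeasure (limit_measure y) B \<partial>\<nu>)"
    and "v \<in> verts G \<Longrightarrow>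
      emeasure (integrated Y \<nu>) (cyl v) = (\<integral>\<^sup>+y. lower_limit v y \<partial>\<nu>)"
proof -
  have "emeasure \<nu> paths = 1"
    using \<nu> prob_space.emeasure_space_1[of \<nu>] space_borel_probs_on[OF \<nu>] by (simp add: borel_probs_on_def)
  then have fin: "emeasure \<nu> paths < \<infinity>" by simp
  note mix = mixture_limit_measure[OF sets_borel_probs_on[OF \<nu>] fin]
  show "semi_conformal (integrated Y \<nu>)"
    using mix(1) by (simp add: integrated_measure_eq_mixture[OF assms])
  show e: "emeasure (integrated Y \<nu>) B = (\<integral>\<^sup>+y. emeasure (limit_measure y) B \<partial>\<nu>)"
    if "B \<in> path_sets" for B
    using mix(2)[OF that] by (simp add: integrated_measure_eq_mixture[OF assms])
  show "emeasure (integrated Y \<nu>) (cyl v) = (\<integral>\<^sup>+y. lower_limit v y \<partial>\<nu>)"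
    if "v \<in> verts G"
    unfolding e[OF sets_vertex_cyl]
    by (rule nn_integral_cong_AE, use AE_borel_probs_on[OF \<nu>] in eventually_elim)
      (use Y C_set_X X_set_harmonic in \<open>auto simp: limit_measure_vertex_cyl[OF that] split: split_indicator\<close>)
qed

lemma integrated_measure_normalized:
  assumes Y: "Y \<subseteq> minimal_rays" and \<nu>: "\<nu> \<in> borel_probs_on G Y"
  shows "integrated Y \<nu> \<in> normalized_conformal G F \<beta> v0"
proof -
  let ?m = "integrated Y \<nu>"
  interpret prob_space \<nu> using \<nu> by (simp add: borel_probs_on_def)
  have "(\<integral>\<^sup>+y. lower_limit v0 y \<partial>\<nu>) = (\<integral>\<^sup>+y. 1 \<partial>\<nu>)"
    by (rule nn_integral_cong) (simp add: lower_limit_v0 space_borel_probs_on[OF \<nu>])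
  then have 1: "emeasure ?m (cyl v0) = 1"
    using emeasure_space_1 by (simp add: integrated_measure(3)[OF assms v0])
  have "emeasure ?m (cyl v0) \<le> emeasure ?m paths"
    using sets.top[of ?m] semi_conformalD(2)[OF integrated_measure(1)[OF assms]]
    by (intro emeasure_mono) (auto simp: vertex_cyl_def)
  then have "emeasure ?m paths \<noteq> 0" using 1 by auto
  then show ?thesis using 1 integrated_measure(1)[OF assms]
    by (simp add: normalized_conformal_def conformal_iff)
qed

definition ray_law :: "(nat \<Rightarrow> 'b) measure \<Rightarrow> (nat \<Rightarrow> 'b) measure" where
  "ray_law m = distr (density m (indicator (cyl v0))) (path_borel G) loop_erasure"

lemma sets_ray_law [simp]: "sets (ray_law m) = path_sets"
  and space_ray_law [simp]: "space (ray_law m) = paths"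
  by (simp_all add: ray_law_def)

lemma emeasure_ray_law:
  assumes sc: "semi_conformal m" and B: "B \<in> path_sets"
  shows "emeasure (ray_law m) B = emeasure m {p \<in> cyl v0. loop_erasure p \<in> B}"
proof -
  note [measurable_cong] = semi_conformalD(1)[OF sc] and [measurable] = B
  have "emeasure (ray_law m) B = emeasure m (cyl v0 \<inter> (loop_erasure -` B \<inter> space m))"
    unfolding ray_law_def by (simp add: emeasure_distr emeasure_restricted)
  also have "cyl v0 \<inter> (loop_erasure -` B \<inter> space m) = {p \<in> cyl v0. loop_erasure p \<in> B}"
    by (auto simp: semi_conformalD(2)[OF sc] vertex_cyl_def)
  finally show ?thesis .
qed

lemma sets_loop_erasure_vimage [measurable]:
  assumes [measurable]: "B \<in> path_sets"
  shows "{p \<in> cyl v0. loop_erasure p \<in> B} \<in> path_sets"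
proof -
  have "{p \<in> space (path_borel G). tail G (p 0) = v0 \<and> loop_erasure p \<in> B} \<in> path_sets"
    by measurable
  moreover have "{p \<in> space (path_borel G). tail G (p 0) = v0 \<and> loop_erasure p \<in> B} =
      {p \<in> cyl v0. loop_erasure p \<in> B}"
    by (auto simp: vertex_cyl_def)
  ultimately show ?thesis by metis
qed

lemma prob_space_ray_law:
  assumes "semi_conformal m" "emeasure m (cyl v0) = 1"
  shows "prob_space (ray_law m)"
proof (rule prob_spaceI)
  have "{p \<in> cyl v0. loop_erasure p \<in> paths} = cyl v0"
    using loop_erasure_in_paths by (auto simp: vertex_cyl_def)
  then show "emeasure (ray_law m) (space (ray_law m)) = 1"
    using emeasure_ray_law[OF assms(1), of "paths"] assms(2) sets.top[of "path_borel G"] by simp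
qed

lemma AE_loop_erasure:
  assumes "semi_conformal m"
  shows "AE p in m. p \<in> cyl v0 \<longrightarrow> loop_erasure p \<in> minimal_rays \<and> same_limit p (loop_erasure p)"
  using AE_transient[OF assms] AE_X_set[OF assms]
  by eventually_elim (use loop_erasure_in_C in blast)

context
  fixes T :: "(nat \<Rightarrow> 'b) \<Rightarrow> nat \<Rightarrow> 'b"
  assumes sel: "martin_selection G F \<beta> v0 T"
begin

lemma T_in_C: "p \<in> minimal_rays \<Longrightarrow> T p \<in> minimal_rays"
  using sel by (auto simp: martin_selection_def)

lemma T_image_subset: "T ` minimal_rays \<subseteq> minimal_rays"
  using T_in_C by blast

lemma T_same_limit: "p \<in> minimal_rays \<Longrightarrow> same_limit p (T p)"
  using sel martin_limit_eq_iff[OF C_set_X[OF T_in_C] C_set_X] by (auto simp: martin_selection_def)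

lemma T_eq_iff: "p \<in> minimal_rays \<Longrightarrow> q \<in> minimal_rays \<Longrightarrow> T p = T q \<longleftrightarrow> same_limit q p"
  using sel martin_limit_eq_iff[OF C_set_X C_set_X] by (auto simp: martin_selection_def)

text \<open>The ray selected for \<open>p\<close> has the same limit as \<open>p\<close>, so the same ray is
  selected for it.\<close>

lemma T_fixed:
  assumes "y \<in> T ` minimal_rays"
  shows "T y = y"
proof -
  obtain p where p: "p \<in> minimal_rays" "y = T p" using assms by blast
  have "T y = T p" using T_eq_iff[of y p] T_in_C[OF p(1)] p T_same_limit[OF p(1)] by simp
  then show ?thesis using p by simp
qed

lemma sets_T_vimage:
  assumes "B \<in> path_sets" "sets \<rho> = path_sets" "prob_space \<rho>"
  shows "T -` B \<inter> minimal_rays \<in> sets (completion \<rho>)"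
  using sel assms prob_space_imp_sigma_finite[OF assms(3)]
  by (auto simp: martin_selection_def universally_measurable_def)

text \<open>The representing measure is the law of the ray selected for the loop erasure. Since
  \<open>T\<close> is measurable only for the completion, it is replaced by a constant off a Borel
  set \<open>S\<close> of full measure. Neither \<open>T\<close> nor the loop erasure changes
  limits, so the vertex masses are those of \<open>m\<close> by \<open>invariant_integral\<close>.\<close>

lemma integrated_measure_surj:
  assumes m: "m \<in> normalized_conformal G F \<beta> v0"
  shows "\<exists>\<nu>\<in>borel_probs_on G (T ` minimal_rays). integrated (T ` minimal_rays) \<nu> = m"
proof -
  let ?C = "minimal_rays"
  have sc: "semi_conformal m" and m1: "emeasure m (cyl v0) = 1"
    using m by (auto simp: normalized_conformal_def conformal_iff)
  note [measurable_cong] = semi_conformalD(1)[OF sc]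
  define \<rho> where "\<rho> = ray_law m"
  have \<rho>: "sets \<rho> = path_sets" "space \<rho> = paths" by (simp_all add: \<rho>_def)
  note [measurable_cong] = \<rho>(1)
  interpret \<rho>: prob_space \<rho> unfolding \<rho>_def by (rule prob_space_ray_law[OF sc m1])
  have "?C = T -` paths \<inter> ?C" using T_in_C C_set_paths by auto
  then have "?C \<in> sets (completion \<rho>)"
    using sets_T_vimage[OF _ \<rho>(1) \<rho>.prob_space_axioms, of "paths"] sets.top[of "path_borel G"] by simp
  then obtain S N N' where C: "?C = S \<union> N" "N \<subseteq> N'" "N' \<in> null_sets \<rho>" "S \<in> sets \<rho>"
    by (rule sets_completionE)
  have AE_C: "AE q in \<rho>. q \<in> S \<union> N'"
  proof -
    have S': "S \<union> N' \<in> path_sets" using C \<rho>(1) by auto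
    have "emeasure \<rho> (S \<union> N') = emeasure m {p \<in> cyl v0. loop_erasure p \<in> S \<union> N'}"
      unfolding \<rho>_def by (rule emeasure_ray_law[OF sc S'])
    also have "\<dots> = emeasure m (cyl v0)"
    proof (rule emeasure_eq_AE)
      show "AE p in m. p \<in> {p \<in> cyl v0. loop_erasure p \<in> S \<union> N'} \<longleftrightarrow> p \<in> cyl v0"
        using AE_loop_erasure[OF sc] by eventually_elim (use C in auto)
    qed (use sets_loop_erasure_vimage[OF S'] semi_conformalD(1)[OF sc] in auto)
    finally have "emeasure \<rho> (S \<union> N') = 1" using m1 by simp
    then show ?thesis using S' \<rho>(1) by (subst \<rho>.AE_in_set_eq_1) (auto simp: measure_def)
  qed
  then have AE_S: "AE q in \<rho>. q \<in> S"
    using AE_not_in[OF C(3)] by eventually_elim auto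
  have SC: "S \<subseteq> ?C" using C by auto
  obtain x0 where x0: "x0 \<in> paths"
    using \<rho>.not_empty \<rho>(2) by auto
  define T' where "T' q = (if q \<in> S then T q else x0)" for q
  have T': "T' \<in> measurable (completion \<rho>) (path_borel G)"
  proof (rule measurableI)
    show "T' q \<in> space (path_borel G)" for q
      using SC T_in_C C_set_paths x0 by (auto simp: T'_def)
    fix B assume B: "B \<in> path_sets"
    have "T' -` B \<inter> space (completion \<rho>) =
        (T -` B \<inter> ?C) \<inter> S \<union> (if x0 \<in> B then space (completion \<rho>) - S else {})"
      using SC C_set_paths \<rho>(2) by (auto simp: T'_def split: if_splits)
    also have "\<dots> \<in> sets (completion \<rho>)"
      using sets_T_vimage[OF B \<rho>(1) \<rho>.prob_space_axioms] sets_completionI_sets[OF C(4)] by auto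
    finally show "T' -` B \<inter> space (completion \<rho>) \<in> sets (completion \<rho>)" .
  qed
  have AE_T': "AE q in completion \<rho>. q \<in> S \<and> T' q = T q"
    using AE_completion[OF AE_S] by eventually_elim (simp add: T'_def)
  define \<nu> where "\<nu> = distr (completion \<rho>) (path_borel G) T'"
  have \<nu>: "sets \<nu> = path_sets" "space \<nu> = paths" by (simp_all add: \<nu>_def)
  have "prob_space (completion \<rho>)"
    by (rule prob_spaceI) (simp add: emeasure_completion \<rho>.emeasure_space_1)
  then interpret \<nu>: prob_space \<nu>
    unfolding \<nu>_def by (rule prob_space.prob_space_distr[OF _ T'])
  have prob: "\<nu> \<in> borel_probs_on G (T ` ?C)"
  proof -
    have "universally_measurable G (T ` ?C)" using sel by (simp add: martin_selection_def)
    then have "T ` ?C \<in> sets (completion \<nu>)"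
      using \<nu>(1) prob_space_imp_sigma_finite[OF \<nu>.prob_space_axioms] by (auto simp: universally_measurable_def)
    then obtain R M M' where R: "T ` ?C = R \<union> M" "M \<subseteq> M'" "M' \<in> null_sets \<nu>" "R \<in> sets \<nu>"
      by (rule sets_completionE)
    have R': "R \<in> path_sets" "M' \<in> path_sets" using R \<nu>(1) by auto
    have "AE q in completion \<rho>. T' q \<in> R \<union> M'"
      using AE_T' by eventually_elim (use SC R in auto)
    moreover have "(AE y in \<nu>. y \<in> R \<union> M') \<longleftrightarrow> (AE q in completion \<rho>. T' q \<in> R \<union> M')"
      unfolding \<nu>_def
    proof (rule AE_distr_iff[OF T'])
      have "{y \<in> space (path_borel G). y \<in> R \<union> M'} = R \<union> M'"
        using sets.sets_into_space[OF R'(1)] sets.sets_into_space[OF R'(2)] by blast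
      then show "{y \<in> space (path_borel G). y \<in> R \<union> M'} \<in> path_sets"
        using sets.Un[OF R'] by (simp only:)
    qed
    ultimately have "AE y in \<nu>. y \<in> R \<union> M'" by blast
    then have "AE y in \<nu>. y \<in> R"
      using AE_not_in[OF R(3)] by eventually_elim auto
    then have "emeasure \<nu> R = 1"
      using R(4) by (intro \<nu>.emeasure_eq_1_AE) auto
    then show ?thesis
      using R R' \<nu> \<nu>.prob_space_axioms by (auto simp: borel_probs_on_def)
  qed
  have "integrated (T ` ?C) \<nu> = m"
  proof (rule semi_conformal_eqI[OF integrated_measure(1)[OF T_image_subset prob] sc])
    fix v assume v: "v \<in> verts G"
    have "emeasure (integrated (T ` ?C) \<nu>) (cyl v) = (\<integral>\<^sup>+y. lower_limit v y \<partial>\<nu>)"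
      by (rule integrated_measure(3)[OF T_image_subset prob v])
    also have "\<dots> = (\<integral>\<^sup>+q. lower_limit v (T' q) \<partial>completion \<rho>)"
      unfolding \<nu>_def by (rule nn_integral_distr[OF T']) simp
    also have "\<dots> = (\<integral>\<^sup>+q. lower_limit v q \<partial>completion \<rho>)"
      by (rule nn_integral_cong_AE, use AE_T' in eventually_elim)
        (use T_same_limit SC v in \<open>auto simp: same_limit_def\<close>)
    also have "\<dots> = (\<integral>\<^sup>+q. lower_limit v q \<partial>\<rho>)" by (rule nn_integral_completion)
    also have "\<dots> = (\<integral>\<^sup>+p. lower_limit v (loop_erasure p) \<partial>density m (indicator (cyl v0)))"
      unfolding \<rho>_def ray_law_def by (rule nn_integral_distr) measurable
    also have "\<dots> = (\<integral>\<^sup>+p\<in>cyl v0. lower_limit v (loop_erasure p) \<partial>m)"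
      by (subst nn_integral_density) (measurable, simp add: mult.commute)
    also have "\<dots> = (\<integral>\<^sup>+p\<in>cyl v0 \<inter> paths. lower_limit v p \<partial>m)"
      by (rule nn_integral_cong_AE, use AE_loop_erasure[OF sc] in eventually_elim)
        (use v in \<open>auto simp: same_limit_def vertex_cyl_def split: split_indicator\<close>)
    also have "\<dots> = emeasure m (cyl v \<inter> paths)"
      by (rule invariant_integral[OF sc v shift_invariant_paths])
    also have "cyl v \<inter> paths = cyl v" by (auto simp: vertex_cyl_def)
    finally show "emeasure (integrated (T ` ?C) \<nu>) (cyl v) = emeasure m (cyl v)" .
  qed
  then show ?thesis using prob by blast
qed

text \<open>Almost every path under \<open>limit_measure y\<close> has the limit of \<open>y\<close>, as
  \<open>y\<close> has a minimal limit.\<close>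

lemma AE_limit_measure_selected:
  assumes y: "y \<in> T ` minimal_rays"
  shows "AE p in limit_measure y. p \<in> cyl v0 \<longrightarrow>
    loop_erasure p \<in> minimal_rays \<and> T (loop_erasure p) = y"
proof -
  note sc = semi_conformal_limit_measure[of y]
  have yC: "y \<in> minimal_rays" using y T_image_subset by blast
  then have "AE p in limit_measure y. same_limit y p" using C_set_X by (auto simp: X_set_iff)
  then show ?thesis
    using AE_loop_erasure[OF sc]
  proof eventually_elim
    case (elim p)
    show ?case
    proof
      assume "p \<in> cyl v0"
      then have q: "loop_erasure p \<in> minimal_rays" "same_limit p (loop_erasure p)" using elim(2) by auto
      then have "same_limit y (loop_erasure p)" using elim(1) by (simp add: same_limit_def)
      then have "T (loop_erasure p) = T y" using T_eq_iff[OF q(1) yC] by simp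
      then show "loop_erasure p \<in> minimal_rays \<and> T (loop_erasure p) = y"
        using q(1) T_fixed[OF y] by simp
    qed
  qed
qed

text \<open>Let \<open>\<rho>\<close> be the law of the loop erasure under the common mixture. The rays that
  are selected into \<open>B\<close> form a set squeezed between Borel sets \<open>S\<close> and
  \<open>S \<union> N'\<close> of equal \<open>\<rho>\<close>-measure. If \<open>y\<close> lies in
  \<open>B\<close>, then \<open>limit_measure y\<close> gives full mass to paths with loop erasure
  in \<open>S \<union> N'\<close>; otherwise it gives no mass to paths with loop erasure in
  \<open>S\<close>. Integrating the first over \<open>\<nu>1\<close> and the second over
  \<open>\<nu>2\<close> yields the two halves of the inequality.\<close>

lemma integrated_measure_determines_le:
  assumes \<nu>1: "\<nu>1 \<in> borel_probs_on G (T ` minimal_rays)" and \<nu>2: "\<nu>2 \<in> borel_probs_on G (T ` minimal_rays)"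
    and eq: "integrated (T ` minimal_rays) \<nu>1 = integrated (T ` minimal_rays) \<nu>2"
    and B: "B \<in> path_sets"
  shows "emeasure \<nu>1 B \<le> emeasure \<nu>2 B"
proof -
  let ?C = "minimal_rays"
  define m where "m = integrated (T ` ?C) \<nu>1"
  have sc: "semi_conformal m" unfolding m_def by (rule integrated_measure(1)[OF T_image_subset \<nu>1])
  have m1: "emeasure m (cyl v0) = 1"
    using integrated_measure_normalized[OF T_image_subset \<nu>1] by (simp add: m_def normalized_conformal_def)
  define \<rho> where "\<rho> = ray_law m"
  have \<rho>: "sets \<rho> = path_sets" by (simp add: \<rho>_def)
  interpret \<rho>: prob_space \<rho> unfolding \<rho>_def by (rule prob_space_ray_law[OF sc m1])
  obtain S N N' where S: "T -` B \<inter> ?C = S \<union> N" "N \<subseteq> N'" "N' \<in> null_sets \<rho>" "S \<in> sets \<rho>"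
    using sets_T_vimage[OF B \<rho> \<rho>.prob_space_axioms] by (rule sets_completionE)
  have S_sets: "S \<in> path_sets" "S \<union> N' \<in> path_sets" using S \<rho> by auto
  let ?L = "\<lambda>A. {p \<in> cyl v0. loop_erasure p \<in> A}"
  have \<rho>_int: "emeasure \<rho> A = (\<integral>\<^sup>+y. emeasure (limit_measure y) (?L A) \<partial>\<nu>)"
    if A: "A \<in> path_sets" and \<nu>: "\<nu> \<in> {\<nu>1, \<nu>2}" for A \<nu>
  proof -
    have "\<nu> \<in> borel_probs_on G (T ` ?C)" "m = integrated (T ` ?C) \<nu>"
      using \<nu> \<nu>1 \<nu>2 eq by (auto simp: m_def)
    then show ?thesis
      unfolding \<rho>_def emeasure_ray_law[OF sc A]
      using integrated_measure(2)[OF T_image_subset _ sets_loop_erasure_vimage[OF A]] by simp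
  qed
  have one: "emeasure (limit_measure y) (cyl v0) = 1" if "y \<in> T ` ?C" for y
  proof -
    have "y \<in> ?C" using that T_image_subset by blast
    then show ?thesis
      using X_set_harmonic[OF C_set_X] lower_limit_v0[OF C_set_paths]
      by (simp add: limit_measure_vertex_cyl[OF v0])
  qed
  have hit: "emeasure (limit_measure y) (?L (S \<union> N')) = 1" if y: "y \<in> T ` ?C" "y \<in> B" for y
  proof -
    have "emeasure (limit_measure y) (?L (S \<union> N')) = emeasure (limit_measure y) (cyl v0)"
    proof (rule emeasure_eq_AE)
      show "AE p in limit_measure y. p \<in> ?L (S \<union> N') \<longleftrightarrow> p \<in> cyl v0"
        using AE_limit_measure_selected[OF y(1)]
      proof eventually_elim
        case (elim p)
        have "loop_erasure p \<in> S \<union> N" if "p \<in> cyl v0"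
          using elim that y(2) unfolding S(1)[symmetric] by auto
        then show ?case using S(2) by blast
      qed
    qed (use sets_loop_erasure_vimage[OF S_sets(2)] in auto)
    then show ?thesis using one[OF y(1)] by simp
  qed
  have miss: "emeasure (limit_measure y) (?L S) \<le> indicator B y" if y: "y \<in> T ` ?C" for y
  proof (cases "y \<in> B")
    case True
    have "emeasure (limit_measure y) (?L S) \<le> emeasure (limit_measure y) (cyl v0)"
      by (rule emeasure_mono) auto
    then show ?thesis using True one[OF y] by simp
  next
    case False
    have "emeasure (limit_measure y) (?L S) = emeasure (limit_measure y) {}"
    proof (rule emeasure_eq_AE)
      show "AE p in limit_measure y. p \<in> ?L S \<longleftrightarrow> p \<in> {}"
        using AE_limit_measure_selected[OF y]
      proof eventually_elim
        case (elim p)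
        have "loop_erasure p \<notin> S \<union> N" if "p \<in> cyl v0"
          using elim that False unfolding S(1)[symmetric] by auto
        then show ?case by blast
      qed
    qed (use sets_loop_erasure_vimage[OF S_sets(1)] in auto)
    then show ?thesis by simp
  qed
  have "emeasure \<nu>1 B = (\<integral>\<^sup>+y. indicator B y \<partial>\<nu>1)"
    using B sets_borel_probs_on[OF \<nu>1] by simp
  also have "\<dots> \<le> (\<integral>\<^sup>+y. emeasure (limit_measure y) (?L (S \<union> N')) \<partial>\<nu>1)"
    by (rule nn_integral_mono_AE, use AE_borel_probs_on[OF \<nu>1] in eventually_elim)
      (use hit in \<open>auto split: split_indicator\<close>)
  also have "\<dots> = emeasure \<rho> (S \<union> N')" by (rule \<rho>_int[OF S_sets(2), of \<nu>1, symmetric]) simp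
  also have "\<dots> = emeasure \<rho> S" by (rule emeasure_Un_null_set[OF S(4,3)])
  also have "\<dots> = (\<integral>\<^sup>+y. emeasure (limit_measure y) (?L S) \<partial>\<nu>2)" by (rule \<rho>_int[OF S_sets(1)]) simp
  also have "\<dots> \<le> (\<integral>\<^sup>+y. indicator B y \<partial>\<nu>2)"
    by (rule nn_integral_mono_AE, use AE_borel_probs_on[OF \<nu>2] in eventually_elim) (rule miss)
  also have "\<dots> = emeasure \<nu>2 B" using B sets_borel_probs_on[OF \<nu>2] by simp
  finally show ?thesis .
qed

lemma integrated_measure_inj:
  "inj_on (integrated (T ` minimal_rays)) (borel_probs_on G (T ` minimal_rays))"
proof (rule inj_onI)
  fix \<nu>1 \<nu>2
  assume \<nu>: "\<nu>1 \<in> borel_probs_on G (T ` minimal_rays)" "\<nu>2 \<in> borel_probs_on G (T ` minimal_rays)"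
    and eq: "integrated (T ` minimal_rays) \<nu>1 = integrated (T ` minimal_rays) \<nu>2"
  show "\<nu>1 = \<nu>2"
  proof (rule measure_eqI)
    show "sets \<nu>1 = sets \<nu>2" using \<nu> by (simp add: sets_borel_probs_on)
    fix B assume "B \<in> sets \<nu>1"
    then have B: "B \<in> path_sets" using sets_borel_probs_on[OF \<nu>(1)] by simp
    show "emeasure \<nu>1 B = emeasure \<nu>2 B"
      using integrated_measure_determines_le[OF \<nu> eq B]
        integrated_measure_determines_le[OF \<nu>(2,1) eq[symmetric] B] by (rule antisym)
  qed
qed

lemma integrated_measure_bij:
  "bij_betw (integrated (T ` minimal_rays))
     (borel_probs_on G (T ` minimal_rays)) (normalized_conformal G F \<beta> v0)"
  unfolding bij_betw_def
proof (intro conjI integrated_measure_inj equalityI subsetI)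
  fix m assume "m \<in> integrated (T ` minimal_rays) ` borel_probs_on G (T ` minimal_rays)"
  then show "m \<in> normalized_conformal G F \<beta> v0"
    using integrated_measure_normalized[OF T_image_subset] by blast
next
  fix m assume "m \<in> normalized_conformal G F \<beta> v0"
  from integrated_measure_surj[OF this]
  show "m \<in> integrated (T ` minimal_rays) ` borel_probs_on G (T ` minimal_rays)"
    by blast
qed

end

lemma convex_comb_borel_probs_on:
  assumes \<mu>: "\<mu> \<in> borel_probs_on G Y" and \<nu>: "\<nu> \<in> borel_probs_on G Y" and t: "0 \<le> t" "t \<le> 1"
  shows "convex_comb t \<mu> \<nu> \<in> borel_probs_on G Y"
proof -
  have sets: "sets \<nu> = sets \<mu>" using \<mu> \<nu> by (simp add: sets_borel_probs_on)
  note c = emeasure_convex_comb[OF sets t]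
  have sum1: "ennreal t * 1 + ennreal (1 - t) * 1 = 1"
    using t by (simp add: ennreal_plus[symmetric] del: ennreal_plus)
  obtain A B where A: "A \<in> path_sets" "A \<subseteq> Y" "emeasure \<mu> A = 1"
    and B: "B \<in> path_sets" "B \<subseteq> Y" "emeasure \<nu> B = 1"
    and p: "prob_space \<mu>" "prob_space \<nu>"
    using \<mu> \<nu> by (auto simp: borel_probs_on_def)
  have sup1: "emeasure M (A \<union> B) = 1" if "prob_space M" "sets M = path_sets"
    "emeasure M A = 1 \<or> emeasure M B = 1" for M
  proof (rule antisym)
    show "emeasure M (A \<union> B) \<le> 1" using emeasure_space[of M "A \<union> B"] prob_space.emeasure_space_1[OF that(1)] by simp
    show "1 \<le> emeasure M (A \<union> B)"
      using emeasure_mono[of A "A \<union> B" M] emeasure_mono[of B "A \<union> B" M] that A B by auto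
  qed
  have AB: "A \<union> B \<in> sets \<mu>" using A B sets_borel_probs_on[OF \<mu>] by simp
  have "emeasure (convex_comb t \<mu> \<nu>) (A \<union> B) = 1"
    unfolding c(2)[OF AB] sup1[OF p(1) sets_borel_probs_on[OF \<mu>] disjI1[OF A(3)]]
      sup1[OF p(2) sets_borel_probs_on[OF \<nu>] disjI2[OF B(3)]] by (rule sum1)
  moreover have "prob_space (convex_comb t \<mu> \<nu>)"
  proof (rule prob_spaceI)
    have sp: "space (convex_comb t \<mu> \<nu>) = space \<mu>" "space \<nu> = space \<mu>"
      using sets_eq_imp_space_eq[OF c(1)] sets_eq_imp_space_eq[OF sets] .
    have "emeasure \<mu> (space \<mu>) = 1" "emeasure \<nu> (space \<mu>) = 1"
      using prob_space.emeasure_space_1[OF p(1)] prob_space.emeasure_space_1[OF p(2)] unfolding sp(2) .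
    then show "emeasure (convex_comb t \<mu> \<nu>) (space (convex_comb t \<mu> \<nu>)) = 1"
      unfolding sp(1) c(2)[OF sets.top] by (simp only: sum1)
  qed
  moreover have "sets (convex_comb t \<mu> \<nu>) = path_sets"
    using c(1) sets_borel_probs_on[OF \<mu>] by (rule trans)
  moreover have "A \<union> B \<in> path_sets" "A \<union> B \<subseteq> Y"
    using A B by (auto intro: sets.Un)
  ultimately show ?thesis
    unfolding borel_probs_on_def by blast
qed

lemma integrated_measure_affine:
  assumes Y: "Y \<subseteq> minimal_rays"
  shows "affine_measure_map (borel_probs_on G Y) (integrated Y)"
  unfolding affine_measure_map_def
proof (intro ballI conjI)
  fix \<mu> \<nu> and t :: real
  assume \<mu>: "\<mu> \<in> borel_probs_on G Y" and \<nu>: "\<nu> \<in> borel_probs_on G Y" and "t \<in> {0..1}"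
  then have t: "0 \<le> t" "t \<le> 1" by auto
  show c: "convex_comb t \<mu> \<nu> \<in> borel_probs_on G Y"
    by (rule convex_comb_borel_probs_on[OF \<mu> \<nu> t])
  let ?\<Phi> = "integrated Y"
  have s: "sets (?\<Phi> \<kappa>) = path_sets" if "\<kappa> \<in> borel_probs_on G Y" for \<kappa>
    by (rule semi_conformalD(1)[OF integrated_measure(1)[OF Y that]])
  have sets: "sets (?\<Phi> \<nu>) = sets (?\<Phi> \<mu>)" "sets \<nu> = sets \<mu>"
    using s \<mu> \<nu> by (simp_all add: sets_borel_probs_on)
  note e = emeasure_convex_comb[OF sets(1) t]
  show "?\<Phi> (convex_comb t \<mu> \<nu>) = convex_comb t (?\<Phi> \<mu>) (?\<Phi> \<nu>)"
  proof (rule measure_eqI)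
    show "sets (?\<Phi> (convex_comb t \<mu> \<nu>)) = sets (convex_comb t (?\<Phi> \<mu>) (?\<Phi> \<nu>))"
      using s[OF c] s[OF \<mu>] e(1) by simp
    fix B assume "B \<in> sets (?\<Phi> (convex_comb t \<mu> \<nu>))"
    then have B: "B \<in> path_sets" using s[OF c] by simp
    have "(\<lambda>y. emeasure (limit_measure y) B) \<in> borel_measurable \<mu>"
      using measurable_limit_measure[OF B] by (simp add: measurable_cong_sets[OF sets_borel_probs_on[OF \<mu>] refl])
    from nn_integral_convex_comb[OF sets(2) t this]
    show "emeasure (?\<Phi> (convex_comb t \<mu> \<nu>)) B = emeasure (convex_comb t (?\<Phi> \<mu>) (?\<Phi> \<nu>)) B"
      using e(2)[of B] B s[OF \<mu>] integrated_measure(2)[OF Y _ B] \<mu> \<nu> c by simp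
  qed
qed

end

theorem theorem11p7:
  fixes G :: "('v, 'a) pre_digraph"
    and F :: "'a \<Rightarrow> real"
    and \<beta> :: real
    and v0 :: 'v
    and T :: "(nat \<Rightarrow> 'a) \<Rightarrow> nat \<Rightarrow> 'a"
    and Y :: "(nat \<Rightarrow> 'a) set"
  assumes "countable_digraph G"
    and "v0 \<in> verts G"
    and "\<forall>v\<in>verts G. 0 < (\<Sum>n. mat_pow G F \<beta> n v0 v) \<and> (\<Sum>n. mat_pow G F \<beta> n v0 v) < \<infinity>"
    and "martin_selection G F \<beta> v0 T"
    and "Y = T ` C_set G F \<beta> v0"
  shows "bij_betw (integrated_measure G F \<beta> v0 Y)
           (borel_probs_on G Y) (normalized_conformal G F \<beta> v0)
       \<and> affine_measure_map (borel_probs_on G Y) (integrated_measure G F \<beta> v0 Y)"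
proof -
  interpret countable_digraph G by (rule assms(1))
  interpret martin_graph G F \<beta> v0
    by unfold_locales (use assms(2,3) in \<open>auto simp: green_def\<close>)
  show ?thesis
    unfolding assms(5)
    using integrated_measure_bij[OF assms(4)] integrated_measure_affine[OF T_image_subset[OF assms(4)]] ..
qed

end
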